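(* Let $n\ge 3$ and $$\lambda_n=\frac{n^2(n^3-6n^2+15n-12)}{3(n-1)^2}.$$ The maximum $J_n^+$ of $\mathrm{JB}_n$ over $\Omega_n$ is attained exactly at the $2n$ single-outlier directions (the vectors $\pm\{n(n-1)\}^{-1/2}(n-1,-1,\dots,-1)'$ and their coordinate permutations), and at each of them the (Riemannian) Hessian of $\mathrm{JB}_n$ on $\Omega_n$ is $-\lambda_n$ times the identity. Consequently, with $d=n-2$ the dimension of $\Omega_n$ and $U$ uniformly distributed on $\Omega_n$, as $\varepsilon\downarrow 0$, $$P\bigl(\mathrm{JB}_n(U)>J_n^+-\varepsilon\bigr)=c_n\Bigl(\frac{2\varepsilon}{\lambda_n}\Bigr)^{d/2}\{1+o(1)\},\qquad c_n=\frac{n\,\Gamma\{(n-1)/2\}}{\pi^{1/2}\,\Gamma(n/2)},$$ and, as $x\uparrow J_n^+$, the density $f_{\mathrm{JB}_n}$ of $\mathrm{JB}_n(U)$ satisfies $$f_{\mathrm{JB}_n}(x)=\frac{n\,\Gamma\{(n-1)/2\}}{\pi^{1/2}\,\Gamma\{(n-2)/2\}}\Bigl(\frac{2}{\lambda_n}\Bigr)^{d/2}(J_n^+-x)^{d/2-1}\{1+o(1)\}.$$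
   Context: For $u\in\mathbb{R}^n$ write $p_r(u)=\sum_{i=1}^n u_i^r$. $\Omega_n=\{u\in\mathbb{R}^n:\ p_1(u)=0,\ p_2(u)=1\}$ is the unit sphere (of dimension $n-2$) in the hyperplane $\{\sum_i u_i=0\}$, with the metric induced from $\mathbb{R}^n$. For $u\in\Omega_n$, $$\mathrm{JB}_n(u)=\frac{n^2}{6}p_3(u)^2+\frac{n}{24}\bigl(n p_4(u)-3\bigr)^2 ,$$ and $J_n^+=\max_{u\in\Omega_n}\mathrm{JB}_n(u)=\dfrac{n\{(n-2)^4+4(n-1)^2\}}{24(n-1)^2}$. (Under independent normal sampling the Jarque--Bera statistic is distributed as $\mathrm{JB}_n(U)$ with $U$ uniform on $\Omega_n$.) *)

theory Defs
  imports "HOL-Probability.Probability"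
begin

definition power_sum :: "nat \<Rightarrow> real ^ 'n \<Rightarrow> real" where
  "power_sum r u = (\<Sum>i\<in>UNIV. (u $ i) ^ r)"

definition Omega :: "(real ^ 'n) set" where
  "Omega = {u. power_sum 1 u = 0 \<and> power_sum 2 u = 1}"

definition JB :: "real ^ 'n \<Rightarrow> real" where
  "JB u = (real CARD('n))\<^sup>2 / 6 * (power_sum 3 u)\<^sup>2
        + real CARD('n) / 24 * (real CARD('n) * power_sum 4 u - 3)\<^sup>2"

definition J_plus :: "nat \<Rightarrow> real" where
  "J_plus n = real n * ((real n - 2) ^ 4 + 4 * (real n - 1)\<^sup>2) / (24 * (real n - 1)\<^sup>2)"

definition lambda_n :: "nat \<Rightarrow> real" where
  "lambda_n n = (real n)\<^sup>2 * (real n ^ 3 - 6 * (real n)\<^sup>2 + 15 * real n - 12)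
                  / (3 * (real n - 1)\<^sup>2)"

definition c_n :: "nat \<Rightarrow> real" where
  "c_n n = real n * Gamma ((real n - 1) / 2) / (sqrt pi * Gamma (real n / 2))"

text \<open>The permutations of the vector with entries \<open>n - 1, -1, \<dots>, -1\<close> are indexed by the
  position \<open>i\<close> of the entry \<open>n - 1\<close>.\<close>

definition outlier :: "'n \<Rightarrow> real ^ 'n" where
  "outlier i = (1 / sqrt (real CARD('n) * (real CARD('n) - 1))) *\<^sub>R
                 (\<chi> j. if j = i then real CARD('n) - 1 else - 1)"

definition outliers :: "(real ^ 'n) set" where
  "outliers = range outlier \<union> range (\<lambda>i. - outlier i)"

text \<open>The tangent space of \<^term>\<open>Omega\<close> at \<open>u\<close> is the common kernel of the differentials at \<open>u\<close>
  of the two constraints.\<close>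

definition tangent :: "real ^ 'n \<Rightarrow> (real ^ 'n) set" where
  "tangent u = {v. (\<Sum>i\<in>UNIV. v $ i) = 0 \<and> u \<bullet> v = 0}"

text \<open>Derivatives taken \<open>within\<close> \<^term>\<open>Omega\<close> depend only on the restriction to \<^term>\<open>Omega\<close> and
  are determined on tangent vectors; hence the gradient below, being tangent, is unique.\<close>

definition has_riemannian_gradient :: "(real ^ 'n \<Rightarrow> real) \<Rightarrow> real ^ 'n \<Rightarrow> real ^ 'n \<Rightarrow> bool" where
  "has_riemannian_gradient f u g \<longleftrightarrow>
     g \<in> tangent u \<and> (f has_derivative (\<lambda>v. g \<bullet> v)) (at u within Omega)"

text \<open>The Hessian operator at \<open>u\<close> is \<open>v \<mapsto> \<nabla>\<^sub>v grad f\<close> on the tangent space, where the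
  Levi-Civita connection of the induced metric is the orthogonal projection onto the
  tangent space of the derivative in the ambient space. The values of \<open>H\<close> off the tangent space
  are irrelevant.\<close>

definition has_riemannian_hessian ::
    "(real ^ 'n \<Rightarrow> real) \<Rightarrow> real ^ 'n \<Rightarrow> (real ^ 'n \<Rightarrow> real ^ 'n) \<Rightarrow> bool" where
  "has_riemannian_hessian f u H \<longleftrightarrow>
     (\<exists>G D. (\<forall>x\<in>Omega. has_riemannian_gradient f x (G x)) \<and>
            (G has_derivative D) (at u within Omega) \<and>
            (\<forall>v\<in>tangent u. H v \<in> tangent u \<and> (\<forall>w\<in>tangent u. H v \<bullet> w = D v \<bullet> w)))"

text \<open>The uniform distribution on the sphere \<^term>\<open>Omega\<close> is its rotation-invariant probability
  distribution. The isometries of \<^term>\<open>Omega\<close> are the restrictions of the orthogonal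
  transformations of the ambient space that map \<^term>\<open>Omega\<close> onto itself.\<close>

definition uniform_on_Omega :: "'a measure \<Rightarrow> ('a \<Rightarrow> real ^ 'n) \<Rightarrow> bool" where
  "uniform_on_Omega M U \<longleftrightarrow>
     U \<in> borel_measurable M \<and> (AE x in M. U x \<in> Omega) \<and>
     (\<forall>T. orthogonal_transformation T \<and> T ` Omega = Omega \<longrightarrow>
          distr M borel (\<lambda>x. T (U x)) = distr M borel U)"

end

theory Submission
  imports Defs "HOL-Real_Asymp.Real_Asymp"
begin

text \<open>
  With \<open>s = n p\<^sub>3\<^sup>2\<close> and \<open>k = n p\<^sub>4\<close> one has \<open>24 JB / n = 4 s + (k - 3)\<^sup>2\<close>. Pearson's inequality
  \<open>s \<le> k - 1\<close> and the nonnegativity of \<open>\<Sum> (A\<^sup>2 - u\<^sub>i\<^sup>2)(u\<^sub>i \<plusminus> b)\<^sup>2\<close>, where \<open>A\<close> and \<open>-b\<close> are the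
  entries of an outlier direction, confine \<open>(\<surd>s, k)\<close> to a planar region in which the convex
  function \<open>4 s + (k - 3)\<^sup>2\<close> is maximal only at the outlier value; equality in Pearson's
  inequality forces \<open>u\<close> to take two values.

  An invariant distribution on the sphere is unique, so \<open>U\<close> is distributed as the direction of
  a centred standard Gaussian vector. Its \<open>JB\<close> value has a density because \<open>JB\<close> is a nonconstant
  rational function along almost every line parallel to an outlier direction. Near the maximum
  the vector lies in one of \<open>2n\<close> disjoint cones; along a ray \<open>e + s w\<close> leaving the
  axis \<open>e\<close> of such a cone, \<open>JB = J\<^sup>+ - \<lambda> \<bar>w\<bar>\<^sup>2 s\<^sup>2 / 2 + O(s\<^sup>3)\<close> is strictly decreasing in \<open>s\<close>. Substituting the value of
  \<open>JB\<close> for \<open>s\<close> yields a continuous density, and dominated convergence its leading term.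
\<close>

section \<open>Orthogonal transformations and invariant measures\<close>

text \<open>A density is determined only up to null sets, so pointwise asymptotics require one
  explicit continuous version. The push-forward is computed exactly only near the maximum; absolute
  continuity supplies a density on the rest of the line, and the two are glued. For n = 3 the factor
  \<open>(J - t) powr ((n - 4) / 2)\<close> has exponent -1/2 and is unbounded; it is therefore
  split off throughout, and dominated convergence is applied to the remaining factor, which has a
  limit. The Gaussian vector lives in all of \<open>real ^ 'n\<close>: the direction of
  \<open>1\<close> is killed by \<open>center\<close> and integrates out, so neither coordinates on
  the hyperplane nor a surface measure on \<open>Omega\<close> have to be chosen. Origin of the
  constants, with d = n - 2: a small cap of radius r about one point has probability about
  \<open>cone_mass n\<close> times r^d. At level J - \<epsilon> the radius satisfies r^2 = 2
  \<epsilon> / \<lambda>, and 2 n caps give \<open>c_n n = 2 * n * cone_mass n\<close>.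
  Differentiation in \<epsilon> contributes the factor d / 2 of the density constant.\<close>

lemma reflection_exists:
  fixes a b :: "'a::euclidean_space"
  assumes "norm a = norm b"
  obtains T where "orthogonal_transformation T" "T a = b" "\<And>x. x \<bullet> a = x \<bullet> b \<Longrightarrow> T x = x"
proof (cases "a = b")
  case True
  then show ?thesis
    by (intro that[of "\<lambda>x. x"]) (auto simp: orthogonal_transformation_def)
next
  case False
  define c where "c = a - b"
  have c: "c \<bullet> c \<noteq> 0"
    using False by (simp add: c_def)
  \<comment> \<open>Householder reflection in the hyperplane orthogonal to \<open>a - b\<close>. It
    swaps \<open>a\<close> and \<open>b\<close> because their norms agree, and it fixes every vector
    having the same inner product with both.\<close>
  define T where "T x = x - (2 * (x \<bullet> c) / (c \<bullet> c)) *\<^sub>R c" for x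
  have "linear T"
    unfolding T_def
    by (intro linearI) (simp_all add: algebra_simps inner_add_left add_divide_distrib)
  moreover have "T v \<bullet> T w = v \<bullet> w" for v w
    using c by (simp add: T_def algebra_simps inner_commute power2_eq_square[symmetric])
  ultimately have "orthogonal_transformation T"
    by (simp add: orthogonal_transformation_def)
  moreover have "T a = b"
  proof -
    have "a \<bullet> a = b \<bullet> b"
      using assms by (simp add: norm_eq)
    then have "2 * (a \<bullet> c) = c \<bullet> c"
      by (simp add: c_def algebra_simps inner_commute)
    then show ?thesis
      using c by (simp add: T_def c_def)
  qed
  moreover have "T x = x" if "x \<bullet> a = x \<bullet> b" for x
    using that by (simp add: T_def c_def inner_diff_right)
  ultimately show ?thesis
    using that by blast
qed

lemma orthogonal_transformation_measurable [measurable_dest]: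
  "orthogonal_transformation (T :: 'a::euclidean_space \<Rightarrow> 'a) \<Longrightarrow> T \<in> borel_measurable borel"
  by (intro borel_measurable_continuous_onI linear_continuous_on)
     (simp add: orthogonal_transformation_linear linear_conv_bounded_linear[symmetric])

lemma lborel_distr_plus_right: "distr lborel borel (\<lambda>x. x + c) = (lborel :: 'a::euclidean_space measure)"
  using lborel_distr_plus[of c] by (subst add.commute) simp

lemma lborel_distr_diff_left: "distr lborel borel (\<lambda>x. c - x) = (lborel :: 'a::euclidean_space measure)"
  using lborel_affine[of "-1" c] by (simp add: density_1)

text \<open>A translation invariant measure \<open>\<mu>\<close> is a multiple of Lebesgue measure \<open>\<lambda>\<close>: by Fubini
  \<open>\<mu> E * \<lambda> B = \<mu> B * \<lambda> E\<close>. The factor is read off the unit ball.\<close>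

lemma lborel_distr_orthogonal_transformation:
  fixes T :: "'a::euclidean_space \<Rightarrow> 'a"
  assumes T: "orthogonal_transformation T"
  shows "distr lborel borel T = lborel"
proof -
  define \<mu> where "\<mu> = distr lborel borel T"
  define B where "B = ball (0::'a) 1"
  have T_meas [measurable]: "T \<in> borel_measurable borel"
    using T by measurable
  have sets [measurable_cong, simp]: "sets \<mu> = sets borel"
    by (simp add: \<mu>_def)
  have lin: "linear T"
    using T by (rule orthogonal_transformation_linear)
  obtain T' where T': "T' \<circ> T = id" "T \<circ> T' = id"
    using orthogonal_transformation_bij[OF T] by (metis bij_iff comp_def eq_id_iff)
  have transl: "distr \<mu> borel (\<lambda>x. x + c) = \<mu>" for c
  proof -
    obtain c' where c': "T c' = c"
      using T'(2) by (metis comp_apply id_apply)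
    have "distr \<mu> borel (\<lambda>x. x + c) = distr lborel borel (T \<circ> (\<lambda>x. x + c'))"
      by (simp add: \<mu>_def distr_distr comp_def linear_add[OF lin] c')
    also have "\<dots> = distr (distr lborel borel (\<lambda>x. x + c')) borel T"
      by (subst distr_distr) auto
    finally show ?thesis
      by (simp add: lborel_distr_plus_right \<mu>_def)
  qed
  \<comment> \<open>Fubini needs sigma-finiteness of \<open>\<mu>\<close>. Since \<open>T\<close>
    preserves centred balls, \<open>\<mu>\<close> agrees with Lebesgue measure on them.\<close>
  have sf: "sigma_finite_measure \<mu>"
  proof
    have vim: "emeasure \<mu> (ball 0 r) = emeasure lborel (ball (0::'a) r)" for r
    proof -
      have "T -` ball 0 r = ball 0 r"
        using orthogonal_transformation_norm[OF T] by auto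
      then show ?thesis
        by (simp add: \<mu>_def emeasure_distr)
    qed
    have "(\<Union>n::nat. ball (0::'a) (real n)) = UNIV"
      by (auto intro: reals_Archimedean2)
    then show "\<exists>A. countable A \<and> A \<subseteq> sets \<mu> \<and> \<Union>A = space \<mu> \<and> (\<forall>a\<in>A. emeasure \<mu> a \<noteq> \<infinity>)"
      using emeasure_lborel_ball_finite
      by (intro exI[of _ "range (\<lambda>n::nat. ball (0::'a) (real n))"])
         (auto simp: vim sets_eq_imp_space_eq[OF sets] less_top)
  qed
  interpret pair_sigma_finite \<mu> lborel
    using sf by (simp add: pair_sigma_finite_def sigma_finite_lborel)
  have B: "emeasure \<mu> B = emeasure lborel B" "emeasure lborel B \<noteq> 0" "emeasure lborel B \<noteq> \<infinity>"
  proof -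
    have "T -` B = B"
      using orthogonal_transformation_norm[OF T] by (auto simp: B_def)
    then show "emeasure \<mu> B = emeasure lborel B"
      by (simp add: \<mu>_def emeasure_distr B_def)
    show "emeasure lborel B \<noteq> 0"
      using less_imp_neq[OF unit_ball_vol_pos[OF of_nat_0_le_iff, of "DIM('a)"]]
      by (simp add: B_def emeasure_ball)
    show "emeasure lborel B \<noteq> \<infinity>"
      using emeasure_lborel_ball_finite by (auto simp: B_def less_top)
  qed
  have "emeasure \<mu> E = emeasure lborel E" if [measurable]: "E \<in> sets borel" for E
  proof -
    have [measurable]: "B \<in> sets borel"
      by (simp add: B_def)
    \<comment> \<open>Three substitutions separated by two exchanges of the integrals: y to y + x in
      Lebesgue measure, x to x - y in \<open>\<mu>\<close>, and finally y to x - y in Lebesgue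
      measure. In the end \<open>E\<close> is measured by Lebesgue measure and \<open>B\<close> by
      \<open>\<mu>\<close>.\<close>
    have "emeasure \<mu> E * emeasure lborel B = (\<integral>\<^sup>+x. (\<integral>\<^sup>+y. indicator E x * indicator B y \<partial>lborel) \<partial>\<mu>)"
      by (simp add: nn_integral_cmult nn_integral_multc)
    also have "\<dots> = (\<integral>\<^sup>+x. (\<integral>\<^sup>+y. indicator E x * indicator B (y + x) \<partial>lborel) \<partial>\<mu>)"
    proof (rule nn_integral_cong)
      fix x
      show "(\<integral>\<^sup>+y. indicator E x * indicator B y \<partial>lborel) = (\<integral>\<^sup>+y. indicator E x * indicator B (y + x) \<partial>lborel)"
        by (subst lborel_distr_plus_right[of x, symmetric], subst nn_integral_distr) auto
    qed
    also have "\<dots> = (\<integral>\<^sup>+y. (\<integral>\<^sup>+x. indicator E x * indicator B (y + x) \<partial>\<mu>) \<partial>lborel)"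
      by (rule Fubini'[symmetric]) measurable
    also have "\<dots> = (\<integral>\<^sup>+y. (\<integral>\<^sup>+x. indicator E (x - y) * indicator B x \<partial>\<mu>) \<partial>lborel)"
    proof (rule nn_integral_cong)
      fix y
      show "(\<integral>\<^sup>+x. indicator E x * indicator B (y + x) \<partial>\<mu>) = (\<integral>\<^sup>+x. indicator E (x - y) * indicator B x \<partial>\<mu>)"
        by (subst transl[of "-y", symmetric], subst nn_integral_distr) auto
    qed
    also have "\<dots> = (\<integral>\<^sup>+x. (\<integral>\<^sup>+y. indicator E (x - y) * indicator B x \<partial>lborel) \<partial>\<mu>)"
      by (rule Fubini') measurable
    also have "\<dots> = (\<integral>\<^sup>+x. (\<integral>\<^sup>+y. indicator E y * indicator B x \<partial>lborel) \<partial>\<mu>)"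
    proof (rule nn_integral_cong)
      fix x
      show "(\<integral>\<^sup>+y. indicator E (x - y) * indicator B x \<partial>lborel) = (\<integral>\<^sup>+y. indicator E y * indicator B x \<partial>lborel)"
        by (subst (2) lborel_distr_diff_left[of x, symmetric], subst nn_integral_distr) auto
    qed
    also have "\<dots> = emeasure lborel E * emeasure \<mu> B"
      by (simp add: nn_integral_cmult nn_integral_multc)
    finally show ?thesis
      using B ennreal_mult_cancel_left[of "emeasure lborel B" "emeasure \<mu> E" "emeasure lborel E"]
      by (simp add: mult.commute)
  qed
  then show ?thesis
    unfolding \<mu>_def[symmetric] by (intro measure_eqI) auto
qed

text \<open>An invariant measure gives the same mass \<open>c(r)\<close> to all \<open>r\<close>-balls centred in \<open>S\<close>, and by
  Fubini \<open>c(r)\<close> is the same for both measures. Integrating the mass of \<open>ball y r\<close> over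
  \<open>y \<in> C\<close> then compares the mass of a closed set \<open>C\<close> with that of its \<open>r\<close>-neighbourhood.\<close>

lemma invariant_measure_le:
  fixes \<mu> \<nu> :: "'a::euclidean_space measure"
  assumes "prob_space \<mu>" "prob_space \<nu>"
    and sets [simp]: "sets \<mu> = sets borel" "sets \<nu> = sets borel"
    and S: "compact S" "AE x in \<mu>. x \<in> S" "AE x in \<nu>. x \<in> S"
    and G: "\<And>T. T \<in> G \<Longrightarrow> orthogonal_transformation T"
    and inv: "\<And>T. T \<in> G \<Longrightarrow> distr \<mu> borel T = \<mu>" "\<And>T. T \<in> G \<Longrightarrow> distr \<nu> borel T = \<nu>"
    and trans: "\<And>x y. x \<in> S \<Longrightarrow> y \<in> S \<Longrightarrow> \<exists>T\<in>G. T x = y"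
    and C: "closed C"
  shows "emeasure \<nu> C \<le> emeasure \<mu> C"
proof -
  interpret \<mu>: prob_space \<mu> by fact
  interpret \<nu>: prob_space \<nu> by fact
  interpret \<mu>\<nu>: pair_sigma_finite \<mu> \<nu> ..
  note [measurable_cong] = sets
  have [simp]: "space \<mu> = UNIV" "space \<nu> = UNIV"
    using sets[THEN sets_eq_imp_space_eq] by auto
  have [measurable]: "S \<in> sets borel" "C \<in> sets borel"
    using S(1) C by (auto dest: compact_imp_closed)
  have ball_eq: "emeasure N (ball x r) = emeasure N (ball y r)"
    if x: "x \<in> S" and y: "y \<in> S" and N: "sets N = sets borel" "\<And>T. T \<in> G \<Longrightarrow> distr N borel T = N" for N x y r
  proof -
    obtain T where T: "T \<in> G" "T x = y"
      using trans[OF x y] by blast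
    have [measurable]: "T \<in> borel_measurable borel"
      using G[OF T(1)] by measurable
    have "T -` ball y r = ball x r"
      using G[OF T(1)] T(2) unfolding orthogonal_transformation_isometry by auto
    moreover have "emeasure N (ball y r) = emeasure (distr N borel T) (ball y r)"
      using N(2)[OF T(1)] by simp
    ultimately show ?thesis
      using N(1) by (simp add: emeasure_distr sets_eq_imp_space_eq[OF N(1)])
  qed
  obtain p where p: "p \<in> S"
  proof -
    have "emeasure \<mu> S = 1"
      using S(2) by (intro \<mu>.emeasure_eq_1_AE) auto
    then show ?thesis
      using that by (metis emeasure_empty equals0I zero_neq_one)
  qed
  define c where "c r = emeasure \<mu> (ball p r)" for r
  have c: "emeasure \<mu> (ball x r) = c r" if "x \<in> S" for x r
    unfolding c_def using that p inv(1) by (intro ball_eq) auto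
  \<comment> \<open>The mass D that \<open>\<nu>\<close> gives to an r-ball is averaged over a
    \<open>\<mu>\<close>-distributed centre. Exchanging the integrals and using the symmetry of the
    distance turns it into the average of \<open>c r\<close> under \<open>\<nu>\<close>; both
    measures have total mass 1.\<close>
  have c': "emeasure \<nu> (ball x r) = c r" if x: "x \<in> S" for x r
  proof -
    define D where "D = emeasure \<nu> (ball p r)"
    have D: "emeasure \<nu> (ball x r) = D" if "x \<in> S" for x
      unfolding D_def using that p inv(2) by (intro ball_eq) auto
    have meas: "(\<lambda>(x, y). indicator (ball x r) y :: ennreal) \<in> borel_measurable (\<mu> \<Otimes>\<^sub>M \<nu>)"
    proof -
      have "(\<lambda>(x, y). indicator (ball x r) y :: ennreal) = (\<lambda>q. indicator {q. dist (fst q) (snd q) < r} q)"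
        by (auto simp: indicator_def fun_eq_iff)
      also have "\<dots> \<in> borel_measurable (\<mu> \<Otimes>\<^sub>M \<nu>)"
        by measurable
      finally show ?thesis .
    qed
    have "D = (\<integral>\<^sup>+x. emeasure \<nu> (ball x r) \<partial>\<mu>)"
      using S(2) D by (subst nn_integral_cong_AE[where v = "\<lambda>_. D"]) (auto simp: \<mu>.emeasure_space_1[simplified])
    also have "\<dots> = (\<integral>\<^sup>+x. (\<integral>\<^sup>+y. indicator (ball x r) y \<partial>\<nu>) \<partial>\<mu>)"
      by simp
    also have "\<dots> = (\<integral>\<^sup>+y. (\<integral>\<^sup>+x. indicator (ball x r) y \<partial>\<mu>) \<partial>\<nu>)"
      using meas by (intro \<mu>\<nu>.Fubini'[symmetric]) simp
    also have "\<dots> = (\<integral>\<^sup>+y. (\<integral>\<^sup>+x. indicator (ball y r) x \<partial>\<mu>) \<partial>\<nu>)"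
      by (intro nn_integral_cong) (auto simp: indicator_def dist_commute)
    also have "\<dots> = (\<integral>\<^sup>+y. emeasure \<mu> (ball y r) \<partial>\<nu>)"
      by simp
    also have "\<dots> = c r"
      using S(3) c by (subst nn_integral_cong_AE[where v = "\<lambda>_. c r"]) (auto simp: \<nu>.emeasure_space_1[simplified])
    finally show ?thesis
      using D x by simp
  qed
  \<comment> \<open>Allows \<open>c r\<close> to be cancelled later. By compactness finitely many
    r-balls cover \<open>S\<close>, so balls of mass 0 would make \<open>S\<close> null.\<close>
  have c_pos: "c r \<noteq> 0" if "r > 0" for r
  proof
    assume 0: "c r = 0"
    have "S \<subseteq> (\<Union>x\<in>S. ball x r)"
      using that by auto
    then obtain F where F: "F \<subseteq> S" "finite F" "S \<subseteq> (\<Union>x\<in>F. ball x r)"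
      using compactE_image[OF S(1), of S "\<lambda>x. ball x r"] by auto
    have "(\<Union>x\<in>F. ball x r) \<in> null_sets \<mu>"
      using F 0 c by (intro null_sets.finite_UN) (auto simp: null_sets_def)
    then have "emeasure \<mu> S = 0"
      using F(3) by (meson emeasure_eq_0 null_setsD1 null_setsD2)
    moreover have "emeasure \<mu> S = 1"
      using S(2) by (intro \<mu>.emeasure_eq_1_AE) auto
    ultimately show False
      by simp
  qed
  define N where "N r = (\<Union>y\<in>C. ball y r)" for r
  have N_open: "open (N r)" for r
    by (auto simp: N_def)
  then have [measurable]: "N r \<in> sets borel" for r
    by simp
  have le: "emeasure \<nu> C \<le> emeasure \<mu> (N r)" if r: "r > 0" for r
  proof -
    have meas: "(\<lambda>(x, y). indicator C x * indicator (ball x r) y :: ennreal) \<in> borel_measurable (\<nu> \<Otimes>\<^sub>M \<mu>)"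
    proof -
      have "(\<lambda>(x, y). indicator C x * indicator (ball x r) y :: ennreal)
          = (\<lambda>q. indicator C (fst q) * indicator {q. dist (fst q) (snd q) < r} q)"
        by (auto simp: indicator_def fun_eq_iff)
      also have "\<dots> \<in> borel_measurable (\<nu> \<Otimes>\<^sub>M \<mu>)"
        by measurable
      finally show ?thesis .
    qed
    interpret \<nu>\<mu>: pair_sigma_finite \<nu> \<mu> ..
    have "emeasure \<nu> C * c r = (\<integral>\<^sup>+x. indicator C x * c r \<partial>\<nu>)"
      by (simp add: nn_integral_multc)
    also have "\<dots> = (\<integral>\<^sup>+x. indicator C x * emeasure \<mu> (ball x r) \<partial>\<nu>)"
      using S(3) c by (intro nn_integral_cong_AE) auto
    also have "\<dots> = (\<integral>\<^sup>+x. (\<integral>\<^sup>+y. indicator C x * indicator (ball x r) y \<partial>\<mu>) \<partial>\<nu>)"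
      by (intro nn_integral_cong, subst nn_integral_cmult) (simp_all add: borel_measurable_indicator)
    also have "\<dots> = (\<integral>\<^sup>+y. (\<integral>\<^sup>+x. indicator C x * indicator (ball x r) y \<partial>\<nu>) \<partial>\<mu>)"
      using meas by (intro \<nu>\<mu>.Fubini'[symmetric]) simp
    also have "\<dots> \<le> (\<integral>\<^sup>+y. (\<integral>\<^sup>+x. indicator (N r) y * indicator (ball y r) x \<partial>\<nu>) \<partial>\<mu>)"
      by (intro nn_integral_mono) (auto simp: indicator_def dist_commute N_def)
    also have "\<dots> = (\<integral>\<^sup>+y. indicator (N r) y * emeasure \<nu> (ball y r) \<partial>\<mu>)"
      by (intro nn_integral_cong, subst nn_integral_cmult) (simp_all add: borel_measurable_indicator)
    also have "\<dots> = (\<integral>\<^sup>+y. indicator (N r) y * c r \<partial>\<mu>)"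
      using S(2) c' by (intro nn_integral_cong_AE) auto
    also have "\<dots> = emeasure \<mu> (N r) * c r"
      by (simp add: nn_integral_multc)
    finally have "emeasure \<nu> C * c r \<le> emeasure \<mu> (N r) * c r" .
    moreover have "c r \<noteq> \<infinity>"
      by (simp add: c_def)
    ultimately show ?thesis
      using c_pos[OF r]
      by (simp add: mult.commute[of _ "c r"] ennreal_mult_le_mult_iff)
  qed
  have "(\<lambda>k::nat. emeasure \<mu> (N (1 / Suc k))) \<longlonglongrightarrow> emeasure \<mu> (\<Inter>k::nat. N (1 / Suc k))"
  proof (rule Lim_emeasure_decseq)
    show "decseq (\<lambda>k::nat. N (1 / Suc k))"
    proof (rule decseq_SucI)
      fix k :: nat
      have "1 / real (Suc (Suc k)) \<le> 1 / real (Suc k)"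
        by (simp add: field_simps)
      then show "N (1 / real (Suc (Suc k))) \<subseteq> N (1 / real (Suc k))"
        unfolding N_def by (meson UN_mono order_refl subset_ball)
    qed
  qed auto
  moreover have "(\<Inter>k::nat. N (1 / Suc k)) = C"
  proof
    show "C \<subseteq> (\<Inter>k::nat. N (1 / Suc k))"
      by (auto simp: N_def)
    show "(\<Inter>k::nat. N (1 / Suc k)) \<subseteq> C"
    proof
      fix x assume x: "x \<in> (\<Inter>k::nat. N (1 / Suc k))"
      have "\<exists>y\<in>C. dist y x < e" if "e > 0" for e
      proof -
        obtain k :: nat where k: "1 / Suc k < e"
          using \<open>e > 0\<close> by (rule nat_approx_posE)
        have "x \<in> N (1 / Suc k)"
          using x by blast
        then obtain y where "y \<in> C" "dist y x < 1 / Suc k"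
          unfolding N_def by auto
        with k show ?thesis
          by (intro bexI[of _ y]) auto
      qed
      then show "x \<in> C"
        using C by (meson closed_approachable)
    qed
  qed
  ultimately have "(\<lambda>k::nat. emeasure \<mu> (N (1 / Suc k))) \<longlonglongrightarrow> emeasure \<mu> C"
    by simp
  then show ?thesis
    by (rule LIMSEQ_le_const) (auto intro!: le)
qed

lemma invariant_measure_unique:
  fixes \<mu> \<nu> :: "'a::euclidean_space measure"
  assumes "prob_space \<mu>" "prob_space \<nu>"
    and sets: "sets \<mu> = sets borel" "sets \<nu> = sets borel"
    and S: "compact S" "AE x in \<mu>. x \<in> S" "AE x in \<nu>. x \<in> S"
    and G: "\<And>T. T \<in> G \<Longrightarrow> orthogonal_transformation T"
    and inv: "\<And>T. T \<in> G \<Longrightarrow> distr \<mu> borel T = \<mu>" "\<And>T. T \<in> G \<Longrightarrow> distr \<nu> borel T = \<nu>"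
    and trans: "\<And>x y. x \<in> S \<Longrightarrow> y \<in> S \<Longrightarrow> \<exists>T\<in>G. T x = y"
  shows "\<mu> = \<nu>"
proof -
  interpret \<mu>: prob_space \<mu> by fact
  have eq: "emeasure \<mu> C = emeasure \<nu> C" if "closed C" for C
    using that assms by (intro antisym invariant_measure_le[where S = S and G = G]) auto
  have closed: "sets (borel :: 'a measure) = sigma_sets UNIV {C. closed C}"
    by (simp add: borel_eq_closed)
  show ?thesis
  proof (rule measure_eqI_generator_eq[where E = "{C :: 'a set. closed C}" and \<Omega> = UNIV and A = "\<lambda>_. UNIV"])
    show "Int_stable {C :: 'a set. closed C}"
      by (auto simp: Int_stable_def)
    show "emeasure \<mu> UNIV \<noteq> \<infinity>" for i :: nat
      by simp
  qed (use eq sets closed in auto)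
qed

section \<open>The maximum of \<open>JB\<close>\<close>

lemma lambda_n_pos:
  assumes "n \<ge> 3"
  shows "lambda_n n > 0"
proof -
  have "(real n) ^ 3 - 6 * (real n)\<^sup>2 + 15 * real n - 12 = (real n - 3) * ((real n - 3) * real n + 6) + 6"
    by (simp add: power2_eq_square power3_eq_cube algebra_simps)
  also have "\<dots> > 0"
    using assms by (intro add_nonneg_pos mult_nonneg_nonneg) auto
  finally show ?thesis
    using assms by (simp add: lambda_n_def)
qed

lemma Omega_iff: "u \<in> Omega \<longleftrightarrow> u \<bullet> 1 = 0 \<and> norm u = 1"
  by (simp add: Omega_def power_sum_def inner_vec_def norm_eq_1 power2_eq_square)

lemma power_sum_neg: "power_sum r (- u) = (-1) ^ r * power_sum r u"
  by (simp add: power_sum_def sum_distrib_left power_mult_distrib[symmetric])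

lemma JB_neg: "JB (- u) = JB u"
  by (simp add: JB_def power_sum_neg)

text \<open>Each summand is a squared entry of the residual of the vector of squares after
  orthogonal projection onto \<open>u\<close> and \<open>1\<close>, which are orthogonal on
  \<open>Omega\<close>; the coefficients are \<open>power_sum 3 u\<close> and 1 / n. Nonnegativity
  is Pearson's inequality, and a zero residual, its equality case, makes every entry a root of one
  quadratic.\<close>

lemma power_sum_square_bound:
  fixes u :: "real ^ 'n"
  assumes "u \<in> Omega"
  shows "(\<Sum>i\<in>UNIV. ((u $ i)\<^sup>2 - power_sum 3 u * u $ i - 1 / CARD('n))\<^sup>2)
       = power_sum 4 u - (power_sum 3 u)\<^sup>2 - 1 / CARD('n)"
proof -
  define p where "p = power_sum 3 u"
  define N where "N = real CARD('n)"
  have N: "N > 0"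
    by (simp add: N_def)
  have s: "(\<Sum>i\<in>UNIV. u $ i) = 0" "(\<Sum>i\<in>UNIV. (u $ i)\<^sup>2) = 1"
    using assms by (simp_all add: Omega_def power_sum_def)
  have "(\<Sum>i\<in>UNIV. ((u $ i)\<^sup>2 - p * u $ i - 1 / N)\<^sup>2)
      = (\<Sum>i\<in>UNIV. (u $ i) ^ 4 - 2 * p * (u $ i) ^ 3 + (p\<^sup>2 - 2 / N) * (u $ i)\<^sup>2 + 2 * p / N * u $ i + 1 / N\<^sup>2)"
    by (intro sum.cong refl) (simp add: power2_eq_square power3_eq_cube power4_eq_xxxx algebra_simps)
  also have "\<dots> = power_sum 4 u - 2 * p * power_sum 3 u + (p\<^sup>2 - 2 / N) * 1 + 2 * p / N * 0 + N * (1 / N\<^sup>2)"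
    unfolding sum.distrib sum_subtractf sum_distrib_left[symmetric] s
    by (simp add: power_sum_def N_def)
  also have "\<dots> = power_sum 4 u - p\<^sup>2 - 1 / N"
    using N by (simp add: p_def power2_eq_square field_simps)
  finally show ?thesis
    by (simp add: p_def N_def)
qed

text \<open>In the application M = n - 1, r^2 = M n p3^2 and k = M (n p4 - 1), and the left-hand
  side is \<open>JB\<close> up to an affine change. The region lies between the parabola k = r^2 and
  the line k = M^2 - 1 - 2 r, which for r \<ge> 0 meet in the corner r = M - 1, k = (M - 1)^2. Below
  the height of the corner the first summand is nonpositive and k^2 is too small; above it,
  convexity in k for fixed r moves the point to one of the two boundary curves.\<close>

lemma planar_bound:
  fixes M r k :: real
  assumes "M \<ge> 2" "0 \<le> r" "r\<^sup>2 \<le> k" "k \<le> M\<^sup>2 - 1 - 2 * r"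
  shows "4 * M * (r\<^sup>2 - k) + k\<^sup>2 \<le> (M - 1) ^ 4"
    and "4 * M * (r\<^sup>2 - k) + k\<^sup>2 = (M - 1) ^ 4 \<Longrightarrow> k = (M - 1)\<^sup>2 \<and> r = M - 1"
proof -
  define f where "f k = 4 * M * (r\<^sup>2 - k) + k\<^sup>2" for k
  define t where "t = M\<^sup>2 - 1 - 2 * r"
  have "(r + 1)\<^sup>2 \<le> M\<^sup>2"
    using assms by (simp add: power2_eq_square algebra_simps)
  then have rM: "r \<le> M - 1"
    using assms by (simp add: power2_le_iff_abs_le)
  \<comment> \<open>The factor \<open>M - 1 - r\<close> vanishes only at the corner, so along the
    bounding line the inequality is strict for \<open>r < M - 1\<close>.\<close>
  have top: "(M - 1) ^ 4 - f t = 4 * (M - 1 - r) * (M * (r + 1) + M + r)"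
    by (simp add: f_def t_def power4_eq_xxxx power2_eq_square algebra_simps)
  have pos: "M * (r + 1) + M + r > 0"
    using assms by (intro add_pos_nonneg) auto
  have four: "(M - 1) ^ 4 = ((M - 1)\<^sup>2)\<^sup>2"
    by simp
  have k0: "k \<ge> 0"
    using assms by (meson order_trans zero_le_power2)
  have "f k < (M - 1) ^ 4 \<or> k = (M - 1)\<^sup>2 \<and> f k \<le> (M - 1) ^ 4 \<and> (f k = (M - 1) ^ 4 \<longrightarrow> r = M - 1)"
  proof (cases k "(M - 1)\<^sup>2" rule: linorder_cases)
    case less
    have "k\<^sup>2 < ((M - 1)\<^sup>2)\<^sup>2"
      using less k0 by (intro power_strict_mono) auto
    moreover have "4 * M * (r\<^sup>2 - k) \<le> 0"
      using assms by (intro mult_nonneg_nonpos) auto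
    ultimately show ?thesis
      unfolding f_def four by linarith
  next
    case equal
    have "4 * M * (r\<^sup>2 - k) \<le> 0"
      using assms by (intro mult_nonneg_nonpos) auto
    moreover have "r = M - 1" if "4 * M * (r\<^sup>2 - k) = 0"
      using that assms equal by (auto simp: power2_eq_iff)
    ultimately show ?thesis
      unfolding f_def four equal by auto
  next
    case greater
    have r: "r < M - 1"
    proof (rule ccontr)
      assume "\<not> r < M - 1"
      then have "r = M - 1"
        using rM by simp
      then show False
        using greater assms(4) by (simp add: power2_eq_square algebra_simps)
    qed
    \<comment> \<open>Convexity made explicit: both differences factor, and the sign of
      \<open>k + r\<^sup>2 - 4 * M\<close> decides which endpoint dominates. In the second case
      \<open>t \<ge> r\<^sup>2\<close> keeps the other factor nonnegative.\<close>
    have "f k \<le> f (r\<^sup>2) \<or> f k \<le> f t"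
    proof (cases "k + r\<^sup>2 - 4 * M \<le> 0")
      case True
      have "f k - f (r\<^sup>2) = (k - r\<^sup>2) * (k + r\<^sup>2 - 4 * M)"
        by (simp add: f_def power2_eq_square algebra_simps)
      also have "\<dots> \<le> 0"
        using assms True by (intro mult_nonneg_nonpos) auto
      finally show ?thesis by simp
    next
      case False
      have "f k - f t = (k - t) * (k + t - 4 * M)"
        by (simp add: f_def power2_eq_square algebra_simps)
      also have "\<dots> \<le> 0"
        using assms False by (intro mult_nonpos_nonneg) (auto simp: t_def)
      finally show ?thesis by simp
    qed
    moreover have "f (r\<^sup>2) < (M - 1) ^ 4"
    proof -
      have "f (r\<^sup>2) = r ^ 4"
        by (simp add: f_def)
      also have "\<dots> < (M - 1) ^ 4"
        using r assms by (intro power_strict_mono) auto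
      finally show ?thesis .
    qed
    moreover have "f t < (M - 1) ^ 4"
    proof -
      have "4 * (M - 1 - r) * (M * (r + 1) + M + r) > 0"
        using r pos by (intro mult_pos_pos) auto
      then show ?thesis
        using top by linarith
    qed
    ultimately show ?thesis
      by auto
  qed
  then show "4 * M * (r\<^sup>2 - k) + k\<^sup>2 \<le> (M - 1) ^ 4"
    and "4 * M * (r\<^sup>2 - k) + k\<^sup>2 = (M - 1) ^ 4 \<Longrightarrow> k = (M - 1)\<^sup>2 \<and> r = M - 1"
    unfolding f_def by auto
qed

section \<open>Power sums of the outlier directions and their extremality\<close>

definition outlier_scale :: "real \<Rightarrow> real" where
  "outlier_scale N = 1 / sqrt (N * (N - 1))"

lemma outlier_scale:
  assumes "N \<ge> 3"
  shows "outlier_scale N > 0" "(outlier_scale N)\<^sup>2 = 1 / (N * (N - 1))"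
  using assms by (simp_all add: outlier_scale_def power_divide)

lemma outlier_nth:
  "outlier i $ j = (if j = i then real CARD('n) - 1 else - 1) * outlier_scale CARD('n)"
  for i :: "'n::finite"
  by (simp add: outlier_def outlier_scale_def)

lemma power_sum_outlier:
  fixes i :: "'n::finite"
  shows "power_sum r (outlier i)
    = ((real CARD('n) - 1) ^ r + (real CARD('n) - 1) * (-1) ^ r) * outlier_scale CARD('n) ^ r"
proof -
  have "power_sum r (outlier i) = (outlier i $ i) ^ r + (\<Sum>j\<in>UNIV - {i}. (outlier i $ j) ^ r)"
    unfolding power_sum_def by (subst sum.remove[of _ i]) auto
  also have "(\<Sum>j\<in>UNIV - {i}. (outlier i $ j) ^ r)
      = (\<Sum>j\<in>UNIV - {i}. (- outlier_scale CARD('n)) ^ r)"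
    by (intro sum.cong) (auto simp: outlier_nth)
  also have "\<dots> = (real CARD('n) - 1) * (- outlier_scale CARD('n)) ^ r"
    by (simp add: card_Diff_singleton of_nat_diff)
  also have "(outlier i $ i) ^ r = (real CARD('n) - 1) ^ r * outlier_scale CARD('n) ^ r"
    by (simp only: outlier_nth if_True refl power_mult_distrib)
  finally show ?thesis
    unfolding power_minus[of "outlier_scale _" r] by (simp only: distrib_right mult.assoc)
qed

lemma outlier_in_Omega:
  fixes i :: "'n::finite"
  assumes "CARD('n) \<ge> 3"
  shows "outlier i \<in> Omega"
proof -
  define N where "N = real CARD('n)"
  have N: "N \<ge> 3"
    using assms by (simp add: N_def)
  have "power_sum 2 (outlier i) = ((N - 1)\<^sup>2 + (N - 1)) * (outlier_scale N)\<^sup>2"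
    unfolding power_sum_outlier N_def by simp
  also have "\<dots> = 1"
    unfolding outlier_scale(2)[OF N] using N by (simp add: field_simps power2_eq_square)
  finally show ?thesis
    unfolding Omega_def by (simp add: power_sum_outlier)
qed

lemma outlier_inner:
  fixes i :: "'n::finite" and u :: "real ^ 'n"
  shows "outlier i \<bullet> u = outlier_scale CARD('n) * (CARD('n) * u $ i - u \<bullet> 1)"
proof -
  define N where "N = real CARD('n)"
  have "outlier i \<bullet> u = (\<Sum>j\<in>UNIV. outlier_scale N * ((if j = i then N * u $ j else 0) - u $ j))"
    unfolding inner_vec_def outlier_nth N_def by (intro sum.cong) (auto simp: algebra_simps)
  also have "\<dots> = outlier_scale N * (N * u $ i - u \<bullet> 1)"
    by (simp add: sum_distrib_left[symmetric] sum_subtractf inner_vec_def)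
  finally show ?thesis
    by (simp add: N_def)
qed

text \<open>Cauchy-Schwarz against \<open>outlier i\<close>, whose inner product with a centred
  \<open>u\<close> is a multiple of \<open>u $ i\<close>. Equality holds at the outlier itself,
  which is why the bound is the square of its large entry.\<close>

lemma Omega_component_bound:
  fixes u :: "real ^ 'n"
  assumes "CARD('n) \<ge> 3" "u \<in> Omega"
  shows "(u $ i)\<^sup>2 \<le> (real CARD('n) - 1) / real CARD('n)"
proof -
  define N where "N = real CARD('n)"
  have N: "N \<ge> 3"
    using assms by (simp add: N_def)
  have "\<bar>outlier i \<bullet> u\<bar> \<le> 1"
    using Cauchy_Schwarz_ineq2[of "outlier i" u] assms outlier_in_Omega[OF assms(1), of i]
    by (simp add: Omega_iff)
  then have "(outlier_scale N * (N * u $ i))\<^sup>2 \<le> 1"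
    using assms(2) by (simp add: outlier_inner Omega_iff N_def abs_square_le_1)
  then have "1 / (N * (N - 1)) * (N * u $ i)\<^sup>2 \<le> 1"
    unfolding power_mult_distrib[of "outlier_scale N"] outlier_scale(2)[OF N] .
  then have "N * (N * (u $ i)\<^sup>2) \<le> N * (N - 1)"
    using N by (simp add: divide_simps power2_eq_square mult_ac)
  then have "N * (u $ i)\<^sup>2 \<le> N - 1"
    using N by (subst (asm) mult_le_cancel_left_pos) auto
  then show ?thesis
    using N by (simp add: N_def[symmetric] field_simps)
qed

text \<open>The quartic \<open>(A\<^sup>2 - x\<^sup>2)(x + b)\<^sup>2\<close>, nonnegative on \<open>[-A, A]\<close>, vanishes at both
  entries \<open>A\<close>, \<open>-b\<close> of an outlier direction.\<close>

lemma power_sum_4_bound: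
  fixes u :: "real ^ 'n"
  assumes "CARD('n) \<ge> 3" "u \<in> Omega"
  shows "power_sum 4 u + 2 * outlier_scale CARD('n) * \<bar>power_sum 3 u\<bar>
    \<le> 1 - 1 / (real CARD('n) * (real CARD('n) - 1))"
proof -
  define N where "N = real CARD('n)"
  have N: "N \<ge> 3"
    using assms by (simp add: N_def)
  define B where "B = (N - 1) / N"
  have s: "(\<Sum>i\<in>UNIV. u $ i) = 0" "(\<Sum>i\<in>UNIV. (u $ i)\<^sup>2) = 1"
    using assms by (simp_all add: Omega_def power_sum_def)
  \<comment> \<open>The scale \<open>b\<close> is allowed either sign; the sign that agrees with
    \<open>power_sum 3 u\<close> produces the absolute value.\<close>
  have *: "power_sum 4 u + 2 * b * power_sum 3 u \<le> 1 - 1 / (N * (N - 1))"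
    if b: "b\<^sup>2 = 1 / (N * (N - 1))" for b
  proof -
    have "0 \<le> (\<Sum>i\<in>UNIV. (B - (u $ i)\<^sup>2) * (u $ i + b)\<^sup>2)"
      using Omega_component_bound[OF assms] by (intro sum_nonneg mult_nonneg_nonneg) (auto simp: B_def N_def)
    also have "\<dots> = (\<Sum>i\<in>UNIV. (B - b\<^sup>2) * (u $ i)\<^sup>2 + 2 * b * B * u $ i + B * b\<^sup>2 - (u $ i) ^ 4 - 2 * b * (u $ i) ^ 3)"
      by (intro sum.cong refl) (simp add: power2_eq_square power3_eq_cube power4_eq_xxxx algebra_simps)
    also have "\<dots> = (B - b\<^sup>2) * 1 + 2 * b * B * 0 + N * (B * b\<^sup>2) - power_sum 4 u - 2 * b * power_sum 3 u"
      unfolding sum.distrib sum_subtractf sum_distrib_left[symmetric] s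
      by (simp add: power_sum_def N_def)
    also have "(B - b\<^sup>2) * 1 + 2 * b * B * 0 + N * (B * b\<^sup>2) = 1 - 1 / (N * (N - 1))"
    proof -
      define M where "M = N - 1"
      have M: "M \<ge> 2" and NM: "N = M + 1"
        using N by (simp_all add: M_def)
      show ?thesis
        unfolding b B_def M_def[symmetric] using M unfolding NM
        by (simp add: divide_simps) (simp add: algebra_simps)
    qed
    finally show ?thesis by simp
  qed
  show ?thesis
    using *[of "outlier_scale N"] *[of "- outlier_scale N"] outlier_scale(2)[OF N]
    by (auto simp: N_def abs_if)
qed

lemma
  fixes u :: "real ^ 'n"
  assumes n: "CARD('n) \<ge> 3" and u: "u \<in> Omega"
  shows JB_le_J_plus: "JB u \<le> J_plus CARD('n)"
    and JB_maximal_imp_outlier: "JB u = J_plus CARD('n) \<Longrightarrow> u \<in> outliers"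
proof -
  define N where "N = real CARD('n)"
  define M where "M = N - 1"
  have N: "N \<ge> 3" and M: "M \<ge> 2"
    using n by (simp_all add: N_def M_def)
  define p where "p = power_sum 3 u"
  define b where "b = outlier_scale N"
  have b: "b > 0" "b\<^sup>2 = 1 / (N * M)"
    using outlier_scale[OF N] by (auto simp: b_def M_def)
  have NMb: "N * M * b * b = 1"
    using b(2) N M by (simp add: power2_eq_square field_simps)
  \<comment> \<open>Since \<open>N * M * b\<^sup>2 = 1\<close>, Pearson's inequality becomes
    \<open>r\<^sup>2 \<le> k\<close> and the quartic inequality becomes
    \<open>k \<le> M\<^sup>2 - 1 - 2 * r\<close>.\<close>
  define r where "r = N * M * b * \<bar>p\<bar>"
  define k where "k = M * (N * power_sum 4 u - 1)"
  have r2: "r\<^sup>2 = N * M * p\<^sup>2"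
  proof -
    have "r\<^sup>2 = (N * M * b * b) * (N * M * p\<^sup>2)"
      by (simp add: r_def power2_eq_square mult_ac)
    then show ?thesis
      by (simp add: NMb)
  qed
  have "0 \<le> power_sum 4 u - p\<^sup>2 - 1 / N"
    unfolding p_def N_def power_sum_square_bound[OF u, symmetric] by (intro sum_nonneg) auto
  then have "0 \<le> N * M * (power_sum 4 u - p\<^sup>2 - 1 / N)"
    using N M by (intro mult_nonneg_nonneg) auto
  then have rk: "r\<^sup>2 \<le> k"
    using N by (simp add: r2 k_def algebra_simps)
  have "power_sum 4 u + 2 * b * \<bar>p\<bar> \<le> 1 - 1 / (N * M)"
    using power_sum_4_bound[OF n u] by (simp add: b_def p_def N_def M_def)
  then have "N * M * (power_sum 4 u + 2 * b * \<bar>p\<bar>) \<le> N * M * (1 - 1 / (N * M))"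
    using N M by (intro mult_left_mono) auto
  moreover have "N * M * (1 - 1 / (N * M)) = N * M - 1"
    using N M by (simp add: right_diff_distrib)
  moreover have "N = M + 1"
    by (simp add: M_def)
  ultimately have kM: "k \<le> M\<^sup>2 - 1 - 2 * r"
    by (simp add: k_def r_def algebra_simps power2_eq_square)
  have r0: "r \<ge> 0"
    using N M b by (simp add: r_def)
  have JB: "JB u = N / (24 * M\<^sup>2) * (4 * M * (r\<^sup>2 - k) + k\<^sup>2 + 4 * M\<^sup>2)"
  proof -
    have "power_sum 4 u = (k / M + 1) / N"
      using M N by (simp add: k_def)
    then have "JB u = N\<^sup>2 / 6 * (r\<^sup>2 / (N * M)) + N / 24 * (k / M - 2)\<^sup>2"
      using M N by (simp add: JB_def r2 p_def[symmetric] N_def[symmetric])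
    then show ?thesis
      using M N by (simp add: field_simps power2_eq_square)
  qed
  have J: "J_plus CARD('n) = N / (24 * M\<^sup>2) * ((M - 1) ^ 4 + 4 * M\<^sup>2)"
    by (simp add: J_plus_def N_def M_def)
  have NM: "N / (24 * M\<^sup>2) > 0"
    using N M by simp
  show "JB u \<le> J_plus CARD('n)"
    unfolding J JB using NM planar_bound(1)[OF M r0 rk kM] by (intro mult_left_mono) auto
  assume "JB u = J_plus CARD('n)"
  then have "k = (M - 1)\<^sup>2 \<and> r = M - 1"
    using NM unfolding J JB by (intro planar_bound(2)[OF M r0 rk kM]) auto
  then have "r\<^sup>2 = k" and rM: "r = M - 1"
    by auto
  then have "N * M * (power_sum 4 u - p\<^sup>2 - 1 / N) = 0"
    using N unfolding r2 by (simp add: k_def algebra_simps)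
  then have "(\<Sum>i\<in>UNIV. ((u $ i)\<^sup>2 - p * u $ i - 1 / N)\<^sup>2) = 0"
    unfolding p_def N_def power_sum_square_bound[OF u] using N M by (simp add: N_def)
  then have root: "(u $ i)\<^sup>2 - p * u $ i - 1 / N = 0" for i
    by (subst (asm) sum_nonneg_eq_0_iff) auto
  \<comment> \<open>The sign for which \<open>\<sigma> *\<^sub>R u\<close> has nonnegative third
    power sum; its entries can then only be \<open>M * b\<close> and \<open>- b\<close>.\<close>
  define \<sigma> :: real where "\<sigma> = (if p \<ge> 0 then 1 else - 1)"
  have \<sigma>: "\<sigma> * \<sigma> = 1" "\<sigma> = 1 \<or> \<sigma> = - 1"
    by (auto simp: \<sigma>_def)
  have p: "p = \<sigma> * (M - 1) * b"
  proof -
    have "\<bar>p\<bar> = (N * M * b * b) * \<bar>p\<bar>"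
      using NMb by simp
    also have "\<dots> = (M - 1) * b"
      using rM by (simp add: r_def)
    finally show ?thesis
      by (auto simp: \<sigma>_def abs_if algebra_simps split: if_splits)
  qed
  have Nb: "1 / N = M * b * b"
    using NMb N M by (simp add: field_simps)
  have vals: "\<sigma> * u $ i = M * b \<or> \<sigma> * u $ i = - b" for i
  proof -
    have "(\<sigma> * u $ i - M * b) * (\<sigma> * u $ i + b) = (\<sigma> * \<sigma>) * (u $ i)\<^sup>2 - \<sigma> * (M - 1) * b * u $ i - M * b * b"
      by (simp add: algebra_simps power2_eq_square)
    also have "\<dots> = 0"
      using root[of i] by (simp add: \<sigma> p[symmetric] Nb[symmetric])
    finally show ?thesis
      by (simp add: eq_neg_iff_add_eq_0)
  qed
  define P where "P = {i. \<sigma> * u $ i = M * b}"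
  \<comment> \<open>The sum of the entries is zero, and it equals \<open>N * b\<close> times the
    number of large entries, minus \<open>N * b\<close>. Hence there is exactly one large
    entry.\<close>
  have "(\<Sum>i\<in>UNIV. \<sigma> * u $ i) = (\<Sum>i\<in>UNIV. (if i \<in> P then N * b else 0) - b)"
    using vals by (intro sum.cong refl) (force simp: P_def M_def algebra_simps)
  also have "\<dots> = card P * (N * b) - N * b"
    by (simp add: sum_subtractf sum.If_cases N_def)
  also have "(\<Sum>i\<in>UNIV. \<sigma> * u $ i) = 0"
    using u by (simp add: sum_distrib_left[symmetric] Omega_def power_sum_def)
  finally have "real (card P) = 1"
    using N b by simp
  then obtain i where i: "P = {i}"
    by (metis card_1_singletonE of_nat_eq_1_iff)
  have "\<sigma> *\<^sub>R u = outlier i"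
    unfolding vec_eq_iff
  proof
    fix j
    show "(\<sigma> *\<^sub>R u) $ j = outlier i $ j"
      using vals[of j] i unfolding P_def by (cases "j = i") (auto simp: outlier_nth b_def N_def M_def)
  qed
  then have "u = outlier i \<or> u = - outlier i"
    using \<sigma>(2) by (metis scaleR_minus1_left scaleR_one minus_equation_iff)
  then show "u \<in> outliers"
    by (auto simp: outliers_def)
qed

lemma outliers_subset_Omega:
  assumes "CARD('n) \<ge> 3"
  shows "(outliers :: (real ^ 'n) set) \<subseteq> Omega"
  using outlier_in_Omega[OF assms] by (auto simp: outliers_def Omega_iff)

lemma JB_outlier:
  fixes i :: "'n::finite"
  assumes "CARD('n) \<ge> 3"
  shows "JB (outlier i) = J_plus CARD('n)"
proof -
  define N where "N = real CARD('n)"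
  have N: "N \<ge> 3"
    using assms by (simp add: N_def)
  define b where "b = outlier_scale N"
  have b: "b\<^sup>2 = 1 / (N * (N - 1))"
    using outlier_scale[OF N] by (simp add: b_def)
  have "power_sum 3 (outlier i) = ((N - 1) ^ 3 - (N - 1)) * b ^ 3"
    unfolding power_sum_outlier N_def b_def by simp
  then have p3: "(power_sum 3 (outlier i))\<^sup>2 = ((N - 1) ^ 3 - (N - 1))\<^sup>2 * (b\<^sup>2) ^ 3"
    by (simp add: power_mult_distrib flip: power_mult)
  have "power_sum 4 (outlier i) = ((N - 1) ^ 4 + (N - 1)) * b ^ 4"
    unfolding power_sum_outlier N_def b_def by simp
  then have p4: "power_sum 4 (outlier i) = ((N - 1) ^ 4 + (N - 1)) * (b\<^sup>2)\<^sup>2"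
    by (simp flip: power_mult)
  define M where "M = N - 1"
  have M: "M \<ge> 2" and NM: "N = M + 1"
    using N by (simp_all add: M_def)
  have "JB (outlier i) = N\<^sup>2 / 6 * ((M ^ 3 - M)\<^sup>2 * (1 / (N * M)) ^ 3)
        + N / 24 * (N * ((M ^ 4 + M) * (1 / (N * M))\<^sup>2) - 3)\<^sup>2"
    unfolding JB_def p3 p4 b N_def[symmetric] M_def[symmetric] ..
  also have "N\<^sup>2 / 6 * ((M ^ 3 - M)\<^sup>2 * (1 / (N * M)) ^ 3) = N * (4 * M * (M - 1)\<^sup>2) / (24 * M\<^sup>2)"
    using M unfolding NM by (simp add: divide_simps) (simp add: power2_eq_square power3_eq_cube algebra_simps)
  also have "N * ((M ^ 4 + M) * (1 / (N * M))\<^sup>2) - 3 = (M\<^sup>2 - 4 * M + 1) / M"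
    using M unfolding NM by (simp add: divide_simps) (simp add: power2_eq_square power4_eq_xxxx algebra_simps)
  also have "N * (4 * M * (M - 1)\<^sup>2) / (24 * M\<^sup>2) + N / 24 * ((M\<^sup>2 - 4 * M + 1) / M)\<^sup>2
     = N * ((M - 1) ^ 4 + 4 * M\<^sup>2) / (24 * M\<^sup>2)"
    using M by (simp add: divide_simps) (simp add: power2_eq_square power4_eq_xxxx algebra_simps)
  finally show ?thesis
    by (simp add: J_plus_def N_def M_def)
qed

lemma JB_eq_J_plus_iff:
  fixes u :: "real ^ 'n"
  assumes n: "CARD('n) \<ge> 3" and u: "u \<in> Omega"
  shows "JB u = J_plus CARD('n) \<longleftrightarrow> u \<in> outliers"
  using JB_maximal_imp_outlier[OF assms] JB_outlier[OF n] by (auto simp: outliers_def JB_neg)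

lemma card_outliers:
  assumes "CARD('n) \<ge> 3"
  shows "card (outliers :: (real ^ 'n) set) = 2 * CARD('n)"
proof -
  define N where "N = real CARD('n)"
  have N: "N \<ge> 3"
    using assms by (simp add: N_def)
  have b: "outlier_scale N > 0"
    using outlier_scale[OF N] by simp
  have inj: "inj (outlier :: 'n \<Rightarrow> _)"
  proof (rule injI)
    fix i j :: 'n assume "outlier i = outlier j"
    then have "outlier i $ i = outlier j $ i"
      by simp
    then show "i = j"
      using b N by (auto simp: outlier_nth N_def split: if_splits)
  qed
  moreover have "inj (\<lambda>i :: 'n. - outlier i)"
    using inj by (auto simp: inj_def)
  moreover have "range outlier \<inter> range (\<lambda>i :: 'n. - outlier i) = {}"
  proof -
    have "outlier i \<noteq> - outlier j" for i j :: 'n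
    proof
      assume eq: "outlier i = - outlier j"
      \<comment> \<open>With n \<ge> 3 there is an index different from \<open>i\<close> and
        \<open>j\<close>; there \<open>outlier i\<close> is negative and \<open>- outlier j\<close>
        is positive.\<close>
      have "card {i, j} < CARD('n)"
        using card_insert_le[of "{j}" i] assms card_insert_if[of "{j}" i] by (auto split: if_splits)
      then have "{i, j} \<noteq> UNIV"
        by auto
      then obtain k where k: "k \<noteq> i" "k \<noteq> j"
        by blast
      have "outlier i $ k = - outlier j $ k"
        using eq by simp
      then show False
        using k b by (simp add: outlier_nth N_def)
    qed
    then show ?thesis
      by blast
  qed
  ultimately show ?thesis
    unfolding outliers_def by (subst card_Un_disjoint) (auto simp: card_image)
qed

section \<open>The Riemannian Hessian at an outlier direction\<close>

text \<open>The repeated entry \<open>\<kappa>\<close> and the third power sum change sign with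
  \<open>e\<close>. Only their products and squares are recorded, so that the two signs share all
  later computations.\<close>

lemma outlier_moments:
  fixes e :: "real ^ 'n" and N :: real
  assumes n: "CARD('n) \<ge> 3" and e: "e \<in> outliers" and N_def: "N = real CARD('n)"
  obtains i \<kappa> where "\<And>j. j \<noteq> i \<Longrightarrow> e $ j = \<kappa>" "e $ i \<noteq> \<kappa>"
    "\<kappa>\<^sup>2 = 1 / (N * (N - 1))"
    "power_sum 3 e * \<kappa> = - (N - 2) / (N * (N - 1))"
    "(power_sum 3 e)\<^sup>2 = (N - 2)\<^sup>2 / (N * (N - 1))"
    "power_sum 4 e = (N\<^sup>2 - 3 * N + 3) / (N * (N - 1))"
proof -
  define M where "M = N - 1"
  define b where "b = outlier_scale N"
  have N: "N \<ge> 3"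
    using n by (simp add: N_def)
  have M: "M \<ge> 2" and NM: "N = M + 1"
    using N by (simp_all add: M_def)
  have b: "b\<^sup>2 = 1 / (N * M)" "b > 0"
    using outlier_scale[OF N] by (simp_all add: b_def M_def)
  obtain i \<sigma> where \<sigma>: "e = \<sigma> *\<^sub>R outlier i" "\<sigma> = 1 \<or> \<sigma> = (- 1 :: real)"
    using e by (auto simp: outliers_def) (metis scaleR_one, metis scaleR_minus1_left)
  have \<sigma>2: "\<sigma> ^ 2 = 1"
    using \<sigma>(2) by auto
  have ps: "power_sum r e = \<sigma> ^ r * ((M ^ r + M * (-1) ^ r) * b ^ r)" for r
    using \<sigma>(1) power_sum_outlier[of r i]
    by (simp add: power_sum_def power_mult_distrib sum_distrib_left[symmetric] N_def M_def b_def)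
  have p3: "power_sum 3 e = (\<sigma> * b) * ((M ^ 3 - M) * b\<^sup>2)"
  proof -
    have "power_sum 3 e = \<sigma> ^ 3 * ((M ^ 3 - M) * b ^ 3)"
      by (subst ps) simp
    also have "\<sigma> ^ 3 = \<sigma>"
      using \<sigma>2 by (simp add: power3_eq_cube power2_eq_square)
    finally show ?thesis
      by (simp add: power3_eq_cube power2_eq_square del: mult_cancel_left mult_cancel_right)
  qed
  have p4: "power_sum 4 e = (M ^ 4 + M) * (b\<^sup>2)\<^sup>2"
    using \<sigma>(2) by (subst ps) (auto simp flip: power_mult)
  have \<sigma>b: "(\<sigma> * b)\<^sup>2 = 1 / (N * M)"
    by (simp add: power_mult_distrib \<sigma>2 b)
  have E: "(M ^ 3 - M) * b\<^sup>2 = M - 1"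
    unfolding b NM using M by (simp add: divide_simps) (simp add: power2_eq_square power3_eq_cube algebra_simps)
  show ?thesis
  proof (rule that[of i "- \<sigma> * b"])
    show "e $ j = - \<sigma> * b" if "j \<noteq> i" for j
      using that \<sigma>(1) by (simp add: outlier_nth b_def N_def)
    have "outlier i $ i = M * b" "M * b > 0"
      using b(2) M by (simp_all add: outlier_nth b_def M_def N_def)
    then show "e $ i \<noteq> - \<sigma> * b"
      using \<sigma> b(2) by auto
    show "(- \<sigma> * b)\<^sup>2 = 1 / (N * (N - 1))"
      using \<sigma>b by (simp add: M_def)
    have "power_sum 3 e * (- \<sigma> * b) = - ((\<sigma> * b)\<^sup>2 * (M - 1))"
      unfolding p3 E by (simp add: power2_eq_square)
    also have "\<dots> = - (N - 2) / (N * (N - 1))"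
      unfolding \<sigma>b by (simp add: M_def minus_divide_left)
    finally show "power_sum 3 e * (- \<sigma> * b) = - (N - 2) / (N * (N - 1))" .
    show "(power_sum 3 e)\<^sup>2 = (N - 2)\<^sup>2 / (N * (N - 1))"
      unfolding p3 E power_mult_distrib[of "\<sigma> * b"] \<sigma>b by (simp add: M_def)
    show "power_sum 4 e = (N\<^sup>2 - 3 * N + 3) / (N * (N - 1))"
      unfolding p4 b(1) M_def[symmetric] unfolding NM using M
      by (simp add: divide_simps) (simp add: power2_eq_square power4_eq_xxxx algebra_simps)
  qed
qed

lemma tangent_iff: "v \<in> tangent u \<longleftrightarrow> v \<bullet> 1 = 0 \<and> u \<bullet> v = 0"
  by (simp add: tangent_def inner_vec_def)

text \<open>The vector \<open>e - \<kappa> *\<^sub>R 1\<close> is supported at the single index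
  \<open>i\<close>, and it is orthogonal to \<open>v\<close> because \<open>e\<close> and
  \<open>1\<close> are.\<close>

lemma tangent_outlier:
  fixes e :: "real ^ 'n"
  assumes "\<And>j. j \<noteq> i \<Longrightarrow> e $ j = \<kappa>" "e $ i \<noteq> \<kappa>" "v \<in> tangent e"
  shows "v $ i = 0"
proof -
  have "0 = e \<bullet> v - \<kappa> * (v \<bullet> 1)"
    using assms(3) by (simp add: tangent_iff)
  also have "\<dots> = (\<Sum>j\<in>UNIV. (e $ j - \<kappa>) * v $ j)"
    by (simp add: inner_vec_def sum_subtractf sum_distrib_left algebra_simps)
  also have "\<dots> = (\<Sum>j\<in>UNIV. if j = i then (e $ i - \<kappa>) * v $ i else 0)"
    using assms(1) by (intro sum.cong) auto
  also have "\<dots> = (e $ i - \<kappa>) * v $ i"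
    by simp
  finally show ?thesis
    using assms(2) by simp
qed

lemma outlier_weighted_sum:
  fixes e :: "real ^ 'n"
  assumes "\<And>j. j \<noteq> i \<Longrightarrow> e $ j = \<kappa>" "v i = 0"
  shows "(\<Sum>j\<in>UNIV. (e $ j) ^ r * v j) = \<kappa> ^ r * (\<Sum>j\<in>UNIV. v j)"
  unfolding sum_distrib_left
proof (intro sum.cong refl)
  fix j
  show "(e $ j) ^ r * v j = \<kappa> ^ r * v j"
    using assms by (cases "j = i") auto
qed

section \<open>Ambient and tangential derivatives of \<open>JB\<close>\<close>

definition vpow :: "nat \<Rightarrow> real ^ 'n \<Rightarrow> real ^ 'n" where
  "vpow r x = (\<chi> i. (x $ i) ^ r)"

lemma power_sum_has_derivative:
  "(power_sum r has_derivative (\<lambda>v. real r * (vpow (r - 1) x \<bullet> v))) (at x within S)"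
  unfolding power_sum_def
  by (auto intro!: derivative_eq_intros bounded_linear.has_derivative[OF bounded_linear_vec_nth]
      simp: fun_eq_iff vpow_def inner_vec_def sum_distrib_left mult_ac)

lemma vpow_has_derivative:
  "(vpow r has_derivative (\<lambda>v. \<chi> i. real r * (x $ i) ^ (r - 1) * v $ i)) (at x within S)"
  unfolding has_derivative_componentwise_within[of "vpow r"]
  by (auto intro!: derivative_eq_intros bounded_linear.has_derivative[OF bounded_linear_vec_nth]
      simp: Basis_vec_def inner_axis vpow_def mult_ac)

definition JB_grad :: "real ^ 'n \<Rightarrow> real ^ 'n" where
  "JB_grad x = ((real CARD('n))\<^sup>2 * power_sum 3 x) *\<^sub>R vpow 2 x
     + ((real CARD('n))\<^sup>2 / 3 * (CARD('n) * power_sum 4 x - 3)) *\<^sub>R vpow 3 x"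

lemma JB_has_derivative:
  fixes x :: "real ^ 'n"
  shows "(JB has_derivative (\<lambda>v. JB_grad x \<bullet> v)) (at x within S)"
proof -
  have "(JB has_derivative (\<lambda>v. (real CARD('n))\<^sup>2 / 6 * (2 * (3 * (vpow 2 x \<bullet> v)) * power_sum 3 x)
      + CARD('n) / 24 * (2 * (CARD('n) * (4 * (vpow 3 x \<bullet> v))) * (CARD('n) * power_sum 4 x - 3)))) (at x within S)"
    unfolding JB_def [abs_def]
    by (auto intro!: derivative_eq_intros power_sum_has_derivative[THEN has_derivative_eq_rhs]
        simp: fun_eq_iff)
  then show ?thesis
    by (rule has_derivative_eq_rhs)
      (simp add: JB_grad_def fun_eq_iff inner_add_left power2_eq_square algebra_simps)
qed

text \<open>On \<open>Omega\<close> this is the orthogonal projection of the ambient gradient onto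
  the tangent space. The formula makes sense on the whole space, so it can be differentiated by the
  ordinary product rule.\<close>

definition JB_tangent_grad :: "real ^ 'n \<Rightarrow> real ^ 'n" where
  "JB_tangent_grad x = JB_grad x - (JB_grad x \<bullet> x) *\<^sub>R x - (JB_grad x \<bullet> 1 / CARD('n)) *\<^sub>R 1"

lemma inner_one_one: "(1 :: real ^ 'n) \<bullet> 1 = CARD('n)"
  by (simp add: inner_vec_def)

text \<open>Adding multiples of the two constraint functions changes the ambient gradient into the
  tangential one without changing the function on \<open>Omega\<close>.\<close>

lemma JB_has_riemannian_gradient:
  fixes x :: "real ^ 'n"
  assumes x: "x \<in> Omega"
  shows "has_riemannian_gradient JB x (JB_tangent_grad x)"
  unfolding has_riemannian_gradient_def
proof
  define c where "c = JB_grad x \<bullet> x"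
  define m where "m = JB_grad x \<bullet> 1 / CARD('n)"
  have xx: "x \<bullet> x = 1" "x \<bullet> 1 = 0"
    using x by (auto simp: Omega_iff norm_eq_1)
  show "JB_tangent_grad x \<in> tangent x"
    using xx by (simp add: tangent_iff JB_tangent_grad_def inner_diff_left inner_diff_right inner_one_one inner_commute)
  define F :: "real ^ 'n \<Rightarrow> real" where "F y = JB y - c / 2 * (y \<bullet> y - 1) - m * (y \<bullet> 1)" for y
  have "(F has_derivative (\<lambda>v. JB_grad x \<bullet> v - c / 2 * (x \<bullet> v + v \<bullet> x) - m * (v \<bullet> 1))) (at x within Omega)"
    unfolding F_def by (auto intro!: derivative_eq_intros JB_has_derivative)
  then have "(F has_derivative (\<lambda>v. JB_tangent_grad x \<bullet> v)) (at x within Omega)"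
    by (rule has_derivative_eq_rhs)
      (simp add: JB_tangent_grad_def fun_eq_iff inner_diff_left inner_diff_right c_def m_def inner_commute)
  then show "(JB has_derivative (\<lambda>v. JB_tangent_grad x \<bullet> v)) (at x within Omega)"
    by (rule has_derivative_transform[OF x, rotated]) (auto simp: F_def Omega_iff norm_eq_1)
qed

text \<open>Tangent vectors vanish at the exceptional index, so \<open>e\<close> acts on them as the
  constant \<open>\<kappa>\<close>. The rank-one terms of the ambient second derivative contain the
  factor \<open>vpow r e \<bullet> v\<close> and drop out; the diagonal terms become multiples of
  \<open>v \<bullet> w\<close>. The curvature of the sphere subtracts the radial derivative
  \<open>c\<close>. This leaves a multiple of the identity.\<close>

lemma JB_has_riemannian_hessian:
  fixes e :: "real ^ 'n"
  assumes n: "CARD('n) \<ge> 3" and e: "e \<in> outliers"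
  shows "has_riemannian_hessian JB e (\<lambda>v. - lambda_n CARD('n) *\<^sub>R v)"
proof -
  define N where "N = real CARD('n)"
  have N: "N \<ge> 3"
    using n by (simp add: N_def)
  obtain i \<kappa> where i: "\<And>j. j \<noteq> i \<Longrightarrow> e $ j = \<kappa>" "e $ i \<noteq> \<kappa>"
    and \<kappa>: "\<kappa>\<^sup>2 = 1 / (N * (N - 1))"
    and p3\<kappa>: "power_sum 3 e * \<kappa> = - (N - 2) / (N * (N - 1))"
    and p3: "(power_sum 3 e)\<^sup>2 = (N - 2)\<^sup>2 / (N * (N - 1))"
    and p4: "power_sum 4 e = (N\<^sup>2 - 3 * N + 3) / (N * (N - 1))"
    by (rule outlier_moments[OF assms N_def]) (rule that; blast)
  define c where "c = JB_grad e \<bullet> e"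
  define g' where "g' v = (N\<^sup>2 * (3 * (vpow 2 e \<bullet> v))) *\<^sub>R vpow 2 e
      + (N\<^sup>2 * power_sum 3 e) *\<^sub>R (\<chi> i. 2 * e $ i * v $ i)
      + (N\<^sup>2 / 3 * (N * (4 * (vpow 3 e \<bullet> v)))) *\<^sub>R vpow 3 e
      + (N\<^sup>2 / 3 * (N * power_sum 4 e - 3)) *\<^sub>R (\<chi> i. 3 * (e $ i)\<^sup>2 * v $ i)" for v
  have g': "(JB_grad has_derivative g') (at e within S)" for S
    unfolding JB_grad_def [abs_def] g'_def [abs_def] N_def[symmetric]
    by (auto intro!: derivative_eq_intros power_sum_has_derivative[THEN has_derivative_eq_rhs]
        vpow_has_derivative[THEN has_derivative_eq_rhs] simp: fun_eq_iff)
  \<comment> \<open>The terms along \<open>e\<close> and \<open>1\<close> are normal and vanish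
    against tangent vectors, so only \<open>g' v - c *\<^sub>R v\<close> matters below.\<close>
  define D where "D v = g' v - ((JB_grad e \<bullet> v + g' v \<bullet> e) *\<^sub>R e + c *\<^sub>R v) - (g' v \<bullet> 1 / N) *\<^sub>R 1" for v
  have D: "(JB_tangent_grad has_derivative D) (at e within Omega)"
    unfolding JB_tangent_grad_def [abs_def] D_def [abs_def] N_def[symmetric]
    using N by (auto intro!: derivative_eq_intros g' simp: fun_eq_iff c_def)
  have "c = N\<^sup>2 * (power_sum 3 e)\<^sup>2 + N\<^sup>2 / 3 * (N * power_sum 4 e - 3) * power_sum 4 e"
  proof -
    have "vpow r e \<bullet> e = power_sum (Suc r) e" for r
      by (simp add: vpow_def inner_vec_def power_sum_def mult.commute)
    from this[of 2] this[of 3] show ?thesis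
      by (simp add: c_def JB_grad_def inner_add_left N_def power2_eq_square)
  qed
  moreover have "2 * (N\<^sup>2 * (power_sum 3 e * \<kappa>)) + N\<^sup>2 * (N * power_sum 4 e - 3) * \<kappa>\<^sup>2
     - (N\<^sup>2 * (power_sum 3 e)\<^sup>2 + N\<^sup>2 / 3 * (N * power_sum 4 e - 3) * power_sum 4 e) = - lambda_n CARD('n)"
    unfolding p3\<kappa> p3 p4 \<kappa> lambda_n_def N_def[symmetric] using N
    by (simp add: divide_simps) (simp add: power2_eq_square power3_eq_cube algebra_simps)
  ultimately have coeff: "2 * (N\<^sup>2 * (power_sum 3 e * \<kappa>)) + N\<^sup>2 * (N * power_sum 4 e - 3) * \<kappa>\<^sup>2 - c = - lambda_n CARD('n)"
    by simp
  have "- lambda_n CARD('n) *\<^sub>R v \<bullet> w = D v \<bullet> w" if v: "v \<in> tangent e" and w: "w \<in> tangent e" for v w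
  proof -
    have vi: "v $ i = 0"
      using tangent_outlier[OF i v] .
    have "vpow r e \<bullet> v = 0" for r
      using outlier_weighted_sum[OF i(1), where v = "\<lambda>j. v $ j" and r = r] vi v
      by (simp add: vpow_def inner_vec_def tangent_def)
    moreover have "(\<chi> i. 2 * e $ i * v $ i) \<bullet> w = 2 * \<kappa> * (v \<bullet> w)"
      using outlier_weighted_sum[OF i(1), where v = "\<lambda>j. v $ j * w $ j" and r = 1] vi
      by (simp add: inner_vec_def sum_distrib_left[symmetric] mult.assoc)
    moreover have "(\<chi> i. 3 * (e $ i)\<^sup>2 * v $ i) \<bullet> w = 3 * \<kappa>\<^sup>2 * (v \<bullet> w)"
      using outlier_weighted_sum[OF i(1), where v = "\<lambda>j. v $ j * w $ j" and r = 2] vi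
      by (simp add: inner_vec_def sum_distrib_left[symmetric] mult.assoc)
    ultimately have "g' v \<bullet> w = (2 * (N\<^sup>2 * (power_sum 3 e * \<kappa>)) + N\<^sup>2 * (N * power_sum 4 e - 3) * \<kappa>\<^sup>2) * (v \<bullet> w)"
      unfolding g'_def by (simp add: inner_add_left algebra_simps)
    moreover have "e \<bullet> w = 0" "1 \<bullet> w = 0"
      using w by (simp_all add: tangent_iff inner_commute)
    ultimately have "D v \<bullet> w = (2 * (N\<^sup>2 * (power_sum 3 e * \<kappa>)) + N\<^sup>2 * (N * power_sum 4 e - 3) * \<kappa>\<^sup>2 - c) * (v \<bullet> w)"
      by (simp add: D_def inner_diff_left inner_add_left algebra_simps)
    then show ?thesis
      by (simp only: coeff inner_scaleR_left)
  qed
  then show ?thesis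
    unfolding has_riemannian_hessian_def
    by (intro exI[of _ JB_tangent_grad] exI[of _ D])
       (auto simp: D JB_has_riemannian_gradient tangent_iff)
qed

section \<open>The uniform distribution as a Gaussian direction\<close>

definition gauss :: "'a::euclidean_space \<Rightarrow> real" where
  "gauss x = exp (- (x \<bullet> x) / 2) / sqrt (2 * pi) ^ DIM('a)"

lemma gauss_eq_prod: "gauss (x :: 'a::euclidean_space) = (\<Prod>b\<in>Basis. std_normal_density (x \<bullet> b))"
proof -
  have "(\<Prod>b\<in>Basis. std_normal_density (x \<bullet> b))
      = (\<Prod>b\<in>(Basis :: 'a set). 1 / sqrt (2 * pi)) * exp (\<Sum>b\<in>Basis. - (x \<bullet> b)\<^sup>2 / 2)"
    by (simp add: std_normal_density_def exp_sum prod_dividef power_divide)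
  also have "(\<Sum>b\<in>Basis. - (x \<bullet> b)\<^sup>2 / 2) = - (x \<bullet> x) / 2"
    by (simp add: sum_negf sum_divide_distrib[symmetric] power2_eq_square euclidean_inner[of x x])
  finally show ?thesis
    by (simp add: gauss_def power_divide)
qed

lemma gauss_pos: "gauss x > 0"
  by (simp add: gauss_def)

lemma gauss_measurable [measurable]: "gauss \<in> borel_measurable borel"
  unfolding gauss_def by measurable

definition gauss_measure :: "'a::euclidean_space measure" where
  "gauss_measure = density lborel (\<lambda>x. ennreal (gauss x))"

lemma sets_gauss_measure [measurable_cong, simp]: "sets gauss_measure = sets borel"
  and space_gauss_measure [simp]: "space gauss_measure = UNIV"
  by (simp_all add: gauss_measure_def)

lemma prob_space_gauss_measure: "prob_space (gauss_measure :: 'a::euclidean_space measure)"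
proof
  have "(\<integral>\<^sup>+x. std_normal_density x \<partial>lborel) = 1"
    using prob_space.emeasure_space_1[OF prob_space_normal_density, of 1 0]
    by (simp add: emeasure_density)
  then have "(\<integral>\<^sup>+x. ennreal (gauss x) \<partial>lborel) = (1 :: ennreal)" for x :: 'a
    unfolding gauss_eq_prod
    by (subst prod_ennreal[symmetric], simp, subst nn_integral_lborel_prod) auto
  then show "emeasure gauss_measure (space (gauss_measure :: 'a measure)) = 1"
    by (simp add: gauss_measure_def emeasure_density)
qed

lemma gauss_measure_orthogonal:
  fixes T :: "'a::euclidean_space \<Rightarrow> 'a"
  assumes T: "orthogonal_transformation T"
  shows "distr gauss_measure borel T = gauss_measure"
proof -
  have [measurable]: "T \<in> borel_measurable borel"
    using T by measurable
  have "gauss (T x) = gauss x" for x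
    using T by (simp add: gauss_def orthogonal_transformation_def)
  then have "distr gauss_measure borel T = distr (density lborel (\<lambda>x. ennreal (gauss (T x)))) borel T"
    by (simp add: gauss_measure_def)
  also have "\<dots> = density (distr lborel borel T) (\<lambda>x. ennreal (gauss x))"
    by (subst density_distr) auto
  finally show ?thesis
    by (simp add: lborel_distr_orthogonal_transformation[OF T] gauss_measure_def)
qed

lemma AE_gauss_measure: "(AE x in gauss_measure. P x) \<longleftrightarrow> (AE x in lborel. P x)"
  unfolding gauss_measure_def by (subst AE_density) (auto simp: gauss_pos)

definition center :: "real ^ 'n \<Rightarrow> real ^ 'n" where
  "center x = x - (x \<bullet> 1 / CARD('n)) *\<^sub>R 1"

abbreviation dir :: "real ^ 'n \<Rightarrow> real ^ 'n" where
  "dir x \<equiv> sgn (center x)"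

lemma center_inner_one: "center x \<bullet> 1 = 0"
  by (simp add: center_def inner_diff_left inner_one_one)

lemma linear_center: "linear center"
  unfolding center_def
  by (intro linearI) (simp_all add: algebra_simps inner_add_left add_divide_distrib)

lemma continuous_on_center [continuous_intros]:
  "continuous_on S f \<Longrightarrow> continuous_on S (\<lambda>x. center (f x))"
  unfolding center_def by (intro continuous_intros) auto

lemma center_measurable [measurable]: "center \<in> borel_measurable borel"
  by (intro borel_measurable_continuous_onI continuous_intros)

lemma dir_in_Omega: "center x \<noteq> 0 \<Longrightarrow> dir x \<in> Omega"
  by (simp add: Omega_iff norm_sgn center_inner_one sgn_div_norm)

lemma AE_not_in_lowdim:
  fixes V :: "'a::euclidean_space set"
  assumes "dim V < DIM('a)"
  shows "AE x in lborel. x \<notin> span V"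
proof -
  have "negligible (span V)"
    using assms by (intro negligible_lowdim) simp
  then show ?thesis
    using closed_span[of V]
    by (intro AE_not_in) (simp add: negligible_iff_null_sets null_sets_completion_iff borel_closed)
qed

lemma AE_center_nonzero:
  assumes "CARD('n) \<ge> 3"
  shows "AE x in lborel. center (x :: real ^ 'n) \<noteq> 0"
proof -
  have "dim {1 :: real ^ 'n} \<le> card {1 :: real ^ 'n}"
    by (rule dim_le_card) (auto intro: span_base)
  then have "AE x in lborel. x \<notin> span {1 :: real ^ 'n}"
    using assms by (intro AE_not_in_lowdim) auto
  then show ?thesis
  proof eventually_elim
    case (elim x)
    have "(x \<bullet> 1 / CARD('n)) *\<^sub>R (1 :: real ^ 'n) \<in> span {1}"
      by (intro span_mul span_base) simp
    with elim show ?case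
      by (auto simp: center_def)
  qed
qed

lemma compact_Omega: "compact (Omega :: (real ^ 'n) set)"
proof -
  have "Omega = {u :: real ^ 'n. u \<bullet> 1 = 0} \<inter> sphere 0 1"
    by (auto simp: Omega_iff)
  moreover have "closed {u :: real ^ 'n. u \<bullet> 1 = 0}"
    using closed_hyperplane[of "1 :: real ^ 'n" 0] by (simp add: inner_commute)
  ultimately show ?thesis
    by (metis closed_Int_compact compact_sphere)
qed

text \<open>The group consists of the orthogonal maps fixing the vector \<open>1\<close>: they
  preserve \<open>Omega\<close>, commute with \<open>center\<close> and leave the Gaussian measure
  invariant. It is transitive on \<open>Omega\<close>, because the reflection swapping two of its
  points fixes \<open>1\<close>, which is orthogonal to both.\<close>

lemma uniform_on_Omega_distr:
  fixes U :: "'a \<Rightarrow> real ^ 'n"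
  assumes n: "CARD('n) \<ge> 3" and M: "prob_space M" and U: "uniform_on_Omega M U"
  shows "distr M borel U = distr gauss_measure borel dir"
proof (rule invariant_measure_unique[where S = Omega
    and G = "{T. orthogonal_transformation T \<and> T (1 :: real ^ 'n) = 1}"])
  have [measurable]: "U \<in> borel_measurable M" and U_AE: "AE x in M. U x \<in> Omega"
    using U by (auto simp: uniform_on_Omega_def)
  have [measurable]: "(Omega :: (real ^ 'n) set) \<in> sets borel"
    using compact_Omega by (intro borel_closed compact_imp_closed)
  show "prob_space (distr M borel U)"
    using M by (rule prob_space.prob_space_distr) simp
  show "prob_space (distr gauss_measure borel (dir :: real ^ 'n \<Rightarrow> _))"
    using prob_space_gauss_measure by (rule prob_space.prob_space_distr) simp
  show "compact (Omega :: (real ^ 'n) set)"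
    by (rule compact_Omega)
  show "AE u in distr M borel U. u \<in> Omega"
    using U_AE by (simp add: AE_distr_iff)
  show "AE u in distr gauss_measure borel dir. u \<in> (Omega :: (real ^ 'n) set)"
    using AE_center_nonzero[OF n] by (auto simp: AE_distr_iff AE_gauss_measure dir_in_Omega elim: eventually_mono)
  fix T :: "real ^ 'n \<Rightarrow> real ^ 'n" assume "T \<in> {T. orthogonal_transformation T \<and> T (1 :: real ^ 'n) = 1}"
  then have T: "orthogonal_transformation T" and T1: "T 1 = 1"
    by auto
  then show "orthogonal_transformation T" by simp
  have [measurable]: "T \<in> borel_measurable borel"
    using T by (rule orthogonal_transformation_measurable)
  have lin: "linear T"
    using T by (rule orthogonal_transformation_linear)
  have inner1: "T x \<bullet> 1 = x \<bullet> 1" for x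
    using T T1 by (metis orthogonal_transformation_def)
  have nrm: "norm (T x) = norm x" for x
    using T by (rule orthogonal_transformation_norm)
  have "T ` Omega = Omega"
  proof
    show "T ` Omega \<subseteq> Omega"
      by (auto simp: Omega_iff inner1 nrm)
    show "Omega \<subseteq> T ` Omega"
    proof
      fix y :: "real ^ 'n" assume y: "y \<in> Omega"
      obtain x where "y = T x"
        using orthogonal_transformation_surj[OF T] by (metis surjD)
      then show "y \<in> T ` Omega"
        using y by (auto simp: Omega_iff inner1 nrm)
    qed
  qed
  then show "distr (distr M borel U) borel T = distr M borel U"
    using U T by (simp add: uniform_on_Omega_def distr_distr comp_def)
  have "center (T x) = T (center x)" for x
    by (simp add: center_def inner1 linear_diff[OF lin] linear_cmul[OF lin] T1)
  then have "dir (T x) = T (dir x)" for x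
    by (simp add: sgn_div_norm nrm linear_cmul[OF lin])
  then have "distr (distr gauss_measure borel dir) borel T = distr (distr gauss_measure borel T) borel dir"
    by (simp add: distr_distr comp_def)
  then show "distr (distr gauss_measure borel dir) borel T = distr gauss_measure borel dir"
    by (simp add: gauss_measure_orthogonal[OF T])
next
  fix x y :: "real ^ 'n" assume xy: "x \<in> Omega" "y \<in> Omega"
  then have "norm x = norm y" "1 \<bullet> x = 1 \<bullet> y"
    by (auto simp: Omega_iff inner_commute)
  then show "\<exists>T\<in>{T. orthogonal_transformation T \<and> T (1 :: real ^ 'n) = 1}. T x = y"
    using reflection_exists[of x y] by (metis (mono_tags, lifting) mem_Collect_eq)
qed auto

section \<open>Absolute continuity\<close>

text \<open>Near a point where the derivative is nonzero it stays away from 0 by continuity, so by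
  the mean value theorem \<open>g\<close> is injective there with Lipschitz inverse. The set is thus
  locally a Lipschitz image of a null set.\<close>

lemma negligible_vimage_nonzero_deriv:
  fixes g g' :: "real \<Rightarrow> real"
  assumes der: "\<And>x. (g has_real_derivative g' x) (at x)"
    and cont: "continuous_on UNIV g'"
    and N: "negligible N"
  shows "negligible {x. g' x \<noteq> 0 \<and> g x \<in> N}" (is "negligible ?S")
  unfolding locally_negligible_alt[of ?S]
proof
  fix x0 assume x0: "x0 \<in> ?S"
  define \<delta> where "\<delta> = \<bar>g' x0\<bar> / 2"
  have \<delta>: "\<delta> > 0"
    using x0 by (simp add: \<delta>_def)
  have "isCont g' x0"
    using cont by (simp add: continuous_on_eq_continuous_at)
  then obtain r where r: "r > 0" "\<And>x. dist x x0 < r \<Longrightarrow> dist (g' x) (g' x0) < \<delta>"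
    using \<delta> unfolding continuous_at_eps_delta by metis
  have big: "\<bar>g' x\<bar> \<ge> \<delta>" if "x \<in> ball x0 r" for x
  proof -
    have "\<bar>g' x - g' x0\<bar> < \<delta>"
      using r(2)[of x] that unfolding dist_real_def mem_ball by (simp add: abs_minus_commute)
    then show ?thesis
      unfolding \<delta>_def by linarith
  qed
  have lip_less: "\<delta> * (y - x) \<le> \<bar>g y - g x\<bar>" if "x \<in> ball x0 r" "y \<in> ball x0 r" "x < y" for x y
  proof -
    obtain z where z: "x < z" "z < y" "g y - g x = (y - x) * g' z"
      using MVT2[OF \<open>x < y\<close>, of g g'] der by blast
    have "z \<in> ball x0 r"
      using that z by (auto simp: dist_real_def)
    then have "\<delta> * (y - x) \<le> \<bar>g' z\<bar> * (y - x)"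
      using big z by (intro mult_right_mono) auto
    also have "\<dots> = \<bar>g y - g x\<bar>"
      using z by (simp add: abs_mult mult.commute)
    finally show ?thesis .
  qed
  have lip: "\<delta> * \<bar>y - x\<bar> \<le> \<bar>g y - g x\<bar>" if "x \<in> ball x0 r" "y \<in> ball x0 r" for x y
    using lip_less[of x y] lip_less[of y x] that by (cases x y rule: linorder_cases) auto
  define E where "E = ball x0 r \<inter> ?S"
  define h where "h = inv_into (ball x0 r) g"
  have inj: "inj_on g (ball x0 r)"
  proof (rule inj_onI)
    fix x y assume "x \<in> ball x0 r" "y \<in> ball x0 r" "g x = g y"
    then have "\<delta> * \<bar>y - x\<bar> \<le> 0"
      using lip[of x y] by simp
    then show "x = y"
      using \<delta> by (simp add: mult_le_0_iff)
  qed
  have hg: "h (g x) = x" if "x \<in> ball x0 r" for x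
    using inj that by (simp add: h_def)
  have "negligible (h ` (g ` E))"
  proof (rule negligible_locally_Lipschitz_image)
    show "negligible (g ` E)"
      by (rule negligible_subset[OF N]) (auto simp: E_def)
    fix u assume "u \<in> g ` E"
    then obtain x where x: "x \<in> E" "u = g x"
      by auto
    show "\<exists>T B. open T \<and> u \<in> T \<and> (\<forall>v\<in>g ` E \<inter> T. norm (h v - h u) \<le> B * norm (v - u))"
    proof (intro exI[of _ UNIV] exI[of _ "1 / \<delta>"] conjI ballI)
      fix v assume "v \<in> g ` E \<inter> UNIV"
      then obtain y where y: "y \<in> E" "v = g y"
        by auto
      have "\<delta> * \<bar>y - x\<bar> \<le> \<bar>g y - g x\<bar>"
        using x y by (intro lip) (auto simp: E_def)
      then show "norm (h v - h u) \<le> 1 / \<delta> * norm (v - u)"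
        using x y \<delta> by (simp add: E_def hg field_simps)
    qed auto
  qed simp
  moreover have "h ` (g ` E) = E"
    using hg by (force simp: E_def image_image)
  ultimately have "negligible E"
    by simp
  moreover have "openin (top_of_set ?S) E"
    using openin_open_Int[OF open_ball, of ?S x0 r] unfolding E_def by (subst Int_commute)
  moreover have "x0 \<in> E"
    using x0 r by (simp add: E_def)
  ultimately show "\<exists>U. openin (top_of_set ?S) U \<and> x0 \<in> U \<and> negligible U"
    by blast
qed

lemma power_sum_scaleR: "power_sum r (c *\<^sub>R x) = c ^ r * power_sum r x"
  by (simp add: power_sum_def power_mult_distrib sum_distrib_left)

lemma power_sum_2: "power_sum 2 x = (norm x)\<^sup>2"
  unfolding power2_norm_eq_inner by (simp add: power_sum_def inner_vec_def power2_eq_square)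

text \<open>Extending by the eighth power of the norm clears all denominators and leaves no square
  root: a quotient of two polynomials of degree 8. This makes \<open>JB\<close> rational along
  lines.\<close>

lemma JB_sgn:
  fixes x :: "real ^ 'n"
  assumes "x \<noteq> 0"
  shows "JB (sgn x) = ((real CARD('n))\<^sup>2 / 6 * (power_sum 3 x)\<^sup>2 * power_sum 2 x
      + CARD('n) / 24 * (CARD('n) * power_sum 4 x - 3 * (power_sum 2 x)\<^sup>2)\<^sup>2) / (power_sum 2 x) ^ 4"
proof -
  define s where "s = power_sum 2 x"
  have s: "s > 0" "(inverse (norm x))\<^sup>2 = 1 / s"
    using assms by (simp_all add: s_def power_sum_2 power_inverse divide_inverse)
  have "(power_sum 3 (sgn x))\<^sup>2 = ((inverse (norm x))\<^sup>2) ^ 3 * (power_sum 3 x)\<^sup>2"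
    unfolding sgn_div_norm power_sum_scaleR power_mult_distrib power_mult[symmetric] by (simp add: mult.commute)
  moreover have "power_sum 4 (sgn x) = ((inverse (norm x))\<^sup>2)\<^sup>2 * power_sum 4 x"
    unfolding sgn_div_norm power_sum_scaleR power_mult[symmetric] by simp
  ultimately have "JB (sgn x) = (real CARD('n))\<^sup>2 / 6 * ((1 / s) ^ 3 * (power_sum 3 x)\<^sup>2)
      + CARD('n) / 24 * (CARD('n) * ((1 / s)\<^sup>2 * power_sum 4 x) - 3)\<^sup>2"
    by (simp add: JB_def s(2))
  also have "(CARD('n) * ((1 / s)\<^sup>2 * power_sum 4 x) - 3)\<^sup>2 = (CARD('n) * power_sum 4 x - 3 * s\<^sup>2)\<^sup>2 / s ^ 4"
  proof -
    have "CARD('n) * ((1 / s)\<^sup>2 * power_sum 4 x) - 3 = (CARD('n) * power_sum 4 x - 3 * s\<^sup>2) / s\<^sup>2"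
      using s(1) by (simp add: field_simps power2_eq_square)
    then show ?thesis
      by (simp add: power_divide flip: power_mult)
  qed
  also have "(1 / s) ^ 3 * (power_sum 3 x)\<^sup>2 = (power_sum 3 x)\<^sup>2 * s / s ^ 4"
    using s(1) by (simp add: power_divide power3_eq_cube power4_eq_xxxx)
  finally show ?thesis
    unfolding s_def[symmetric] by (simp add: add_divide_distrib mult.assoc)
qed

lemma continuous_on_JB [continuous_intros]:
  "continuous_on S f \<Longrightarrow> continuous_on S (\<lambda>x. JB (f x))"
  unfolding JB_def power_sum_def by (intro continuous_intros) auto

lemma JB_measurable [measurable]: "JB \<in> borel_measurable borel"
  by (intro borel_measurable_continuous_onI continuous_intros)

lemma finite_outliers: "finite (outliers :: (real ^ 'n) set)"
  by (simp add: outliers_def)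

text \<open>Along the line \<open>x + t e\<close> the function is rational. Were it constant, letting
  \<open>t\<close> tend to infinity would give the value \<open>JB e\<close>, the maximum, hence
  \<open>dir x\<close> would be an outlier.\<close>

lemma JB_dir_line_null:
  fixes x e :: "real ^ 'n"
  assumes n: "CARD('n) \<ge> 3" and e: "e \<in> outliers"
    and x: "\<And>e'. e' \<in> outliers \<Longrightarrow> x \<notin> span {1, e'}"
    and N: "negligible N"
  shows "negligible {t. JB (dir (x + t *\<^sub>R e)) \<in> N}"
proof -
  define c where "c = center x"
  have e1: "norm e = 1" "e \<bullet> 1 = 0"
    using outliers_subset_Omega[OF n] e by (auto simp: Omega_iff)
  have center_e: "center e = e"
    by (simp add: center_def e1)
  have line: "center (x + t *\<^sub>R e) = c + t *\<^sub>R e" for t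
    by (simp add: linear_add[OF linear_center] linear_cmul[OF linear_center] center_e c_def)
  \<comment> \<open>Serves twice: the line never meets the kernel of \<open>center\<close>, so the
    denominator has no zero, and \<open>dir x\<close> is not an outlier.\<close>
  have x_span: "x \<in> span {1, e'}" if "center x = s *\<^sub>R e'" for s e'
  proof -
    have "x = s *\<^sub>R e' + (x \<bullet> 1 / CARD('n)) *\<^sub>R 1"
      using that by (simp add: center_def algebra_simps)
    also have "\<dots> \<in> span {1, e'}"
      by (intro span_add span_mul span_base) auto
    finally show ?thesis .
  qed
  have nz: "c + t *\<^sub>R e \<noteq> 0" for t
  proof
    assume "c + t *\<^sub>R e = 0"
    then have "center x = (- t) *\<^sub>R e"
      by (simp add: c_def add_eq_0_iff2)
    then show False
      using x_span x e by blast
  qed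
  define Q :: "nat \<Rightarrow> real poly" where "Q r = (\<Sum>i\<in>UNIV. [:c $ i, e $ i:] ^ r)" for r
  have Q: "poly (Q r) t = power_sum r (c + t *\<^sub>R e)" for r t
    by (simp add: Q_def poly_sum power_sum_def poly_power mult.commute)
  define a :: real where "a = (real CARD('n))\<^sup>2 / 6"
  define b :: real where "b = CARD('n) / 24"
  define A where "A = smult a ((Q 3)\<^sup>2 * Q 2) + smult b ((smult CARD('n) (Q 4) - smult 3 ((Q 2)\<^sup>2))\<^sup>2)"
  define B where "B = (Q 2) ^ 4"
  have B_pos: "poly B t > 0" for t
    using nz[of t] by (simp add: B_def poly_power Q power_sum_2)
  define g where "g t = JB (dir (x + t *\<^sub>R e))" for t
  have g: "g t = poly A t / poly B t" for t
    unfolding g_def line JB_sgn[OF nz] Q[symmetric] A_def B_def a_def b_def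
    by (simp add: poly_power mult.assoc)
  define R where "R = pderiv A * B - A * pderiv B"
  have der: "(g has_real_derivative poly R t / (poly B t)\<^sup>2) (at t)" for t
    unfolding g[abs_def] using B_pos[of t]
    by (auto intro!: derivative_eq_intros poly_DERIV simp: R_def power2_eq_square)
  have "R \<noteq> 0"
  proof
    assume "R = 0"
    then have der0: "(g has_real_derivative 0) (at t)" for t
      using der[of t] by simp
    have const: "g t = g 0" for t
      using DERIV_isconst_all der0 by blast
    have "((\<lambda>t. inverse t *\<^sub>R c + e) \<longlongrightarrow> 0 *\<^sub>R c + e) at_top"
      by (intro tendsto_intros tendsto_inverse_0_at_top filterlim_ident)
    then have "((\<lambda>t. sgn (inverse t *\<^sub>R c + e)) \<longlongrightarrow> sgn (0 *\<^sub>R c + e)) at_top"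
      using e1 by (intro tendsto_sgn) auto
    moreover have "sgn (0 *\<^sub>R c + e) = e"
      using e1 by (simp add: sgn_div_norm)
    moreover have "eventually (\<lambda>t. sgn (inverse t *\<^sub>R c + e) = sgn (c + t *\<^sub>R e)) at_top"
      using eventually_gt_at_top[of 0]
    proof eventually_elim
      case (elim t)
      have "sgn (c + t *\<^sub>R e) = sgn (t *\<^sub>R (inverse t *\<^sub>R c + e))"
        using elim by (simp add: algebra_simps)
      then show ?case
        using elim by (simp add: sgn_scaleR)
    qed
    ultimately have "((\<lambda>t. sgn (c + t *\<^sub>R e)) \<longlongrightarrow> e) at_top"
      using Lim_transform_eventually by fastforce
    moreover have "isCont JB e"
      using continuous_on_JB[OF continuous_on_id, of "UNIV :: (real ^ 'n) set"]
      by (simp only: continuous_on_eq_continuous_at[OF open_UNIV] ball_UNIV)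
    ultimately have "(g \<longlongrightarrow> JB e) at_top"
      unfolding g_def line by (rule isCont_tendsto_compose[rotated])
    moreover have "g = (\<lambda>_. g 0)"
      using const by auto
    ultimately have "JB e = g 0"
      by (metis tendsto_const tendsto_unique trivial_limit_at_top_linorder)
    then have "JB (dir x) = J_plus CARD('n)"
      using JB_eq_J_plus_iff[OF n, of e] e outliers_subset_Omega[OF n] by (auto simp: g_def)
    moreover have cx: "center x \<noteq> 0"
      using nz[of 0] by (simp add: c_def)
    ultimately have "dir x \<in> outliers"
      using JB_eq_J_plus_iff[OF n] dir_in_Omega by blast
    moreover have "center x = norm (center x) *\<^sub>R dir x"
      using cx by (simp add: sgn_div_norm)
    ultimately show False
      using x x_span by blast
  qed
  then have "finite {t. poly R t = 0}"
    by (rule poly_roots_finite)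
  moreover have "negligible {t. poly R t / (poly B t)\<^sup>2 \<noteq> 0 \<and> g t \<in> N}"
    using B_pos by (intro negligible_vimage_nonzero_deriv der N continuous_intros) (auto simp: less_imp_neq[symmetric])
  ultimately have "negligible ({t. poly R t = 0} \<union> {t. poly R t / (poly B t)\<^sup>2 \<noteq> 0 \<and> g t \<in> N})"
    by (rule negligible_Un[OF negligible_finite])
  then show ?thesis
    by (rule negligible_subset) (use B_pos in \<open>auto simp: g_def less_imp_neq[symmetric]\<close>)
qed

text \<open>The measure of \<open>E\<close> equals the average of the measures of its translates by
  multiples of \<open>e\<close> with parameter in [0, 1]. After Fubini this is an integral over the
  line sections of \<open>E\<close>, which are null.\<close>

lemma AE_lines_null:
  fixes E :: "'a::euclidean_space set"
  assumes [measurable]: "E \<in> sets borel"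
    and null: "AE x in lborel. negligible {t. x + t *\<^sub>R e \<in> E}"
  shows "emeasure lborel E = 0"
proof -
  have "emeasure lborel E = (\<integral>\<^sup>+t. indicator {0..1::real} t * emeasure lborel E \<partial>lborel)"
    by (subst nn_integral_multc) auto
  also have "\<dots> = (\<integral>\<^sup>+t. (\<integral>\<^sup>+x. indicator {0..1::real} t * indicator E (x + t *\<^sub>R e) \<partial>lborel) \<partial>lborel)"
  proof (rule nn_integral_cong)
    fix t :: real
    have "emeasure lborel E = emeasure (distr lborel borel (\<lambda>x. x + t *\<^sub>R e)) E"
      by (simp only: lborel_distr_plus_right)
    also have "\<dots> = (\<integral>\<^sup>+x. indicator E x \<partial>distr lborel borel (\<lambda>x. x + t *\<^sub>R e))"
      by simp
    also have "\<dots> = (\<integral>\<^sup>+x. indicator E (x + t *\<^sub>R e) \<partial>lborel)"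
      by (subst nn_integral_distr) auto
    finally show "indicator {0..1} t * emeasure lborel E
        = (\<integral>\<^sup>+x. indicator {0..1::real} t * indicator E (x + t *\<^sub>R e) \<partial>lborel)"
      by (subst nn_integral_cmult) auto
  qed
  also have "\<dots> = (\<integral>\<^sup>+x. (\<integral>\<^sup>+t. indicator {0..1::real} t * indicator E (x + t *\<^sub>R e) \<partial>lborel) \<partial>lborel)"
    by (rule lborel_pair.Fubini') measurable
  also have "\<dots> = (\<integral>\<^sup>+x. 0 \<partial>(lborel :: 'a measure))"
    using null
  proof (intro nn_integral_cong_AE, eventually_elim)
    case (elim x)
    have [measurable]: "{t. x + t *\<^sub>R e \<in> E} \<in> sets borel"
      by measurable
    have "{t. x + t *\<^sub>R e \<in> E} \<in> null_sets lborel"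
      using elim by (simp add: negligible_iff_null_sets null_sets_completion_iff)
    then have "AE t in lborel. indicator {0..1::real} t * indicator E (x + t *\<^sub>R e) = (0 :: ennreal)"
      by (rule AE_I') (auto split: split_indicator_asm)
    then show ?case
      by (simp add: nn_integral_0_iff_AE)
  qed
  finally show ?thesis
    by simp
qed

text \<open>The span of \<open>1\<close> and an outlier has dimension at most 2 < n, and there are
  finitely many outliers. Hence almost every point is admissible for
  \<open>JB_dir_line_null\<close>, with one fixed direction \<open>e\<close> for all lines.\<close>

lemma JB_dir_absolutely_continuous:
  assumes n: "CARD('n) \<ge> 3"
  shows "absolutely_continuous lborel (distr gauss_measure borel (\<lambda>x :: real ^ 'n. JB (dir x)))"
  unfolding absolutely_continuous_def
proof
  fix N :: "real set" assume N: "N \<in> null_sets lborel"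
  then have [measurable]: "N \<in> sets borel"
    by auto
  have negl: "negligible N"
    using N by (simp add: negligible_iff_null_sets null_sets_completionI)
  obtain e :: "real ^ 'n" where e: "e \<in> outliers"
    by (auto simp: outliers_def)
  have "AE x in lborel. \<forall>e'\<in>(outliers :: (real ^ 'n) set). x \<notin> span {1, e'}"
  proof (intro AE_ball_countable' AE_not_in_lowdim)
    fix e' :: "real ^ 'n"
    have "dim {1, e'} \<le> card {1, e'}"
      by (rule dim_le_card) (auto intro: span_base)
    also have "\<dots> \<le> 2"
      by (simp add: card_insert_if)
    finally show "dim {1, e'} < DIM(real ^ 'n)"
      using n by simp
  qed (rule countable_finite[OF finite_outliers])
  then have "AE x in lborel. negligible {t. x + t *\<^sub>R e \<in> {x :: real ^ 'n. JB (dir x) \<in> N}}"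
    by (rule eventually_mono) (use JB_dir_line_null[OF n e] negl in auto)
  then have "emeasure lborel {x :: real ^ 'n. JB (dir x) \<in> N} = 0"
    by (intro AE_lines_null) measurable
  then have "AE x in lborel. JB (dir (x :: real ^ 'n)) \<notin> N"
    by (subst AE_iff_measurable[OF _ refl]) auto
  then have "AE x in gauss_measure. JB (dir (x :: real ^ 'n)) \<notin> N"
    by (simp add: AE_gauss_measure)
  then have "emeasure gauss_measure {x :: real ^ 'n. JB (dir x) \<in> N} = 0"
    by (subst (asm) AE_iff_measurable[OF _ refl]) auto
  then show "N \<in> null_sets (distr gauss_measure borel (\<lambda>x :: real ^ 'n. JB (dir x)))"
    by (simp add: null_sets_def emeasure_distr vimage_def)
qed

section \<open>Polar coordinates around a direction\<close>

definition perp :: "'a::euclidean_space \<Rightarrow> 'a \<Rightarrow> 'a \<Rightarrow> 'a" where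
  "perp a b x = x - (x \<bullet> a) *\<^sub>R a - (x \<bullet> b) *\<^sub>R b"

definition stretch :: "'a::euclidean_space \<Rightarrow> 'a \<Rightarrow> real \<Rightarrow> 'a \<Rightarrow> 'a" where
  "stretch a b s x = (x \<bullet> a) *\<^sub>R a + (x \<bullet> b) *\<^sub>R b + s *\<^sub>R perp a b x"

lemma continuous_on_perp [continuous_intros]:
  "continuous_on S f \<Longrightarrow> continuous_on S (\<lambda>x. perp a b (f x))"
  unfolding perp_def by (intro continuous_intros)

lemma perp_measurable [measurable]: "perp a b \<in> borel_measurable borel"
  by (intro borel_measurable_continuous_onI continuous_intros)

lemma stretch_measurable [measurable]:
  assumes [measurable]: "f \<in> borel_measurable M" "g \<in> borel_measurable M"
  shows "(\<lambda>x. stretch a b (f x) (g x)) \<in> borel_measurable M"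
  unfolding stretch_def by measurable

locale orthonormal_pair =
  fixes a b :: "'a::euclidean_space"
  assumes norm_a: "a \<bullet> a = 1" and norm_b: "b \<bullet> b = 1" and orth: "a \<bullet> b = 0"
begin

lemma perp_inner: "perp a b x \<bullet> a = 0" "perp a b x \<bullet> b = 0"
  using norm_a norm_b orth by (simp_all add: perp_def inner_diff_left inner_diff_right inner_commute)

lemma stretch_inner: "stretch a b s x \<bullet> a = x \<bullet> a" "stretch a b s x \<bullet> b = x \<bullet> b"
  using norm_a norm_b orth by (simp_all add: stretch_def inner_add_left perp_inner inner_commute[of b a])

lemma perp_stretch: "perp a b (stretch a b s x) = s *\<^sub>R perp a b x"
  unfolding perp_def[of a b "stretch a b s x"] stretch_inner by (simp add: stretch_def)

lemma stretch_alt: "stretch a b s x = s *\<^sub>R x + (1 - s) *\<^sub>R ((x \<bullet> a) *\<^sub>R a + (x \<bullet> b) *\<^sub>R b)"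
  by (simp add: stretch_def perp_def algebra_simps)

lemma stretch_inner_self:
  "stretch a b s x \<bullet> stretch a b s x = (x \<bullet> a)\<^sup>2 + (x \<bullet> b)\<^sup>2 + s\<^sup>2 * (norm (perp a b x))\<^sup>2"
  unfolding stretch_def power2_norm_eq_inner
  using norm_a norm_b orth perp_inner[of x]
  by (simp add: inner_add_left inner_add_right inner_commute power2_eq_square)

text \<open>One reflection takes a basis vector to \<open>a\<close>; a second takes the image of
  another basis vector to \<open>b\<close>. The second fixes \<open>a\<close>, which is orthogonal
  to both the vector it moves and its target.\<close>

lemma frame_exists:
  obtains Q :: "'a \<Rightarrow> 'a" and k1 k2 :: 'a where "orthogonal_transformation Q" "Q k1 = a" "Q k2 = b" "k1 \<in> Basis" "k2 \<in> Basis" "k1 \<noteq> k2"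
proof -
  have "a \<noteq> b"
    using norm_a orth by auto
  have "\<exists>k1\<in>(Basis :: 'a set). \<exists>k2\<in>Basis. k1 \<noteq> k2"
  proof (rule ccontr)
    assume neg: "\<not> ?thesis"
    obtain k :: 'a where k: "k \<in> Basis"
      using nonempty_Basis by blast
    have B: "Basis = {k}"
      using neg k by blast
    have inner: "x \<bullet> y = (x \<bullet> k) * (y \<bullet> k)" for x y :: 'a
      by (subst euclidean_inner) (simp add: B)
    show False
      using norm_a norm_b orth inner[of a b] inner[of a a] inner[of b b] by auto
  qed
  then obtain k1 k2 :: 'a where k: "k1 \<in> Basis" "k2 \<in> Basis" "k1 \<noteq> k2"
    by blast
  have "norm k1 = norm a" "norm k2 = norm b"
    using norm_a norm_b k by (simp_all add: norm_eq_1 norm_eq)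
  then obtain T1 :: "'a \<Rightarrow> 'a" where T1: "orthogonal_transformation T1" "T1 k1 = a"
    using reflection_exists by metis
  have "norm (T1 k2) = norm b"
    using \<open>norm k2 = norm b\<close> orthogonal_transformation_norm[OF T1(1)] by simp
  then obtain T2 :: "'a \<Rightarrow> 'a" where T2: "orthogonal_transformation T2" "T2 (T1 k2) = b"
    "\<And>x. x \<bullet> T1 k2 = x \<bullet> b \<Longrightarrow> T2 x = x"
    using reflection_exists by metis
  have "a \<bullet> T1 k2 = k1 \<bullet> k2"
    using T1 by (metis orthogonal_transformation_def)
  then have "T2 a = a"
    using T2(3)[of a] k orth by (simp add: inner_Basis)
  then show ?thesis
    using that[of "T2 \<circ> T1" k1 k2] orthogonal_transformation_compose[OF T2(1) T1(1)] T1 T2 k by simp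
qed

text \<open>In an orthonormal frame starting with \<open>a\<close> and \<open>b\<close>,
  \<open>stretch a b s\<close> is diagonal with entries 1, 1, s, ..., s; its determinant is the
  factor in front.\<close>

lemma nn_integral_stretch:
  assumes s: "s > 0" and [measurable]: "h \<in> borel_measurable borel"
  shows "(\<integral>\<^sup>+x. h x \<partial>lborel) = ennreal (s ^ (DIM('a) - 2)) * (\<integral>\<^sup>+x. h (stretch a b s x) \<partial>lborel)"
proof -
  obtain Q :: "'a \<Rightarrow> 'a" and k1 k2 :: 'a where Q: "orthogonal_transformation Q" "Q k1 = a" "Q k2 = b"
    and k: "k1 \<in> Basis" "k2 \<in> Basis" "k1 \<noteq> k2"
    by (rule frame_exists)
  have lin: "linear Q"
    using Q(1) by (rule orthogonal_transformation_linear)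
  have [measurable]: "Q \<in> borel_measurable borel"
    using Q(1) by (rule orthogonal_transformation_measurable)
  have inv: "(\<integral>\<^sup>+x. f x \<partial>lborel) = (\<integral>\<^sup>+x. f (Q x) \<partial>lborel)"
    if [measurable]: "f \<in> borel_measurable borel" for f :: "'a \<Rightarrow> ennreal"
    by (subst lborel_distr_orthogonal_transformation[OF Q(1), symmetric], subst nn_integral_distr) auto
  define c where "c j = (if j = k1 \<or> j = k2 then 1 else s)" for j
  define T where "T x = 0 + (\<Sum>j\<in>Basis. (c j * (x \<bullet> j)) *\<^sub>R j)" for x
  have [measurable]: "T \<in> borel_measurable borel"
    unfolding T_def[abs_def] by measurable
  have prod: "(\<Prod>j\<in>Basis. \<bar>c j\<bar>) = s ^ (DIM('a) - 2)"
  proof -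
    have "(\<Prod>j\<in>Basis. \<bar>c j\<bar>) = (\<Prod>j\<in>Basis - {k1, k2}. \<bar>c j\<bar>)"
      by (intro prod.mono_neutral_right) (auto simp: c_def)
    also have "\<dots> = (\<Prod>j\<in>Basis - {k1, k2}. s)"
      using s by (intro prod.cong) (auto simp: c_def)
    also have "\<dots> = s ^ (DIM('a) - 2)"
      using k by (simp add: card_Diff_subset numeral_2_eq_2)
    finally show ?thesis .
  qed
  have QT: "Q (T x) = stretch a b s (Q x)" for x
  proof -
    have "T x = (\<Sum>j\<in>Basis. (s * (x \<bullet> j)) *\<^sub>R j + (if j = k1 \<or> j = k2 then ((1 - s) * (x \<bullet> j)) *\<^sub>R j else 0))"
      unfolding T_def c_def by (simp, intro sum.cong) (auto simp: algebra_simps)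
    also have "\<dots> = s *\<^sub>R x + (\<Sum>j\<in>{k1, k2}. ((1 - s) * (x \<bullet> j)) *\<^sub>R j)"
    proof -
      have "(\<Sum>j\<in>Basis. (s * (x \<bullet> j)) *\<^sub>R j) = s *\<^sub>R x"
        by (subst (2) euclidean_representation[of x, symmetric]) (simp add: scaleR_sum_right)
      moreover have "(\<Sum>j\<in>Basis. if j = k1 \<or> j = k2 then ((1 - s) * (x \<bullet> j)) *\<^sub>R j else 0)
          = (\<Sum>j\<in>{k1, k2}. ((1 - s) * (x \<bullet> j)) *\<^sub>R j)"
        using k by (intro sum.mono_neutral_cong_right) auto
      ultimately show ?thesis
        by (simp only: sum.distrib)
    qed
    also have "\<dots> = s *\<^sub>R x + (1 - s) *\<^sub>R ((x \<bullet> k1) *\<^sub>R k1 + (x \<bullet> k2) *\<^sub>R k2)"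
      using k by (simp add: scaleR_add_right)
    finally have "Q (T x) = s *\<^sub>R Q x + (1 - s) *\<^sub>R ((x \<bullet> k1) *\<^sub>R a + (x \<bullet> k2) *\<^sub>R b)"
      by (simp add: linear_add[OF lin] linear_cmul[OF lin] Q)
    moreover have "x \<bullet> k1 = Q x \<bullet> a" "x \<bullet> k2 = Q x \<bullet> b"
      using Q by (metis orthogonal_transformation_def)+
    ultimately show ?thesis
      by (simp add: stretch_alt)
  qed
  have "(\<integral>\<^sup>+x. h x \<partial>lborel) = (\<integral>\<^sup>+x. h (Q x) \<partial>lborel)"
    by (rule inv) simp
  also have "\<dots> = (\<integral>\<^sup>+x. h (Q x) \<partial>density (distr lborel borel T) (\<lambda>_. ennreal (\<Prod>j\<in>Basis. \<bar>c j\<bar>)))"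
    unfolding T_def[abs_def] using s by (subst lborel_affine_euclidean[where c = c and t = 0]) (auto simp: c_def)
  also have "\<dots> = (\<integral>\<^sup>+x. ennreal (s ^ (DIM('a) - 2)) * h (Q (T x)) \<partial>lborel)"
    by (simp add: nn_integral_density nn_integral_distr prod)
  also have "\<dots> = ennreal (s ^ (DIM('a) - 2)) * (\<integral>\<^sup>+x. h (stretch a b s (Q x)) \<partial>lborel)"
    by (simp add: nn_integral_cmult QT)
  also have "(\<integral>\<^sup>+x. h (stretch a b s (Q x)) \<partial>lborel) = (\<integral>\<^sup>+x. h (stretch a b s x) \<partial>lborel)"
    by (rule inv[symmetric]) simp
  finally show ?thesis .
qed

definition annulus :: "'a set" where
  "annulus = {x. 0 < x \<bullet> b \<and> x \<bullet> b \<le> norm (perp a b x) \<and> norm (perp a b x) \<le> exp 1 * (x \<bullet> b)}"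

lemma annulus_measurable [measurable]: "annulus \<in> sets borel"
  unfolding annulus_def by measurable

text \<open>Polar coordinates in the orthogonal complement of \<open>a\<close> and \<open>b\<close>, the unit sphere
  being replaced by an annulus of logarithmic width \<open>1\<close>: insert
  \<open>1 = \<integral> ds/s\<close> over \<open>\<tau>/e \<le> s \<le> \<tau>\<close>, where \<open>\<tau> = \<bar>perp x\<bar> / (x \<bullet> b)\<close>, exchange the integrals
  and rescale by \<open>s\<close>.\<close>

lemma nn_integral_polar:
  assumes d: "DIM('a) \<ge> 3" and [measurable]: "h \<in> borel_measurable borel"
  shows "(\<integral>\<^sup>+x. h x * indicator {x. 0 < x \<bullet> b \<and> perp a b x \<noteq> 0} x \<partial>lborel)
    = (\<integral>\<^sup>+x. indicator annulus x *
         (\<integral>\<^sup>+s. ennreal (s ^ (DIM('a) - 3)) * indicator {0<..} s * h (stretch a b s x) \<partial>lborel) \<partial>lborel)"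
proof -
  \<comment> \<open>For \<open>s > 0\<close> this says that \<open>x\<close> is the
    \<open>s\<close>-stretch of a point of \<open>annulus\<close>. The quotients are multiplied out,
    and for fixed \<open>x\<close> the condition describes the interval of \<open>s\<close> of
    logarithmic length 1.\<close>
  define I where "I s x \<longleftrightarrow> 0 < x \<bullet> b \<and> 0 < s \<and> s * (x \<bullet> b) \<le> norm (perp a b x)
      \<and> norm (perp a b x) \<le> exp 1 * (s * (x \<bullet> b))" for s :: real and x :: 'a
  have [measurable]: "Measurable.pred (borel \<Otimes>\<^sub>M borel) (\<lambda>(s, x). I s x)"
    "Measurable.pred (borel \<Otimes>\<^sub>M borel) (\<lambda>(x, s). I s x)"
    unfolding I_def by measurable
  have [measurable]: "{x. I s x} \<in> sets borel" for s
    unfolding I_def by measurable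
  have log: "(\<integral>\<^sup>+s. ennreal (1 / s) * indicator {s. I s x} s \<partial>lborel)
      = indicator {x. 0 < x \<bullet> b \<and> perp a b x \<noteq> 0} x" for x
  proof (cases "0 < x \<bullet> b \<and> perp a b x \<noteq> 0")
    case True
    define \<tau> where "\<tau> = norm (perp a b x) / (x \<bullet> b)"
    have \<tau>: "\<tau> > 0" "\<tau> / exp 1 \<le> \<tau>"
      using True by (simp_all add: \<tau>_def divide_le_eq)
    have "I s x \<longleftrightarrow> s \<in> {\<tau> / exp 1..\<tau>}" for s
    proof -
      have "I s x \<longleftrightarrow> 0 < s \<and> s \<in> {\<tau> / exp 1..\<tau>}"
        using True unfolding I_def \<tau>_def by (auto simp: field_simps)
      moreover have "s > 0" if "s \<in> {\<tau> / exp 1..\<tau>}"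
        using that \<tau> by (auto intro: less_le_trans[rotated])
      ultimately show ?thesis
        by blast
    qed
    then have "{s. I s x} = {\<tau> / exp 1..\<tau>}"
      by (simp only: Collect_mem_eq)
    then have "(\<integral>\<^sup>+s. ennreal (1 / s) * indicator {s. I s x} s \<partial>lborel)
        = (\<integral>\<^sup>+s. ennreal (1 / s) * indicator {\<tau> / exp 1..\<tau>} s \<partial>lborel)"
      by simp
    also have "\<dots> = ennreal (ln \<tau> - ln (\<tau> / exp 1))"
    proof (rule nn_integral_FTC_Icc)
      fix s assume "s \<in> {\<tau> / exp 1..\<tau>}"
      then have "s > 0"
        using \<tau> by (auto intro: less_le_trans[rotated])
      then show "(ln has_real_derivative 1 / s) (at s)" "0 \<le> 1 / s"
        by (auto intro!: derivative_eq_intros)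
    qed (use \<tau> in auto)
    finally show ?thesis
      using True \<tau> by (simp add: ln_div)
  next
    case False
    have "\<not> I s x" for s
    proof
      assume "I s x"
      then have "0 < s * (x \<bullet> b)" "s * (x \<bullet> b) \<le> norm (perp a b x)" "0 < x \<bullet> b"
        by (auto simp: I_def)
      with False show False
        by auto
    qed
    with False show ?thesis
      by simp
  qed
  have "(\<integral>\<^sup>+x. h x * indicator {x. 0 < x \<bullet> b \<and> perp a b x \<noteq> 0} x \<partial>lborel)
      = (\<integral>\<^sup>+x. (\<integral>\<^sup>+s. h x * (ennreal (1 / s) * indicator {s. I s x} s) \<partial>lborel) \<partial>lborel)"
    unfolding log[symmetric] by (intro nn_integral_cong, subst nn_integral_cmult) auto
  also have "\<dots> = (\<integral>\<^sup>+s. (\<integral>\<^sup>+x. h x * (ennreal (1 / s) * indicator {s. I s x} s) \<partial>lborel) \<partial>lborel)"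
    by (rule lborel_pair.Fubini'[symmetric]) measurable
  also have "\<dots> = (\<integral>\<^sup>+s. (\<integral>\<^sup>+x. indicator annulus x * (ennreal (s ^ (DIM('a) - 3)) * indicator {0<..} s * h (stretch a b s x)) \<partial>lborel) \<partial>lborel)"
  proof (rule nn_integral_cong)
    fix s :: real
    show "(\<integral>\<^sup>+x. h x * (ennreal (1 / s) * indicator {s. I s x} s) \<partial>lborel)
      = (\<integral>\<^sup>+x. indicator annulus x * (ennreal (s ^ (DIM('a) - 3)) * indicator {0<..} s * h (stretch a b s x)) \<partial>lborel)"
    proof (cases "s > 0")
      case True
      have "DIM('a) - 2 = Suc (DIM('a) - 3)"
        using d by simp
      then have pw: "ennreal (s ^ (DIM('a) - 2)) * ennreal (1 / s) = ennreal (s ^ (DIM('a) - 3))"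
        using True by (simp add: ennreal_mult[symmetric])
      have I: "I s (stretch a b s x) \<longleftrightarrow> x \<in> annulus" for x
        using True by (auto simp: I_def annulus_def stretch_inner perp_stretch mult.left_commute)
      have [measurable]: "Measurable.pred borel (\<lambda>x. I s x)"
        unfolding I_def by measurable
      have "(\<integral>\<^sup>+x. h x * (ennreal (1 / s) * indicator {s. I s x} s) \<partial>lborel)
          = ennreal (s ^ (DIM('a) - 2)) * (\<integral>\<^sup>+x. h (stretch a b s x) * (ennreal (1 / s) * indicator {r. I r (stretch a b s x)} s) \<partial>lborel)"
        by (rule nn_integral_stretch[OF True, where h = "\<lambda>x. h x * (ennreal (1 / s) * indicator {s. I s x} s)"]) measurable
      also have "\<dots> = (\<integral>\<^sup>+x. ennreal (s ^ (DIM('a) - 2)) * (h (stretch a b s x) * (ennreal (1 / s) * indicator {r. I r (stretch a b s x)} s)) \<partial>lborel)"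
        by (rule nn_integral_cmult[symmetric]) measurable
      also have "\<dots> = (\<integral>\<^sup>+x. indicator annulus x * (ennreal (s ^ (DIM('a) - 3)) * indicator {0<..} s * h (stretch a b s x)) \<partial>lborel)"
        unfolding pw[symmetric] using True by (intro nn_integral_cong) (auto simp: I indicator_def mult_ac)
      finally show ?thesis .
    next
      case False
      then have "\<not> I s x" for x
        by (simp add: I_def)
      with False show ?thesis
        by simp
    qed
  qed
  also have "\<dots> = (\<integral>\<^sup>+x. (\<integral>\<^sup>+s. indicator annulus x * (ennreal (s ^ (DIM('a) - 3)) * indicator {0<..} s * h (stretch a b s x)) \<partial>lborel) \<partial>lborel)"
    by (rule lborel_pair.Fubini') measurable
  also have "\<dots> = (\<integral>\<^sup>+x. indicator annulus x *
         (\<integral>\<^sup>+s. ennreal (s ^ (DIM('a) - 3)) * indicator {0<..} s * h (stretch a b s x) \<partial>lborel) \<partial>lborel)"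
    by (intro nn_integral_cong nn_integral_cmult) measurable
  finally show ?thesis .
qed

end

section \<open>The constant of the leading term\<close>

lemma nn_integral_exp_square: "(\<integral>\<^sup>+x. ennreal (exp (- x\<^sup>2 / 2)) \<partial>lborel) = ennreal (sqrt (2 * pi))"
proof -
  have "(\<integral>\<^sup>+x. ennreal (exp (- x\<^sup>2 / 2)) \<partial>lborel)
      = (\<integral>\<^sup>+x. ennreal (sqrt (2 * pi)) * ennreal (std_normal_density x) \<partial>lborel)"
    by (intro nn_integral_cong) (simp add: std_normal_density_def ennreal_mult[symmetric])
  also have "\<dots> = ennreal (sqrt (2 * pi)) * (\<integral>\<^sup>+x. ennreal (std_normal_density x) \<partial>lborel)"
    by (rule nn_integral_cmult) simp
  also have "(\<integral>\<^sup>+x. ennreal (std_normal_density x) \<partial>lborel) = 1"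
    using prob_space.emeasure_space_1[OF prob_space_normal_density, of 1 0]
    by (simp add: emeasure_density)
  finally show ?thesis
    by simp
qed

text \<open>Layer cake: write \<open>exp (- r\<^sup>2 / 2)\<close> as the integral of \<open>w exp (- w\<^sup>2 / 2)\<close> over \<open>w \<ge> r\<close> and
  integrate over \<open>m\<close>-dimensional space first.\<close>

lemma nn_integral_half_moment:
  "(\<integral>\<^sup>+w. ennreal (w ^ Suc m * exp (- w\<^sup>2 / 2)) * indicator {0<..} w \<partial>lborel)
     = ennreal (sqrt (2 * pi) ^ m / unit_ball_vol (real m))"
proof -
  interpret product_sigma_finite "\<lambda>_::nat. lborel :: real measure" ..
  define A where "A = {..<m}"
  have A: "finite A" "card A = m"
    by (simp_all add: A_def)
  let ?P = "Pi\<^sub>M A (\<lambda>_. lborel :: real measure)"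
  interpret pair_sigma_finite ?P "lborel :: real measure"
    using sigma_finite[OF A(1)] by (simp add: pair_sigma_finite_def sigma_finite_lborel)
  define r where "r f = sqrt (\<Sum>i\<in>A. (f i)\<^sup>2)" for f :: "nat \<Rightarrow> real"
  have r0: "r f \<ge> 0" for f
    by (simp add: r_def sum_nonneg)
  have [measurable]: "r \<in> borel_measurable ?P"
    unfolding r_def[abs_def] by measurable
  define g where "g w = w * exp (- w\<^sup>2 / 2)" for w :: real
  have [measurable]: "g \<in> borel_measurable borel"
    unfolding g_def[abs_def] by measurable
  have V: "unit_ball_vol (real m) > 0"
    by simp
  have tail: "(\<integral>\<^sup>+w. ennreal (g w) * indicator {\<rho>..} w \<partial>lborel) = ennreal (exp (- \<rho>\<^sup>2 / 2))" if "\<rho> \<ge> 0" for \<rho>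
  proof -
    have "(\<integral>\<^sup>+w. ennreal (g w) * indicator {\<rho>..} w \<partial>lborel) = ennreal (0 - (- exp (- \<rho>\<^sup>2 / 2)))"
    proof (rule nn_integral_FTC_atLeast)
      fix w assume "\<rho> \<le> w"
      then show "((\<lambda>w. - exp (- w\<^sup>2 / 2)) has_real_derivative g w) (at w)" "0 \<le> g w"
        using that unfolding g_def by (auto intro!: derivative_eq_intros)
    next
      have "((\<lambda>w::real. - exp (- w\<^sup>2 / 2)) \<longlongrightarrow> - 0) at_top"
        by real_asymp
      then show "((\<lambda>w::real. - exp (- w\<^sup>2 / 2)) \<longlongrightarrow> 0) at_top"
        by simp
    qed simp
    then show ?thesis
      by simp
  qed
  have "ennreal (sqrt (2 * pi) ^ m) = (\<integral>\<^sup>+f. (\<Prod>i\<in>A. ennreal (exp (- (f i)\<^sup>2 / 2))) \<partial>?P)"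
    using A by (subst product_nn_integral_prod) (auto simp: nn_integral_exp_square[simplified] ennreal_power)
  also have "\<dots> = (\<integral>\<^sup>+f. ennreal (exp (- (r f)\<^sup>2 / 2)) \<partial>?P)"
    using A(1) by (intro nn_integral_cong)
      (simp add: prod_ennreal r_def sum_nonneg exp_sum[symmetric] sum_negf sum_divide_distrib)
  also have "\<dots> = (\<integral>\<^sup>+f. (\<integral>\<^sup>+w. ennreal (g w) * indicator {r f..} w \<partial>lborel) \<partial>?P)"
    by (simp only: tail[OF r0])
  also have "\<dots> = (\<integral>\<^sup>+f. (\<integral>\<^sup>+w. ennreal (g w) * indicator {q. r (fst q) \<le> snd q} (f, w) \<partial>lborel) \<partial>?P)"
    by (intro nn_integral_cong) (auto simp: indicator_def)
  also have "\<dots> = (\<integral>\<^sup>+w. (\<integral>\<^sup>+f. ennreal (g w) * indicator {q. r (fst q) \<le> snd q} (f, w) \<partial>?P) \<partial>lborel)"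
    by (rule Fubini'[symmetric]) measurable
  also have "\<dots> = (\<integral>\<^sup>+w. ennreal (unit_ball_vol (real m)) * (ennreal (w ^ Suc m * exp (- w\<^sup>2 / 2)) * indicator {0<..} w) \<partial>lborel)"
  proof (rule nn_integral_cong_AE)
    have "AE w in lborel. w \<noteq> (0::real)"
      by (rule AE_lborel_singleton)
    then show "AE w in lborel. (\<integral>\<^sup>+f. ennreal (g w) * indicator {q. r (fst q) \<le> snd q} (f, w) \<partial>?P)
      = ennreal (unit_ball_vol (real m)) * (ennreal (w ^ Suc m * exp (- w\<^sup>2 / 2)) * indicator {0<..} w)"
    proof eventually_elim
      case (elim w)
      show ?case
      proof (cases "w > 0")
        case True
        have [measurable]: "{f. r f \<le> w} \<inter> space ?P \<in> sets ?P"
          by measurable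
        have "(\<integral>\<^sup>+f. ennreal (g w) * indicator {q. r (fst q) \<le> snd q} (f, w) \<partial>?P)
            = (\<integral>\<^sup>+f. ennreal (g w) * indicator ({f. r f \<le> w} \<inter> space ?P) f \<partial>?P)"
          by (intro nn_integral_cong) (auto simp: indicator_def)
        also have "\<dots> = ennreal (g w) * emeasure ?P ({f. r f \<le> w} \<inter> space ?P)"
          by (subst nn_integral_cmult) auto
        also have "\<dots> = ennreal (g w) * ennreal (unit_ball_vol (real m) * w ^ m)"
          unfolding r_def using emeasure_cball_aux[OF A(1) True] A(2) by simp
        finally show ?thesis
          using True V by (simp add: g_def ennreal_mult[symmetric] mult_ac)
      next
        case False
        with elim have "w < 0" by simp
        then have "\<not> r f \<le> w" for f
          using r0[of f] by linarith
        with False show ?thesis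
          by simp
      qed
    qed
  qed
  also have "\<dots> = ennreal (unit_ball_vol (real m)) * (\<integral>\<^sup>+w. ennreal (w ^ Suc m * exp (- w\<^sup>2 / 2)) * indicator {0<..} w \<partial>lborel)"
    by (rule nn_integral_cmult) measurable
  finally have eq: "ennreal (sqrt (2 * pi) ^ m)
    = ennreal (unit_ball_vol (real m)) * (\<integral>\<^sup>+w. ennreal (w ^ Suc m * exp (- w\<^sup>2 / 2)) * indicator {0<..} w \<partial>lborel)" .
  have "ennreal (sqrt (2 * pi) ^ m / unit_ball_vol (real m)) = ennreal (1 / unit_ball_vol (real m)) * ennreal (sqrt (2 * pi) ^ m)"
    using V by (subst ennreal_mult[symmetric]) auto
  also have "\<dots> = (ennreal (1 / unit_ball_vol (real m)) * ennreal (unit_ball_vol (real m)))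
      * (\<integral>\<^sup>+w. ennreal (w ^ Suc m * exp (- w\<^sup>2 / 2)) * indicator {0<..} w \<partial>lborel)"
    by (simp only: eq mult.assoc)
  also have "ennreal (1 / unit_ball_vol (real m)) * ennreal (unit_ball_vol (real m)) = 1"
    using V less_imp_neq[OF V] by (subst ennreal_mult[symmetric]) auto
  finally show ?thesis
    by simp
qed

text \<open>With d = n - 2, this is the volume of the unit d-ball divided by the area of the
  d-dimensional unit sphere, hence the leading coefficient of the uniform probability of a small cap
  as a multiple of the d-th power of its radius.\<close>

definition cone_mass :: "nat \<Rightarrow> real" where
  "cone_mass n = Gamma ((real n - 1) / 2) / (2 * sqrt pi * Gamma (real n / 2))"

text \<open>The form in which the Gaussian integral produces the constant: 2 pi times the volume of
  the unit ball of dimension n - 3 is the area of the unit sphere of dimension n - 2.\<close>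

lemma cone_mass_unit_ball_vol:
  assumes "n \<ge> 3"
  shows "cone_mass n = unit_ball_vol (real (n - 2)) / (2 * pi * unit_ball_vol (real (n - 3)))"
proof -
  have e: "real (n - 2) / 2 + 1 = real n / 2" "real (n - 3) / 2 + 1 = (real n - 1) / 2"
    "real (n - 2) / 2 = real (n - 3) / 2 + 1 / 2"
    using assms by (simp_all add: of_nat_diff field_simps)
  have "pi powr (real (n - 2) / 2) = pi powr (real (n - 3) / 2) * sqrt pi"
    unfolding e(3) powr_add by (simp add: powr_half_sqrt)
  moreover have "A / (2 * r * B) = P * r / B / (2 * (r * r) * (P / A))"
    if "A > 0" "B > 0" "P > 0" "r > 0" for A B P r :: real
    using that by (simp add: field_simps)
  from this[of "Gamma ((real n - 1) / 2)" "Gamma (real n / 2)" "pi powr (real (n - 3) / 2)" "sqrt pi"]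
  have "cone_mass n = pi powr (real (n - 3) / 2) * sqrt pi / Gamma (real n / 2)
      / (2 * pi * (pi powr (real (n - 3) / 2) / Gamma ((real n - 1) / 2)))"
    using assms unfolding cone_mass_def by (simp add: Gamma_real_pos)
  ultimately show ?thesis
    unfolding unit_ball_vol_def e(1,2) by simp
qed

lemma cone_mass_pos: "n \<ge> 3 \<Longrightarrow> cone_mass n > 0"
  by (simp add: cone_mass_def)

context orthonormal_pair
begin

text \<open>The Gaussian density with the component orthogonal to \<open>a\<close> and
  \<open>b\<close> set to zero, that is, its value at the foot s = 0 of a ray. The normalisation is
  that of the full space, so this is not itself a probability density.\<close>

definition axial :: "'a \<Rightarrow> real" where
  "axial x = exp (- ((x \<bullet> a)\<^sup>2 + (x \<bullet> b)\<^sup>2) / 2) / sqrt (2 * pi) ^ DIM('a)"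

lemma axial_measurable [measurable]: "axial \<in> borel_measurable borel"
  unfolding axial_def by measurable

lemma axial_pos: "axial x > 0"
  by (simp add: axial_def)

lemma axial_stretch: "axial (stretch a b s x) = axial x"
  by (simp add: axial_def stretch_inner)

lemma gauss_stretch: "gauss (stretch a b s x) = axial x * exp (- (s * norm (perp a b x))\<^sup>2 / 2)"
  unfolding gauss_def axial_def stretch_inner_self
  by (simp add: exp_add[symmetric] power_mult_distrib field_simps)

text \<open>In a frame adapted to \<open>a\<close> and \<open>b\<close> the integral separates, with
  n the dimension: the component along \<open>a\<close> gives sqrt (2 pi); the slice of the cone at
  height w along \<open>b\<close> is a ball of dimension n - 2 and radius w; what remains is a
  half-line moment of order n - 2 in w.\<close>

lemma nn_integral_axial_cone:
  assumes d: "DIM('a) \<ge> 3"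
  shows "(\<integral>\<^sup>+x. ennreal (axial x) * indicator {x. 0 < x \<bullet> b \<and> norm (perp a b x) \<le> x \<bullet> b} x \<partial>lborel)
    = ennreal (cone_mass DIM('a))"
proof -
  obtain Q :: "'a \<Rightarrow> 'a" and k1 k2 :: 'a where Q: "orthogonal_transformation Q" "Q k1 = a" "Q k2 = b"
    and k: "k1 \<in> Basis" "k2 \<in> Basis" "k1 \<noteq> k2"
    by (rule frame_exists)
  have lin: "linear Q"
    using Q(1) by (rule orthogonal_transformation_linear)
  have [measurable]: "Q \<in> borel_measurable borel"
    using Q(1) by (rule orthogonal_transformation_measurable)
  have Qi: "Q x \<bullet> a = x \<bullet> k1" "Q x \<bullet> b = x \<bullet> k2" for x
    using Q by (metis orthogonal_transformation_def)+
  define I where "I = (Basis :: 'a set) - {k1, k2}"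
  have I: "finite I" "k1 \<notin> I" "k2 \<notin> I" "Basis = insert k1 (insert k2 I)"
    using k by (auto simp: I_def)
  have cI: "card I = DIM('a) - 2"
    using k by (simp add: I_def card_Diff_subset numeral_2_eq_2)
  have norm_perp: "norm (perp a b (Q x)) = sqrt (\<Sum>j\<in>I. (x \<bullet> j)\<^sup>2)" for x
  proof -
    have "perp a b (Q x) = Q (x - (x \<bullet> k1) *\<^sub>R k1 - (x \<bullet> k2) *\<^sub>R k2)"
      by (simp add: perp_def Qi linear_diff[OF lin] linear_cmul[OF lin] Q)
    then have "norm (perp a b (Q x)) = norm (x - (x \<bullet> k1) *\<^sub>R k1 - (x \<bullet> k2) *\<^sub>R k2)"
      by (simp add: orthogonal_transformation_norm[OF Q(1)])
    also have "\<dots> = sqrt (\<Sum>j\<in>Basis. ((x - (x \<bullet> k1) *\<^sub>R k1 - (x \<bullet> k2) *\<^sub>R k2) \<bullet> j)\<^sup>2)"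
      unfolding norm_eq_sqrt_inner by (subst euclidean_inner) (simp add: power2_eq_square)
    also have "(\<Sum>j\<in>Basis. ((x - (x \<bullet> k1) *\<^sub>R k1 - (x \<bullet> k2) *\<^sub>R k2) \<bullet> j)\<^sup>2) = (\<Sum>j\<in>I. (x \<bullet> j)\<^sup>2)"
      unfolding I_def using k
      by (intro sum.mono_neutral_cong_right) (auto simp: inner_diff_left inner_Basis)
    finally show ?thesis .
  qed
  define h where "h u w t = (if 0 < w \<and> t \<le> w then ennreal (exp (- (u\<^sup>2 + w\<^sup>2) / 2) / sqrt (2 * pi) ^ DIM('a)) else 0)"
    for u w t :: real
  have h_meas [measurable]: "(\<lambda>x. h (f x) (g x) (q x)) \<in> borel_measurable M"
    if [measurable]: "f \<in> borel_measurable M" "g \<in> borel_measurable M" "q \<in> borel_measurable M" for f g q M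
    unfolding h_def by measurable
  interpret product_sigma_finite "\<lambda>_::'a. lborel :: real measure" ..
  define V where "V = unit_ball_vol (real (card I))"
  have V: "V \<ge> 0"
    by (simp add: V_def)
  have "(\<integral>\<^sup>+x. ennreal (axial x) * indicator {x. 0 < x \<bullet> b \<and> norm (perp a b x) \<le> x \<bullet> b} x \<partial>lborel)
      = (\<integral>\<^sup>+x. h (x \<bullet> a) (x \<bullet> b) (norm (perp a b x)) \<partial>lborel)"
    by (intro nn_integral_cong) (auto simp: h_def axial_def indicator_def)
  also have "\<dots> = (\<integral>\<^sup>+x. h (Q x \<bullet> a) (Q x \<bullet> b) (norm (perp a b (Q x))) \<partial>lborel)"
    by (subst lborel_distr_orthogonal_transformation[OF Q(1), symmetric], subst nn_integral_distr) auto
  also have "\<dots> = (\<integral>\<^sup>+x. h (x \<bullet> k1) (x \<bullet> k2) (sqrt (\<Sum>j\<in>I. (x \<bullet> j)\<^sup>2)) \<partial>lborel)"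
    by (simp only: Qi norm_perp)
  also have "\<dots> = (\<integral>\<^sup>+f. h ((\<Sum>j\<in>Basis. f j *\<^sub>R j) \<bullet> k1) ((\<Sum>j\<in>Basis. f j *\<^sub>R j) \<bullet> k2)
      (sqrt (\<Sum>i\<in>I. ((\<Sum>j\<in>Basis. f j *\<^sub>R j) \<bullet> i)\<^sup>2)) \<partial>Pi\<^sub>M Basis (\<lambda>_. lborel))"
    by (subst lborel_eq, subst nn_integral_distr) auto
  also have "\<dots> = (\<integral>\<^sup>+f. h (f k1) (f k2) (sqrt (\<Sum>i\<in>I. (f i)\<^sup>2)) \<partial>Pi\<^sub>M Basis (\<lambda>_. lborel))"
  proof (intro nn_integral_cong)
    fix f :: "'a \<Rightarrow> real"
    have "(\<Sum>j\<in>Basis. f j *\<^sub>R j) \<bullet> i = f i" if "i \<in> Basis" for i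
      using that by (simp add: inner_sum_left_Basis)
    moreover have "(\<Sum>i\<in>I. ((\<Sum>j\<in>Basis. f j *\<^sub>R j) \<bullet> i)\<^sup>2) = (\<Sum>i\<in>I. (f i)\<^sup>2)"
      using calculation by (intro sum.cong) (auto simp: I_def)
    ultimately show "h ((\<Sum>j\<in>Basis. f j *\<^sub>R j) \<bullet> k1) ((\<Sum>j\<in>Basis. f j *\<^sub>R j) \<bullet> k2)
      (sqrt (\<Sum>i\<in>I. ((\<Sum>j\<in>Basis. f j *\<^sub>R j) \<bullet> i)\<^sup>2)) = h (f k1) (f k2) (sqrt (\<Sum>i\<in>I. (f i)\<^sup>2))"
      using k by simp
  qed
  also have "\<dots> = (\<integral>\<^sup>+u. (\<integral>\<^sup>+f. h u (f k2) (sqrt (\<Sum>i\<in>I. (f i)\<^sup>2)) \<partial>Pi\<^sub>M (insert k2 I) (\<lambda>_. lborel)) \<partial>lborel)"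
    unfolding I(4) using I(1-3) k
    by (subst product_nn_integral_insert_rev) (auto intro!: nn_integral_cong arg_cong[where f = "h _ _"] arg_cong[where f = sqrt] sum.cong)
  also have "\<dots> = (\<integral>\<^sup>+u. (\<integral>\<^sup>+w. (\<integral>\<^sup>+f. h u w (sqrt (\<Sum>i\<in>I. (f i)\<^sup>2)) \<partial>Pi\<^sub>M I (\<lambda>_. lborel)) \<partial>lborel) \<partial>lborel)"
    using I(1-3)
    by (subst product_nn_integral_insert_rev) (auto intro!: nn_integral_cong arg_cong[where f = "h _ _"] arg_cong[where f = sqrt] sum.cong)
  also have "\<dots> = (\<integral>\<^sup>+u. (\<integral>\<^sup>+w. ennreal (exp (- (u\<^sup>2 + w\<^sup>2) / 2) / sqrt (2 * pi) ^ DIM('a))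
      * (indicator {0<..} w * ennreal (V * w ^ card I)) \<partial>lborel) \<partial>lborel)"
  proof (intro nn_integral_cong)
    fix u w :: real
    let ?P = "Pi\<^sub>M I (\<lambda>_. lborel :: real measure)"
    show "(\<integral>\<^sup>+f. h u w (sqrt (\<Sum>i\<in>I. (f i)\<^sup>2)) \<partial>?P)
        = ennreal (exp (- (u\<^sup>2 + w\<^sup>2) / 2) / sqrt (2 * pi) ^ DIM('a)) * (indicator {0<..} w * ennreal (V * w ^ card I))"
    proof (cases "w > 0")
      case True
      have [measurable]: "{f. sqrt (\<Sum>i\<in>I. (f i)\<^sup>2) \<le> w} \<inter> space ?P \<in> sets ?P"
        by measurable
      have "(\<integral>\<^sup>+f. h u w (sqrt (\<Sum>i\<in>I. (f i)\<^sup>2)) \<partial>?P)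
          = (\<integral>\<^sup>+f. ennreal (exp (- (u\<^sup>2 + w\<^sup>2) / 2) / sqrt (2 * pi) ^ DIM('a))
              * indicator ({f. sqrt (\<Sum>i\<in>I. (f i)\<^sup>2) \<le> w} \<inter> space ?P) f \<partial>?P)"
        using True by (intro nn_integral_cong) (auto simp: h_def indicator_def)
      also have "\<dots> = ennreal (exp (- (u\<^sup>2 + w\<^sup>2) / 2) / sqrt (2 * pi) ^ DIM('a))
          * emeasure ?P ({f. sqrt (\<Sum>i\<in>I. (f i)\<^sup>2) \<le> w} \<inter> space ?P)"
        by (subst nn_integral_cmult) auto
      finally show ?thesis
        using True emeasure_cball_aux[OF I(1) True] by (simp add: V_def)
    qed (simp add: h_def)
  qed
  also have "\<dots> = (\<integral>\<^sup>+u. (\<integral>\<^sup>+w. ennreal (exp (- u\<^sup>2 / 2) * V / sqrt (2 * pi) ^ DIM('a))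
      * (ennreal (w ^ card I * exp (- w\<^sup>2 / 2)) * indicator {0<..} w) \<partial>lborel) \<partial>lborel)"
    using V by (intro nn_integral_cong)
      (auto simp: indicator_def ennreal_mult[symmetric] exp_add[symmetric] add_divide_distrib diff_divide_distrib)
  also have "\<dots> = (\<integral>\<^sup>+u. ennreal (exp (- u\<^sup>2 / 2) * V / sqrt (2 * pi) ^ DIM('a))
      * ennreal (sqrt (2 * pi) ^ (DIM('a) - 3) / unit_ball_vol (real (DIM('a) - 3))) \<partial>lborel)"
  proof (intro nn_integral_cong)
    fix u :: real
    \<comment> \<open>The half-line moment of order \<open>Suc m\<close> involves the ball of
      dimension m, so the order n - 2 brings in the ball of dimension n - 3.\<close>
    have "card I = Suc (DIM('a) - 3)"
      using d cI by simp
    then show "(\<integral>\<^sup>+w. ennreal (exp (- u\<^sup>2 / 2) * V / sqrt (2 * pi) ^ DIM('a))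
      * (ennreal (w ^ card I * exp (- w\<^sup>2 / 2)) * indicator {0<..} w) \<partial>lborel)
      = ennreal (exp (- u\<^sup>2 / 2) * V / sqrt (2 * pi) ^ DIM('a))
      * ennreal (sqrt (2 * pi) ^ (DIM('a) - 3) / unit_ball_vol (real (DIM('a) - 3)))"
      by (subst nn_integral_cmult) (simp_all only: nn_integral_half_moment, measurable)
  qed
  also have "\<dots> = (\<integral>\<^sup>+u. ennreal (exp (- u\<^sup>2 / 2))
      * ennreal (V / sqrt (2 * pi) ^ DIM('a) * (sqrt (2 * pi) ^ (DIM('a) - 3) / unit_ball_vol (real (DIM('a) - 3)))) \<partial>lborel)"
    using V by (intro nn_integral_cong) (simp add: ennreal_mult[symmetric])
  also have "\<dots> = ennreal (sqrt (2 * pi))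
      * ennreal (V / sqrt (2 * pi) ^ DIM('a) * (sqrt (2 * pi) ^ (DIM('a) - 3) / unit_ball_vol (real (DIM('a) - 3))))"
    by (subst nn_integral_multc) (auto simp: nn_integral_exp_square[simplified])
  also have "\<dots> = ennreal (cone_mass DIM('a))"
  proof -
    have "sqrt (2 * pi) ^ DIM('a) = sqrt (2 * pi) ^ (DIM('a) - 3) * sqrt (2 * pi) ^ 3"
      using d by (simp flip: power_add)
    also have "sqrt (2 * pi) ^ 3 = sqrt (2 * pi) * (2 * pi)"
      by (simp add: power3_eq_cube)
    finally have "sqrt (2 * pi) * (V / sqrt (2 * pi) ^ DIM('a) * (sqrt (2 * pi) ^ (DIM('a) - 3) / unit_ball_vol (real (DIM('a) - 3))))
        = V / (2 * pi * unit_ball_vol (real (DIM('a) - 3)))"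
      by (simp add: field_simps)
    then show ?thesis
      using V by (simp add: ennreal_mult[symmetric] cone_mass_unit_ball_vol[OF d] V_def cI)
  qed
  finally show ?thesis .
qed

text \<open>Polar coordinates applied to the cone integral. \<open>axial\<close> is constant along a
  ray, and the ray leaves the cone at T = \<open>x \<bullet> b / norm (perp a b x)\<close>, so with
  d = \<open>DIM('a) - 2\<close> the radial integral of s^(d - 1) is T^d / d.\<close>

lemma nn_integral_axial_annulus:
  assumes d: "DIM('a) \<ge> 3"
  shows "(\<integral>\<^sup>+x. indicator annulus x * ennreal (axial x * (x \<bullet> b / norm (perp a b x)) ^ (DIM('a) - 2)) \<partial>lborel)
    = ennreal (real (DIM('a) - 2) * cone_mass DIM('a))"
proof -
  define m where "m = DIM('a) - 2"
  have m: "m = Suc (DIM('a) - 3)" "real m > 0"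
    using d by (simp_all add: m_def)
  define h where "h x = ennreal (axial x) * indicator {x. 0 < x \<bullet> b \<and> norm (perp a b x) \<le> x \<bullet> b} x" for x
  have [measurable]: "h \<in> borel_measurable borel"
    unfolding h_def[abs_def] by measurable
  have "AE x in lborel. perp a b x \<noteq> 0"
  proof -
    have "dim {a, b} \<le> card {a, b}"
      by (rule dim_le_card) (auto intro: span_base)
    also have "\<dots> \<le> 2"
      by (simp add: card_insert_if)
    finally have "AE x in lborel. x \<notin> span {a, b}"
      using d by (intro AE_not_in_lowdim) simp
    then show ?thesis
    proof eventually_elim
      case (elim x)
      have "(x \<bullet> a) *\<^sub>R a + (x \<bullet> b) *\<^sub>R b \<in> span {a, b}"
        by (intro span_add span_mul span_base) auto
      with elim show ?case
        by (auto simp: perp_def diff_diff_eq)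
    qed
  qed
  then have "ennreal (cone_mass DIM('a)) = (\<integral>\<^sup>+x. h x * indicator {x. 0 < x \<bullet> b \<and> perp a b x \<noteq> 0} x \<partial>lborel)"
    unfolding nn_integral_axial_cone[OF d, symmetric] h_def
    by (intro nn_integral_cong_AE, eventually_elim) (auto simp: indicator_def)
  also have "\<dots> = (\<integral>\<^sup>+x. indicator annulus x *
         (\<integral>\<^sup>+s. ennreal (s ^ (DIM('a) - 3)) * indicator {0<..} s * h (stretch a b s x) \<partial>lborel) \<partial>lborel)"
    by (rule nn_integral_polar[OF d]) simp
  also have "\<dots> = (\<integral>\<^sup>+x. ennreal (1 / m) * (indicator annulus x * ennreal (axial x * (x \<bullet> b / norm (perp a b x)) ^ m)) \<partial>lborel)"
  proof (rule nn_integral_cong)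
    fix x
    show "indicator annulus x * (\<integral>\<^sup>+s. ennreal (s ^ (DIM('a) - 3)) * indicator {0<..} s * h (stretch a b s x) \<partial>lborel)
      = ennreal (1 / m) * (indicator annulus x * ennreal (axial x * (x \<bullet> b / norm (perp a b x)) ^ m))"
    proof (cases "x \<in> annulus")
      case True
      define T where "T = x \<bullet> b / norm (perp a b x)"
      have pos: "x \<bullet> b > 0" "norm (perp a b x) > 0"
        using True by (auto simp: annulus_def)
      then have T: "T > 0"
        by (simp add: T_def)
      have "AE s in lborel. s \<noteq> (0::real)"
        by (rule AE_lborel_singleton)
      then have "(\<integral>\<^sup>+s. ennreal (s ^ (DIM('a) - 3)) * indicator {0<..} s * h (stretch a b s x) \<partial>lborel)
          = (\<integral>\<^sup>+s. ennreal (axial x) * (ennreal (s ^ (DIM('a) - 3)) * indicator {0..T} s) \<partial>lborel)"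
      proof (intro nn_integral_cong_AE, eventually_elim)
        case (elim s)
        have "s * norm (perp a b x) \<le> x \<bullet> b \<longleftrightarrow> s \<le> T"
          using pos by (simp add: T_def pos_le_divide_eq)
        then show ?case
          using elim pos by (auto simp: h_def indicator_def axial_stretch stretch_inner perp_stretch mult_ac)
      qed
      also have "\<dots> = ennreal (axial x) * (\<integral>\<^sup>+s. ennreal (s ^ (DIM('a) - 3)) * indicator {0..T} s \<partial>lborel)"
        by (rule nn_integral_cmult) measurable
      also have "(\<integral>\<^sup>+s. ennreal (s ^ (DIM('a) - 3)) * indicator {0..T} s \<partial>lborel) = ennreal (T ^ m / m - 0 ^ m / m)"
      proof (rule nn_integral_FTC_Icc)
        fix s assume "s \<in> {0..T}"
        then show "0 \<le> s ^ (DIM('a) - 3)"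
          by simp
        have "((\<lambda>s. s ^ m / m) has_real_derivative real m * s ^ (m - Suc 0) / m) (at s)"
          by (intro DERIV_cdivide DERIV_pow)
        then show "((\<lambda>s. s ^ m / m) has_real_derivative s ^ (DIM('a) - 3)) (at s)"
          using m(2) by (simp add: m(1) del: of_nat_Suc)
      qed (use T in auto)
      finally show ?thesis
        using True m T axial_pos[of x] by (simp add: T_def[symmetric] ennreal_mult[symmetric] mult_ac)
    qed simp
  qed
  also have "\<dots> = ennreal (1 / m) * (\<integral>\<^sup>+x. indicator annulus x * ennreal (axial x * (x \<bullet> b / norm (perp a b x)) ^ m) \<partial>lborel)"
    by (rule nn_integral_cmult) measurable
  finally have "ennreal (cone_mass DIM('a)) = ennreal (1 / m)
      * (\<integral>\<^sup>+x. indicator annulus x * ennreal (axial x * (x \<bullet> b / norm (perp a b x)) ^ m) \<partial>lborel)" .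
  then have "ennreal m * ennreal (cone_mass DIM('a)) = (ennreal m * ennreal (1 / m))
      * (\<integral>\<^sup>+x. indicator annulus x * ennreal (axial x * (x \<bullet> b / norm (perp a b x)) ^ m) \<partial>lborel)"
    by (simp only: mult.assoc)
  also have "ennreal m * ennreal (1 / m) = 1"
    using m by (subst ennreal_mult[symmetric]) auto
  finally show ?thesis
    using cone_mass_pos[OF d] by (simp add: m_def ennreal_mult[symmetric])
qed

end

section \<open>Densities in radial coordinates\<close>

text \<open>Here \<open>x\<close> labels a ray, \<open>s\<close> is the position on it,
  \<open>\<phi>\<close> the observed value, \<open>g\<close> the weight, and \<open>m\<close> the
  power of \<open>s\<close> from polar coordinates. Writing the derivative as
  \<open>- (s * \<psi> x s)\<close> with \<open>\<psi>\<close> between positive constants near 0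
  encodes a nondegenerate quadratic maximum, uniformly over the rays. The bounds on
  \<open>\<psi>\<close> and \<open>g\<close> provide the dominating function.\<close>

locale radial_profile = sigma_finite_measure N for N :: "'b measure" +
  fixes \<phi> \<psi> g :: "'b \<Rightarrow> real \<Rightarrow> real" and g0 :: "'b \<Rightarrow> real" and J s0 c1 c2 :: real and m :: nat
  assumes s0: "s0 > 0" and c1: "0 < c1" and c12: "c1 \<le> c2"
    and at_0: "\<And>x. x \<in> space N \<Longrightarrow> \<phi> x 0 = J"
    and deriv: "\<And>x s. x \<in> space N \<Longrightarrow> (\<phi> x has_real_derivative - (s * \<psi> x s)) (at s)"
    and cont_\<psi>: "\<And>x s. x \<in> space N \<Longrightarrow> isCont (\<psi> x) s"
    and bounds: "\<And>x s. x \<in> space N \<Longrightarrow> 0 \<le> s \<Longrightarrow> s \<le> s0 \<Longrightarrow> c1 \<le> \<psi> x s \<and> \<psi> x s \<le> c2"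
    and cont_g: "\<And>x s. x \<in> space N \<Longrightarrow> isCont (g x) s"
    and g_nonneg: "\<And>x s. x \<in> space N \<Longrightarrow> 0 \<le> g x s"
    and g_le: "\<And>x s. x \<in> space N \<Longrightarrow> g x s \<le> g0 x"
    and g0: "integrable N g0"
    and meas_pair: "(\<lambda>(x, s). \<phi> x s) \<in> borel_measurable (N \<Otimes>\<^sub>M borel)"
      "(\<lambda>(x, s). \<psi> x s) \<in> borel_measurable (N \<Otimes>\<^sub>M borel)"
      "(\<lambda>(x, s). g x s) \<in> borel_measurable (N \<Otimes>\<^sub>M borel)"
begin

lemma meas [measurable]:
  assumes [measurable]: "f \<in> measurable M N" "u \<in> borel_measurable M"
  shows "(\<lambda>w. \<phi> (f w) (u w)) \<in> borel_measurable M" "(\<lambda>w. \<psi> (f w) (u w)) \<in> borel_measurable M"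
    "(\<lambda>w. g (f w) (u w)) \<in> borel_measurable M"
  using meas_pair[THEN measurable_compose[rotated], of "\<lambda>w. (f w, u w)" M] by simp_all

text \<open>Adding c1 s^2 / 2 to \<open>\<phi> x\<close> leaves it nonincreasing on [0, s0], and
  adding c2 s^2 / 2 makes it nondecreasing, by the bounds on \<open>\<psi>\<close>.\<close>

lemma quadratic_bounds:
  assumes x: "x \<in> space N" and s: "0 \<le> s" "s \<le> s'" "s' \<le> s0"
  shows "c1 / 2 * (s'\<^sup>2 - s\<^sup>2) \<le> \<phi> x s - \<phi> x s'" "\<phi> x s - \<phi> x s' \<le> c2 / 2 * (s'\<^sup>2 - s\<^sup>2)"
proof -
  have "\<phi> x s' + c1 / 2 * s'\<^sup>2 \<le> \<phi> x s + c1 / 2 * s\<^sup>2"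
  proof (rule DERIV_nonpos_imp_nonincreasing[OF s(2), of "\<lambda>u. \<phi> x u + c1 / 2 * u\<^sup>2"])
    fix u assume u: "s \<le> u" "u \<le> s'"
    have "((\<lambda>u. \<phi> x u + c1 / 2 * u\<^sup>2) has_real_derivative u * (c1 - \<psi> x u)) (at u)"
      by (auto intro!: derivative_eq_intros deriv[OF x] simp: algebra_simps)
    moreover have "u * (c1 - \<psi> x u) \<le> 0"
      using bounds[OF x, of u] u s by (intro mult_nonneg_nonpos) auto
    ultimately show "\<exists>y. ((\<lambda>u. \<phi> x u + c1 / 2 * u\<^sup>2) has_real_derivative y) (at u) \<and> y \<le> 0"
      by blast
  qed
  then show "c1 / 2 * (s'\<^sup>2 - s\<^sup>2) \<le> \<phi> x s - \<phi> x s'"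
    by (simp add: algebra_simps)
  have "\<phi> x s + c2 / 2 * s\<^sup>2 \<le> \<phi> x s' + c2 / 2 * s'\<^sup>2"
  proof (rule DERIV_nonneg_imp_nondecreasing[OF s(2), of "\<lambda>u. \<phi> x u + c2 / 2 * u\<^sup>2"])
    fix u assume u: "s \<le> u" "u \<le> s'"
    have "((\<lambda>u. \<phi> x u + c2 / 2 * u\<^sup>2) has_real_derivative u * (c2 - \<psi> x u)) (at u)"
      by (auto intro!: derivative_eq_intros deriv[OF x] simp: algebra_simps)
    moreover have "u * (c2 - \<psi> x u) \<ge> 0"
      using bounds[OF x, of u] u s by (intro mult_nonneg_nonneg) auto
    ultimately show "\<exists>y. ((\<lambda>u. \<phi> x u + c2 / 2 * u\<^sup>2) has_real_derivative y) (at u) \<and> 0 \<le> y"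
      by blast
  qed
  then show "\<phi> x s - \<phi> x s' \<le> c2 / 2 * (s'\<^sup>2 - s\<^sup>2)"
    by (simp add: algebra_simps)
qed

lemma strict_decreasing:
  assumes x: "x \<in> space N" and s: "0 \<le> s" "s < s'" "s' \<le> s0"
  shows "\<phi> x s' < \<phi> x s"
proof -
  have "s\<^sup>2 < s'\<^sup>2"
    using s by (intro power_strict_mono) auto
  then have "0 < c1 / 2 * (s'\<^sup>2 - s\<^sup>2)"
    using c1 by simp
  then show ?thesis
    using quadratic_bounds(1)[OF x, of s s'] s by simp
qed

text \<open>By the lower quadratic bound every ray has dropped by at least this amount at
  \<open>s0\<close>, so each level between \<open>J - \<eta>\<close> and \<open>J\<close> is crossed
  where the bounds on \<open>\<psi>\<close> hold.\<close>

definition \<eta> :: real where "\<eta> = c1 * s0\<^sup>2 / 2"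

lemma eta_pos: "\<eta> > 0"
  using s0 c1 by (simp add: \<eta>_def)

text \<open>Defining the radius at level \<open>t\<close> as an integral makes its joint measurability automatic.\<close>

definition radius :: "'b \<Rightarrow> real \<Rightarrow> real" where
  "radius x t = enn2real (\<integral>\<^sup>+s. indicator {0<..<s0} s * indicator {t<..} (\<phi> x s) \<partial>lborel)"

lemma radius_measurable [measurable]:
  assumes [measurable]: "f \<in> measurable M N" "u \<in> borel_measurable M"
  shows "(\<lambda>w. radius (f w) (u w)) \<in> borel_measurable M"
  unfolding radius_def greaterThan_def by measurable

lemma radius_eq:
  assumes x: "x \<in> space N" and s: "0 \<le> s" "s \<le> s0" and t: "\<phi> x s = t"
  shows "radius x t = s"
proof -
  \<comment> \<open>By strict monotonicity the superlevel set inside (0, s0) is the interval (0, s),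
    whose length is the radius.\<close>
  have "indicator {0<..<s0} u * indicator {t<..} (\<phi> x u) = (indicator {0<..<s} u :: ennreal)" for u
    using strict_decreasing[OF x, of u s] strict_decreasing[OF x, of s u] s t
    by (cases u s rule: linorder_cases) (auto simp: indicator_def)
  then show ?thesis
    using s by (simp add: radius_def)
qed

lemma radius:
  assumes x: "x \<in> space N" and t: "J - \<eta> < t" "t < J"
  shows "0 < radius x t" "radius x t < s0" "\<phi> x (radius x t) = t"
    and "2 * (J - t) / c2 \<le> (radius x t)\<^sup>2" "(radius x t)\<^sup>2 \<le> 2 * (J - t) / c1"
proof -
  have "\<phi> x s0 \<le> J - \<eta>"
    using quadratic_bounds(1)[OF x, of 0 s0] s0 by (simp add: at_0[OF x] \<eta>_def)
  moreover have "isCont (\<phi> x) s" for s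
    using deriv[OF x] by (rule DERIV_isCont)
  ultimately obtain s where s: "0 \<le> s" "s \<le> s0" "\<phi> x s = t"
    using IVT2[of "\<phi> x" s0 t 0] s0 t by (auto simp: at_0[OF x])
  have eq: "radius x t = s"
    using radius_eq[OF x s] .
  show "\<phi> x (radius x t) = t"
    using s eq by simp
  have "s \<noteq> 0" "s \<noteq> s0"
    using s t \<open>\<phi> x s0 \<le> J - \<eta>\<close> by (auto simp: at_0[OF x])
  then show "0 < radius x t" "radius x t < s0"
    using s eq by auto
  show "2 * (J - t) / c2 \<le> (radius x t)\<^sup>2" "(radius x t)\<^sup>2 \<le> 2 * (J - t) / c1"
    using quadratic_bounds[OF x, of 0 s] s c1 c12 by (simp_all add: at_0[OF x] eq field_simps)
qed

text \<open>The lower quadratic bound between two radii shows that the square of the radius is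
  Lipschitz in the level, with constant 2 / c1; a square root gives continuity.\<close>

lemma radius_continuous:
  assumes x: "x \<in> space N" and t: "J - \<eta> < t" "t < J"
  shows "isCont (radius x) t"
proof -
  have lip: "\<bar>(radius x u)\<^sup>2 - (radius x t)\<^sup>2\<bar> \<le> 2 / c1 * \<bar>u - t\<bar>" if u: "J - \<eta> < u" "u < J" for u
  proof -
    note r = radius[OF x u] radius[OF x t]
    show ?thesis
    proof (cases "radius x u \<le> radius x t")
      case True
      then have "c1 / 2 * ((radius x t)\<^sup>2 - (radius x u)\<^sup>2) \<le> u - t"
        using quadratic_bounds(1)[OF x, of "radius x u" "radius x t"] r by simp
      moreover have "(radius x u)\<^sup>2 \<le> (radius x t)\<^sup>2"
        using True r by (intro power_mono) auto
      ultimately show ?thesis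
        using c1 by (simp add: field_simps abs_if)
    next
      case False
      then have "c1 / 2 * ((radius x u)\<^sup>2 - (radius x t)\<^sup>2) \<le> t - u"
        using quadratic_bounds(1)[OF x, of "radius x t" "radius x u"] r by simp
      moreover have "(radius x t)\<^sup>2 \<le> (radius x u)\<^sup>2"
        using False r by (intro power_mono) auto
      ultimately show ?thesis
        using c1 by (simp add: field_simps abs_if)
    qed
  qed
  have ev: "eventually (\<lambda>u. u \<in> {J - \<eta><..<J}) (at t)"
    using t by (intro eventually_at_in_open') auto
  have "((\<lambda>u. (radius x u)\<^sup>2 - (radius x t)\<^sup>2) \<longlongrightarrow> 0) (at t)"
  proof (rule Lim_null_comparison)
    show "eventually (\<lambda>u. norm ((radius x u)\<^sup>2 - (radius x t)\<^sup>2) \<le> 2 / c1 * \<bar>u - t\<bar>) (at t)"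
      using ev by (rule eventually_mono) (use lip in auto)
    have "((\<lambda>u. 2 / c1 * \<bar>u - t\<bar>) \<longlongrightarrow> 2 / c1 * \<bar>t - t\<bar>) (at t)"
      by (intro tendsto_intros)
    then show "((\<lambda>u. 2 / c1 * \<bar>u - t\<bar>) \<longlongrightarrow> 0) (at t)"
      by simp
  qed
  then have "((\<lambda>u. sqrt ((radius x u)\<^sup>2)) \<longlongrightarrow> sqrt ((radius x t)\<^sup>2)) (at t)"
    by (intro tendsto_real_sqrt) (simp add: LIM_zero_iff)
  moreover have "eventually (\<lambda>u. sqrt ((radius x u)\<^sup>2) = radius x u) (at t)"
    using ev by (rule eventually_mono) (use radius(1)[OF x] in \<open>auto simp: less_imp_le\<close>)
  ultimately have "(radius x \<longlongrightarrow> sqrt ((radius x t)\<^sup>2)) (at t)"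
    by (rule Lim_transform_eventually)
  then show ?thesis
    using radius(1)[OF x t] by (simp add: isCont_def)
qed

text \<open>L'Hopital's rule for (J - \<open>\<phi> x s\<close>) / s^2 at s = 0, where the quotient
  of derivatives is \<open>\<psi> x s / 2\<close>, composed with the radius, which tends to 0 from
  the right.\<close>

lemma radius_limit:
  assumes x: "x \<in> space N"
  shows "((\<lambda>t. (radius x t)\<^sup>2 / (J - t)) \<longlongrightarrow> 2 / \<psi> x 0) (at_left J)"
    and "(radius x \<longlongrightarrow> 0) (at_left J)"
proof -
  have ev: "eventually (\<lambda>t. t \<in> {J - \<eta><..<J}) (at_left J)"
    using eta_pos by (intro eventually_at_left_real) simp
  have "((\<lambda>t. sqrt ((radius x t)\<^sup>2)) \<longlongrightarrow> sqrt 0) (at_left J)"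
  proof (rule tendsto_real_sqrt, rule tendsto_sandwich)
    show "eventually (\<lambda>t. 0 \<le> (radius x t)\<^sup>2) (at_left J)"
      by simp
    show "eventually (\<lambda>t. (radius x t)\<^sup>2 \<le> 2 * (J - t) / c1) (at_left J)"
      using ev by (rule eventually_mono) (use radius(5)[OF x] in auto)
    have "((\<lambda>t. 2 * (J - t) / c1) \<longlongrightarrow> 2 * (J - J) / c1) (at_left J)"
      using c1 by (intro tendsto_intros) auto
    then show "((\<lambda>t. 2 * (J - t) / c1) \<longlongrightarrow> 0) (at_left J)"
      by simp
  qed simp
  moreover have "eventually (\<lambda>t. sqrt ((radius x t)\<^sup>2) = radius x t) (at_left J)"
    using ev by (rule eventually_mono) (use radius(1)[OF x] in \<open>auto simp: less_imp_le\<close>)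
  ultimately show r0: "(radius x \<longlongrightarrow> 0) (at_left J)"
    using Lim_transform_eventually by fastforce
  have \<psi>0: "\<psi> x 0 > 0"
    using bounds[OF x, of 0] s0 c1 by auto
  have "((\<lambda>s. (J - \<phi> x s) / s\<^sup>2) \<longlongrightarrow> \<psi> x 0 / 2) (at_right 0)"
  proof (rule lhopital_right_0)
    have "isCont (\<phi> x) 0"
      using deriv[OF x] by (rule DERIV_isCont)
    then have "((\<lambda>s. J - \<phi> x s) \<longlongrightarrow> J - \<phi> x 0) (at 0)"
      by (intro tendsto_intros) (simp add: isCont_def)
    then show "((\<lambda>s. J - \<phi> x s) \<longlongrightarrow> 0) (at_right 0)"
      by (simp add: at_0[OF x] filterlim_at_split)
    have "((\<lambda>s. s\<^sup>2) \<longlongrightarrow> 0\<^sup>2) (at_right (0::real))"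
      by (intro tendsto_intros)
    then show "((\<lambda>s. s\<^sup>2) \<longlongrightarrow> 0) (at_right (0::real))"
      by simp
    show "eventually (\<lambda>s::real. s\<^sup>2 \<noteq> 0) (at_right 0)" "eventually (\<lambda>s::real. 2 * s \<noteq> 0) (at_right 0)"
      by (auto intro: eventually_mono[OF eventually_at_right_less[of "0::real"]])
    show "eventually (\<lambda>s. ((\<lambda>s. J - \<phi> x s) has_real_derivative s * \<psi> x s) (at s)) (at_right 0)"
      by (intro always_eventually allI) (auto intro!: derivative_eq_intros deriv[OF x])
    show "eventually (\<lambda>s. ((\<lambda>s. s\<^sup>2) has_real_derivative 2 * s) (at s)) (at_right (0::real))"
      by (intro always_eventually allI) (auto intro!: derivative_eq_intros)
    have "((\<lambda>s. \<psi> x s / 2) \<longlongrightarrow> \<psi> x 0 / 2) (at_right 0)"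
      using cont_\<psi>[OF x, of 0] by (intro tendsto_intros) (auto simp: isCont_def filterlim_at_split)
    moreover have "eventually (\<lambda>s. \<psi> x s / 2 = s * \<psi> x s / (2 * s)) (at_right 0)"
      by (rule eventually_mono[OF eventually_at_right_less[of "0::real"]]) simp
    ultimately show "((\<lambda>s. s * \<psi> x s / (2 * s)) \<longlongrightarrow> \<psi> x 0 / 2) (at_right 0)"
      by (rule Lim_transform_eventually)
  qed
  moreover have "filterlim (radius x) (at_right 0) (at_left J)"
    unfolding filterlim_at
    using r0 ev radius(1)[OF x] by (auto elim!: eventually_mono simp: less_imp_neq[symmetric])
  ultimately have "((\<lambda>t. (J - \<phi> x (radius x t)) / (radius x t)\<^sup>2) \<longlongrightarrow> \<psi> x 0 / 2) (at_left J)"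
    by (rule filterlim_compose)
  then have "((\<lambda>t. inverse ((J - \<phi> x (radius x t)) / (radius x t)\<^sup>2)) \<longlongrightarrow> inverse (\<psi> x 0 / 2)) (at_left J)"
    using \<psi>0 by (intro tendsto_inverse) auto
  moreover have "eventually (\<lambda>t. inverse ((J - \<phi> x (radius x t)) / (radius x t)\<^sup>2) = (radius x t)\<^sup>2 / (J - t)) (at_left J)"
    using ev by (rule eventually_mono) (use radius(3)[OF x] in auto)
  ultimately have "((\<lambda>t. (radius x t)\<^sup>2 / (J - t)) \<longlongrightarrow> inverse (\<psi> x 0 / 2)) (at_left J)"
    by (rule Lim_transform_eventually)
  then show "((\<lambda>t. (radius x t)\<^sup>2 / (J - t)) \<longlongrightarrow> 2 / \<psi> x 0) (at_left J)"
    by simp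
qed

text \<open>Passing from s to the level t replaces ds by dt / (s \<open>\<psi>\<close>), so s^m
  becomes s^(m - 1), the power \<open>ex\<close> of s^2. The factor (J - t)^\<open>ex\<close> is
  split off; \<open>h\<close> keeps the ratio s^2 / (J - t), which stays between positive
  constants.\<close>

definition ex :: real where "ex = (real m - 1) / 2"

definition h :: "'b \<Rightarrow> real \<Rightarrow> real" where
  "h x t = ((radius x t)\<^sup>2 / (J - t)) powr ex * g x (radius x t) / \<psi> x (radius x t)"

lemma h_measurable [measurable]:
  assumes [measurable]: "f \<in> measurable M N" "u \<in> borel_measurable M"
  shows "(\<lambda>w. h (f w) (u w)) \<in> borel_measurable M"
  unfolding h_def by measurable

definition F :: "real \<Rightarrow> real" where "F t = (\<integral>x. h x t \<partial>N)"

definition bound :: "'b \<Rightarrow> real" where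
  "bound x = ((2 / c2) powr ex + (2 / c1) powr ex) / c1 * g0 x"

lemma bound_integrable: "integrable N bound"
  unfolding bound_def using g0 by (rule integrable_mult_right)

lemma h_bounds:
  assumes x: "x \<in> space N" and t: "J - \<eta> < t" "t < J"
  shows "0 \<le> h x t" "h x t \<le> bound x"
proof -
  define \<rho> where "\<rho> = (radius x t)\<^sup>2 / (J - t)"
  note r = radius[OF x t]
  have \<psi>: "c1 \<le> \<psi> x (radius x t)"
    using bounds[OF x, of "radius x t"] r by simp
  show "0 \<le> h x t"
    using \<psi> c1 g_nonneg[OF x] unfolding h_def by (intro divide_nonneg_nonneg mult_nonneg_nonneg) auto
  have \<rho>: "2 / c2 \<le> \<rho>" "\<rho> \<le> 2 / c1"
    using r t c1 c12 by (simp_all add: \<rho>_def field_simps)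
  have c2: "2 / c2 > 0"
    using c1 c12 by simp
  then have "\<rho> > 0"
    using \<rho>(1) by (rule less_le_trans)
  \<comment> \<open>The sum of the powers at both ends of the range of \<open>\<rho>\<close> covers
    either sign of \<open>ex\<close>, which is negative for m = 0, the case n = 3.\<close>
  have "\<rho> powr ex \<le> (2 / c2) powr ex + (2 / c1) powr ex"
  proof (cases "ex \<ge> 0")
    case True
    then have "\<rho> powr ex \<le> (2 / c1) powr ex"
      using \<rho> \<open>\<rho> > 0\<close> by (intro powr_mono2) auto
    then show ?thesis
      by (simp add: add_increasing)
  next
    case False
    then have "\<rho> powr ex \<le> (2 / c2) powr ex"
      using \<rho> c2 by (intro powr_mono2') auto
    then show ?thesis
      by (simp add: add_increasing2)
  qed
  then have "\<rho> powr ex * g x (radius x t) / \<psi> x (radius x t)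
      \<le> ((2 / c2) powr ex + (2 / c1) powr ex) * g0 x / c1"
    using g_nonneg[OF x] g_le[OF x] \<psi> c1
    by (intro frac_le mult_mono mult_nonneg_nonneg) (auto intro: order_trans)
  then show "h x t \<le> bound x"
    by (simp add: h_def bound_def \<rho>_def)
qed

lemma F_nonneg: "J - \<eta> < t \<Longrightarrow> t < J \<Longrightarrow> 0 \<le> F t"
  unfolding F_def using h_bounds by (intro integral_nonneg_AE) (auto intro!: AE_I2)

lemma h_integrable: "J - \<eta> < t \<Longrightarrow> t < J \<Longrightarrow> integrable N (\<lambda>x. h x t)"
  using h_bounds by (intro Bochner_Integration.integrable_bound[OF bound_integrable])
    (auto intro!: AE_I2 intro: order_trans[OF _ abs_ge_self])

lemma F_sequence:
  assumes t: "\<And>k. J - \<eta> < t k \<and> t k < J"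
    and lim: "\<And>x. x \<in> space N \<Longrightarrow> (\<lambda>k. h x (t k)) \<longlonglongrightarrow> l x"
    and [measurable]: "l \<in> borel_measurable N"
  shows "(\<lambda>k::nat. F (t k)) \<longlonglongrightarrow> (\<integral>x. l x \<partial>N)"
  unfolding F_def
proof (rule integral_dominated_convergence[where w = bound])
  show "AE x in N. norm (h x (t k)) \<le> bound x" for k
    using h_bounds t by (auto intro!: AE_I2)
qed (use lim bound_integrable in \<open>auto intro!: AE_I2\<close>)

lemma F_continuous: "continuous_on {J - \<eta><..<J} F"
  unfolding continuous_on_sequentially
proof (intro allI ballI impI, elim conjE)
  fix t u assume u: "u \<in> {J - \<eta><..<J}" and t: "\<forall>k. t k \<in> {J - \<eta><..<J}" "t \<longlonglongrightarrow> u"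
  have "(\<lambda>k. h x (t k)) \<longlonglongrightarrow> h x u" if x: "x \<in> space N" for x
  proof -
    have "isCont (radius x) u"
      using u by (intro radius_continuous[OF x]) auto
    then have r: "(\<lambda>k. radius x (t k)) \<longlonglongrightarrow> radius x u"
      using t(2) by (rule isCont_tendsto_compose)
    have "0 < radius x u" "radius x u < s0"
      using radius[OF x, of u] u by auto
    then have "\<psi> x (radius x u) \<noteq> 0" "(radius x u)\<^sup>2 / (J - u) \<noteq> 0"
      using bounds[OF x, of "radius x u"] c1 u by auto
    then show ?thesis
      unfolding h_def using u
      by (intro tendsto_intros r t(2) isCont_tendsto_compose[OF cont_\<psi>[OF x]] isCont_tendsto_compose[OF cont_g[OF x]]) auto
  qed
  then have "(\<lambda>k. F (t k)) \<longlonglongrightarrow> (\<integral>x. h x u \<partial>N)"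
    using t by (intro F_sequence) auto
  then show "(F \<circ> t) \<longlonglongrightarrow> F u"
    by (simp add: F_def comp_def)
qed

lemma F_limit: "(F \<longlongrightarrow> (\<integral>x. (2 / \<psi> x 0) powr ex * g x 0 / \<psi> x 0 \<partial>N)) (at_left J)"
proof (rule tendsto_at_left_sequentially[of "J - \<eta>"])
  show "J - \<eta> < J"
    using eta_pos by simp
  fix t :: "nat \<Rightarrow> real" assume t: "\<And>k. t k < J" "\<And>k. J - \<eta> < t k" "incseq t" "t \<longlonglongrightarrow> J"
  have tl: "filterlim t (at_left J) sequentially"
    unfolding filterlim_at using t by (auto simp: less_imp_neq)
  show "(\<lambda>k. F (t k)) \<longlonglongrightarrow> (\<integral>x. (2 / \<psi> x 0) powr ex * g x 0 / \<psi> x 0 \<partial>N)"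
  proof (rule F_sequence)
    fix x assume x: "x \<in> space N"
    have r: "(\<lambda>k. (radius x (t k))\<^sup>2 / (J - t k)) \<longlonglongrightarrow> 2 / \<psi> x 0" "(\<lambda>k. radius x (t k)) \<longlonglongrightarrow> 0"
      using filterlim_compose[OF radius_limit(1)[OF x] tl] filterlim_compose[OF radius_limit(2)[OF x] tl]
      by simp_all
    have "\<psi> x 0 > 0"
      using bounds[OF x, of 0] s0 c1 by auto
    then show "(\<lambda>k. h x (t k)) \<longlonglongrightarrow> (2 / \<psi> x 0) powr ex * g x 0 / \<psi> x 0"
      unfolding h_def
      by (intro tendsto_intros r isCont_tendsto_compose[OF cont_\<psi>[OF x]] isCont_tendsto_compose[OF cont_g[OF x]]) auto
  qed (use t in auto)
qed

text \<open>Change of variables from position to level on each ray, then Fubini over the rays: the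
  weighted measure is pushed forward to one with density
  \<open>(J - t) powr ex * F t\<close>.\<close>

lemma level_integral:
  assumes [measurable]: "B \<in> sets borel" and B: "B \<subseteq> {J - \<eta><..<J}"
  shows "(\<integral>\<^sup>+x. (\<integral>\<^sup>+s. indicator {0<..<s0} s * ennreal (s ^ m * g x s) * indicator B (\<phi> x s) \<partial>lborel) \<partial>N)
    = (\<integral>\<^sup>+t. indicator B t * ennreal ((J - t) powr ex * F t) \<partial>lborel)"
proof -
  interpret pair_sigma_finite N "lborel :: real measure" ..
  have inner: "(\<integral>\<^sup>+s. indicator {0<..<s0} s * ennreal (s ^ m * g x s) * indicator B (\<phi> x s) \<partial>lborel)
      = (\<integral>\<^sup>+t. indicator B t * ennreal ((J - t) powr ex * h x t) \<partial>lborel)" if x: "x \<in> space N" for x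
  proof -
    have [measurable]: "(\<lambda>t. h x t) \<in> borel_measurable borel"
      using x by measurable
    define f where "f t = indicator B t * ennreal ((J - t) powr ex * h x t)" for t
    have [measurable]: "f \<in> borel_measurable borel"
      unfolding f_def[abs_def] by measurable
    have "(\<integral>\<^sup>+t. f t \<partial>lborel) = (\<integral>\<^sup>+t. f (- t) \<partial>lborel)"
      by (subst lborel_distr_uminus[symmetric], subst nn_integral_distr) auto
    also have "\<dots> = (\<integral>\<^sup>+t. f (- t) * indicator {- \<phi> x 0..- \<phi> x s0} t \<partial>lborel)"
    proof (intro nn_integral_cong)
      fix t
      have "\<phi> x s0 \<le> J - \<eta>"
        using quadratic_bounds(1)[OF x, of 0 s0] s0 by (simp add: at_0[OF x] \<eta>_def)
      then show "f (- t) = f (- t) * indicator {- \<phi> x 0..- \<phi> x s0} t"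
        using B by (auto simp: f_def indicator_def at_0[OF x])
    qed
    also have "\<dots> = (\<integral>\<^sup>+s. f (- (- \<phi> x s)) * ennreal (s * \<psi> x s) * indicator {0..s0} s \<partial>lborel)"
    \<comment> \<open>The substitution rule is for nondecreasing maps. It is applied to
      \<open>- \<phi> x\<close>, which is why \<open>f\<close> has been reflected.\<close>
    proof (rule nn_integral_substitution_aux)
      show "((\<lambda>s. - \<phi> x s) has_real_derivative s * \<psi> x s) (at s)" for s
        by (auto intro!: derivative_eq_intros deriv[OF x])
      show "continuous_on {0..s0} (\<lambda>s. s * \<psi> x s)"
        using cont_\<psi>[OF x] by (intro continuous_intros) (simp add: continuous_at_imp_continuous_on)
      show "0 \<le> s * \<psi> x s" if "s \<in> {0..s0}" for s
        using bounds[OF x, of s] that c1 by auto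
    qed (use s0 in auto)
    also have "\<dots> = (\<integral>\<^sup>+s. indicator {0<..<s0} s * ennreal (s ^ m * g x s) * indicator B (\<phi> x s) \<partial>lborel)"
    proof (intro nn_integral_cong)
      fix s
      show "f (- (- \<phi> x s)) * ennreal (s * \<psi> x s) * indicator {0..s0} s
          = indicator {0<..<s0} s * ennreal (s ^ m * g x s) * indicator B (\<phi> x s)"
      proof (cases "s \<in> {0..s0} \<and> \<phi> x s \<in> B")
        case True
        define t where "t = \<phi> x s"
        have t: "J - \<eta> < t" "t < J"
          using True B by (auto simp: t_def)
        have r: "radius x t = s"
          using radius_eq[OF x, of s t] True by (simp add: t_def)
        have s: "0 < s" "s < s0"
          using radius[OF x t] r by auto
        have \<psi>: "\<psi> x s > 0"
          using bounds[OF x, of s] s c1 by auto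
        have "(J - t) powr ex * (s\<^sup>2 / (J - t)) powr ex = (s\<^sup>2) powr ex"
          using t s by (simp add: powr_divide)
        also have "\<dots> = s powr (2 * ex)"
          using s by (simp add: powr_powr flip: powr_numeral)
        also have "2 * ex = real m - 1"
          by (simp add: ex_def)
        finally have pw: "(J - t) powr ex * (s\<^sup>2 / (J - t)) powr ex = s powr (real m - 1)" .
        have "(J - t) powr ex * h x t * (s * \<psi> x s)
            = ((J - t) powr ex * (s\<^sup>2 / (J - t)) powr ex) * s * g x s"
          using \<psi> by (simp add: h_def r)
        also have "\<dots> = s ^ m * g x s"
          unfolding pw using s by (simp add: powr_diff powr_realpow)
        finally have "(J - t) powr ex * h x t * (s * \<psi> x s) = s ^ m * g x s" .
        moreover have "0 \<le> h x t" "0 \<le> s * \<psi> x s"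
          using h_bounds[OF x t] s \<psi> by auto
        ultimately show ?thesis
          using True s by (simp add: f_def t_def[symmetric] ennreal_mult[symmetric])
      next
        case False
        then show ?thesis
          by (auto simp: f_def indicator_def)
      qed
    qed
    finally show ?thesis
      by (simp add: f_def)
  qed
  have "(\<integral>\<^sup>+x. (\<integral>\<^sup>+s. indicator {0<..<s0} s * ennreal (s ^ m * g x s) * indicator B (\<phi> x s) \<partial>lborel) \<partial>N)
      = (\<integral>\<^sup>+x. (\<integral>\<^sup>+t. indicator B t * ennreal ((J - t) powr ex * h x t) \<partial>lborel) \<partial>N)"
    by (intro nn_integral_cong inner)
  also have "\<dots> = (\<integral>\<^sup>+t. (\<integral>\<^sup>+x. indicator B t * ennreal ((J - t) powr ex * h x t) \<partial>N) \<partial>lborel)"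
    by (rule Fubini'[symmetric]) measurable
  also have "\<dots> = (\<integral>\<^sup>+t. indicator B t * ennreal ((J - t) powr ex * F t) \<partial>lborel)"
  proof (intro nn_integral_cong)
    fix t :: real
    show "(\<integral>\<^sup>+x. indicator B t * ennreal ((J - t) powr ex * h x t) \<partial>N) = indicator B t * ennreal ((J - t) powr ex * F t)"
    proof (cases "t \<in> B")
      case True
      then have t: "J - \<eta> < t" "t < J"
        using B by auto
      have "(\<integral>\<^sup>+x. ennreal ((J - t) powr ex * h x t) \<partial>N) = ennreal (\<integral>x. (J - t) powr ex * h x t \<partial>N)"
        using h_bounds[OF _ t] by (intro nn_integral_eq_integral integrable_mult_right h_integrable t) (auto intro!: AE_I2)
      with True show ?thesis
        by (simp add: F_def)
    qed simp
  qed
  finally show ?thesis .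
qed

end

section \<open>The profile of \<open>JB\<close> around an outlier direction\<close>

text \<open>The moment identities are carried as assumptions, so neither the sign of
  \<open>e\<close> nor its exact entries have to be inspected again. The vector \<open>a\<close>
  below, the normalised \<open>1\<close>, spans the direction removed by \<open>center\<close>;
  together with \<open>e\<close> it forms the pair for polar coordinates.\<close>

locale outlier_chart =
  fixes e :: "real ^ 'n" and i :: 'n and \<kappa> N :: real
  assumes n3: "CARD('n) \<ge> 3" and e_outlier: "e \<in> outliers" and N_def: "N = real CARD('n)"
    and e_nth: "\<And>j. j \<noteq> i \<Longrightarrow> e $ j = \<kappa>" "e $ i \<noteq> \<kappa>"
    and \<kappa>2: "\<kappa>\<^sup>2 = 1 / (N * (N - 1))"
    and p3\<kappa>: "power_sum 3 e * \<kappa> = - (N - 2) / (N * (N - 1))"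
    and p3: "(power_sum 3 e)\<^sup>2 = (N - 2)\<^sup>2 / (N * (N - 1))"
    and p4: "power_sum 4 e = (N\<^sup>2 - 3 * N + 3) / (N * (N - 1))"
begin

definition \<alpha> :: real where "\<alpha> = power_sum 3 e"
definition \<beta> :: real where "\<beta> = power_sum 4 e"
definition lam :: real where "lam = lambda_n CARD('n)"

lemma N3: "N \<ge> 3"
  using n3 by (simp add: N_def)

lemma lam_eq: "lam = - (2 * N\<^sup>2 * (\<alpha> * \<kappa>) + N\<^sup>2 * (N * \<beta> - 3) * \<kappa>\<^sup>2 - N\<^sup>2 * \<alpha>\<^sup>2 - N\<^sup>2 / 3 * (N * \<beta> - 3) * \<beta>)"
  unfolding lam_def \<alpha>_def \<beta>_def p3\<kappa> p3 p4 \<kappa>2 lambda_n_def N_def[symmetric] using N3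
  by (simp add: divide_simps) (simp add: power2_eq_square power3_eq_cube algebra_simps)

lemma lam_pos: "lam > 0"
  unfolding lam_def by (rule lambda_n_pos[OF n3])

definition a :: "real ^ 'n" where "a = (1 / sqrt N) *\<^sub>R 1"

lemma e_Omega: "norm e = 1" "e \<bullet> 1 = 0"
  using e_outlier outliers_subset_Omega[OF n3] by (auto simp: Omega_iff)

sublocale orthonormal_pair a e
proof
  show "a \<bullet> a = 1"
    using N3 by (simp add: a_def inner_one_one N_def[symmetric])
  show "e \<bullet> e = 1"
    using e_Omega by (simp add: norm_eq_1)
  show "a \<bullet> e = 0"
    using e_Omega by (simp add: a_def inner_commute)
qed

abbreviation pe :: "real ^ 'n \<Rightarrow> real ^ 'n" where "pe \<equiv> perp a e"

lemma center_eq: "center x = (x \<bullet> e) *\<^sub>R e + pe x"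
proof -
  have "(x \<bullet> a) *\<^sub>R a = (x \<bullet> 1 / N) *\<^sub>R 1"
    using N3 by (simp add: a_def)
  then show ?thesis
    by (simp add: perp_def center_def N_def)
qed

lemma perp_tangent: "pe x \<in> tangent e"
proof -
  have "pe x \<bullet> 1 = sqrt N * (pe x \<bullet> a)"
    using N3 by (simp add: a_def)
  then show ?thesis
    using perp_inner[of x] by (simp add: tangent_iff inner_commute)
qed

text \<open>Binomial expansion. A tangent vector vanishes at the exceptional index, so each mixed
  sum is a power of \<open>\<kappa>\<close> times a power sum of \<open>v\<close>; the terms linear
  in s vanish because the entries of \<open>v\<close> sum to 0.\<close>

lemma power_sums_line:
  assumes v: "v \<in> tangent e"
  shows "power_sum 2 (e + s *\<^sub>R v) = 1 + s\<^sup>2 * power_sum 2 v"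
    and "power_sum 3 (e + s *\<^sub>R v) = \<alpha> + 3 * \<kappa> * power_sum 2 v * s\<^sup>2 + power_sum 3 v * s ^ 3"
    and "power_sum 4 (e + s *\<^sub>R v) = \<beta> + 6 * \<kappa>\<^sup>2 * power_sum 2 v * s\<^sup>2 + 4 * \<kappa> * power_sum 3 v * s ^ 3 + power_sum 4 v * s ^ 4"
proof -
  have vi: "v $ i = 0"
    using tangent_outlier[OF e_nth v] .
  have mixed: "(\<Sum>j\<in>UNIV. (e $ j) ^ r * (v $ j) ^ k) = \<kappa> ^ r * power_sum k v" if "k > 0" for r k
    unfolding power_sum_def using that vi
    by (intro outlier_weighted_sum[OF e_nth(1), where v = "\<lambda>j. (v $ j) ^ k"]) auto
  have v1: "power_sum (Suc 0) v = 0"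
    using v by (simp add: power_sum_def tangent_def)
  have e2: "power_sum 2 e = 1"
    using e_Omega by (simp add: power_sum_2)
  have "power_sum 2 (e + s *\<^sub>R v)
      = (\<Sum>j\<in>UNIV. (e $ j) ^ 2 + 2 * s * ((e $ j) ^ 1 * (v $ j) ^ 1) + s\<^sup>2 * (v $ j)\<^sup>2)"
    unfolding power_sum_def by (intro sum.cong) (simp_all add: power2_eq_square algebra_simps)
  also have "\<dots> = power_sum 2 e + 2 * s * (\<kappa> ^ 1 * power_sum 1 v) + s\<^sup>2 * power_sum 2 v"
    unfolding sum.distrib sum_distrib_left[symmetric] mixed[OF zero_less_one] by (simp add: power_sum_def)
  finally show "power_sum 2 (e + s *\<^sub>R v) = 1 + s\<^sup>2 * power_sum 2 v"
    by (simp add: e2 v1)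
  have "power_sum 3 (e + s *\<^sub>R v) = (\<Sum>j\<in>UNIV. (e $ j) ^ 3 + 3 * s * ((e $ j) ^ 2 * (v $ j) ^ 1)
      + 3 * s\<^sup>2 * ((e $ j) ^ 1 * (v $ j) ^ 2) + s ^ 3 * (v $ j) ^ 3)"
    unfolding power_sum_def
    by (intro sum.cong) (simp_all add: power2_eq_square power3_eq_cube algebra_simps)
  also have "\<dots> = power_sum 3 e + 3 * s * (\<kappa> ^ 2 * power_sum 1 v) + 3 * s\<^sup>2 * (\<kappa> ^ 1 * power_sum 2 v) + s ^ 3 * power_sum 3 v"
    unfolding sum.distrib sum_distrib_left[symmetric] mixed[OF zero_less_one] mixed[OF zero_less_numeral] by (simp add: power_sum_def)
  finally show "power_sum 3 (e + s *\<^sub>R v) = \<alpha> + 3 * \<kappa> * power_sum 2 v * s\<^sup>2 + power_sum 3 v * s ^ 3"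
    by (simp add: v1 \<alpha>_def)
  have "power_sum 4 (e + s *\<^sub>R v) = (\<Sum>j\<in>UNIV. (e $ j) ^ 4 + 4 * s * ((e $ j) ^ 3 * (v $ j) ^ 1)
      + 6 * s\<^sup>2 * ((e $ j) ^ 2 * (v $ j) ^ 2) + 4 * s ^ 3 * ((e $ j) ^ 1 * (v $ j) ^ 3) + s ^ 4 * (v $ j) ^ 4)"
    unfolding power_sum_def
    by (intro sum.cong) (simp_all add: power2_eq_square power3_eq_cube power4_eq_xxxx algebra_simps)
  also have "\<dots> = power_sum 4 e + 4 * s * (\<kappa> ^ 3 * power_sum 1 v) + 6 * s\<^sup>2 * (\<kappa> ^ 2 * power_sum 2 v)
      + 4 * s ^ 3 * (\<kappa> ^ 1 * power_sum 3 v) + s ^ 4 * power_sum 4 v"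
    unfolding sum.distrib sum_distrib_left[symmetric] mixed[OF zero_less_one] mixed[OF zero_less_numeral] by (simp add: power_sum_def)
  finally show "power_sum 4 (e + s *\<^sub>R v) = \<beta> + 6 * \<kappa>\<^sup>2 * power_sum 2 v * s\<^sup>2 + 4 * \<kappa> * power_sum 3 v * s ^ 3 + power_sum 4 v * s ^ 4"
    by (simp add: v1 \<beta>_def)
qed

text \<open>The values of \<open>JB\<close> along the ray \<open>e + s v\<close> and the radial derivative \<open>- s \<Psi>\<close>,
  in terms of the power sums \<open>q\<^sub>2, q\<^sub>3, q\<^sub>4\<close> of \<open>v\<close>.\<close>

definition T2 :: "real \<Rightarrow> real \<Rightarrow> real" where
  "T2 q2 s = 1 + s\<^sup>2 * q2"
definition T3 :: "real \<Rightarrow> real \<Rightarrow> real \<Rightarrow> real" where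
  "T3 q2 q3 s = \<alpha> + 3 * \<kappa> * q2 * s\<^sup>2 + q3 * s ^ 3"
definition T4 :: "real \<Rightarrow> real \<Rightarrow> real \<Rightarrow> real \<Rightarrow> real" where
  "T4 q2 q3 q4 s = \<beta> + 6 * \<kappa>\<^sup>2 * q2 * s\<^sup>2 + 4 * \<kappa> * q3 * s ^ 3 + q4 * s ^ 4"

definition \<Phi> :: "real \<Rightarrow> real \<Rightarrow> real \<Rightarrow> real \<Rightarrow> real" where
  "\<Phi> q2 q3 q4 s = N\<^sup>2 / 6 * (T3 q2 q3 s)\<^sup>2 / (T2 q2 s) ^ 3 + N / 24 * (N * T4 q2 q3 q4 s / (T2 q2 s)\<^sup>2 - 3)\<^sup>2"

definition \<Psi> :: "real \<Rightarrow> real \<Rightarrow> real \<Rightarrow> real \<Rightarrow> real" where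
  "\<Psi> q2 q3 q4 s = - (N\<^sup>2 / 6 * (2 * T3 q2 q3 s * (6 * \<kappa> * q2 + 3 * q3 * s) * T2 q2 s - 6 * q2 * (T3 q2 q3 s)\<^sup>2) / (T2 q2 s) ^ 4
     + N\<^sup>2 / 12 * (N * T4 q2 q3 q4 s / (T2 q2 s)\<^sup>2 - 3)
       * ((12 * \<kappa>\<^sup>2 * q2 + 12 * \<kappa> * q3 * s + 4 * q4 * s\<^sup>2) * T2 q2 s - 4 * q2 * T4 q2 q3 q4 s) / (T2 q2 s) ^ 3)"

lemma T2_pos: "q2 \<ge> 0 \<Longrightarrow> T2 q2 s > 0"
  unfolding T2_def by (intro add_pos_nonneg) auto

lemma JB_ray:
  assumes v: "v \<in> tangent e"
  shows "JB (sgn (e + s *\<^sub>R v)) = \<Phi> (power_sum 2 v) (power_sum 3 v) (power_sum 4 v) s"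
proof -
  define q2 where "q2 = power_sum 2 v"
  have "q2 \<ge> 0"
    by (simp add: q2_def power_sum_2)
  then have T: "T2 q2 s > 0"
    by (rule T2_pos)
  have ps: "power_sum 2 (e + s *\<^sub>R v) = T2 q2 s" "power_sum 3 (e + s *\<^sub>R v) = T3 q2 (power_sum 3 v) s"
    "power_sum 4 (e + s *\<^sub>R v) = T4 q2 (power_sum 3 v) (power_sum 4 v) s"
    unfolding power_sums_line[OF v] T2_def T3_def T4_def q2_def by simp_all
  have "e + s *\<^sub>R v \<noteq> 0"
    using ps(1) T by (auto simp: power_sum_2)
  then have "JB (sgn (e + s *\<^sub>R v)) = (N\<^sup>2 / 6 * (T3 q2 (power_sum 3 v) s)\<^sup>2 * T2 q2 s
      + N / 24 * (N * T4 q2 (power_sum 3 v) (power_sum 4 v) s - 3 * (T2 q2 s)\<^sup>2)\<^sup>2) / (T2 q2 s) ^ 4"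
    by (simp add: JB_sgn ps N_def[symmetric])
  also have "\<dots> = \<Phi> q2 (power_sum 3 v) (power_sum 4 v) s"
  proof -
    define t where "t = T2 q2 s"
    define t3 where "t3 = T3 q2 (power_sum 3 v) s"
    define t4 where "t4 = T4 q2 (power_sum 3 v) (power_sum 4 v) s"
    have t: "t > 0"
      using T by (simp add: t_def)
    have 1: "N\<^sup>2 / 6 * t3\<^sup>2 * t / t ^ 4 = N\<^sup>2 / 6 * t3\<^sup>2 / t ^ 3"
      using t by (simp add: power3_eq_cube power4_eq_xxxx)
    have 2: "N * t4 / t\<^sup>2 - 3 = (N * t4 - 3 * t\<^sup>2) / t\<^sup>2"
      using t by (simp add: field_simps)
    have 3: "((N * t4 - 3 * t\<^sup>2) / t\<^sup>2)\<^sup>2 = (N * t4 - 3 * t\<^sup>2)\<^sup>2 / t ^ 4"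
      by (simp add: power_divide flip: power_mult)
    show ?thesis
      unfolding \<Phi>_def t_def[symmetric] t3_def[symmetric] t4_def[symmetric] add_divide_distrib 1 2 3
      by simp
  qed
  finally show ?thesis
    by (simp add: q2_def)
qed

lemma \<Phi>_0: "\<Phi> q2 q3 q4 0 = J_plus CARD('n)"
proof -
  have "\<Phi> q2 q3 q4 0 = JB e"
    by (simp add: \<Phi>_def T2_def T3_def T4_def JB_def \<alpha>_def \<beta>_def N_def[symmetric])
  then show ?thesis
    using JB_eq_J_plus_iff[OF n3, of e] e_outlier outliers_subset_Omega[OF n3] by auto
qed

text \<open>The second derivative of \<open>JB\<close> along the ray at s = 0 is minus this value,
  so the Hessian eigenvalue reappears; \<open>lam_eq\<close> has the shape needed for the
  comparison.\<close>

lemma \<Psi>_0: "\<Psi> q2 q3 q4 0 = lam * q2"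
  unfolding lam_eq \<Psi>_def T2_def T3_def T4_def
  by (simp add: power2_eq_square field_simps)

lemma \<Phi>_deriv:
  assumes q2: "q2 \<ge> 0"
  shows "(\<Phi> q2 q3 q4 has_real_derivative - (s * \<Psi> q2 q3 q4 s)) (at s)"
proof -
  have t: "(T2 q2 has_real_derivative s * (2 * q2)) (at s)"
    unfolding T2_def[abs_def] by (auto intro!: derivative_eq_intros)
  have t3: "(T3 q2 q3 has_real_derivative s * (6 * \<kappa> * q2 + 3 * q3 * s)) (at s)"
    unfolding T3_def[abs_def] by (auto intro!: derivative_eq_intros simp: power2_eq_square algebra_simps)
  have t4: "(T4 q2 q3 q4 has_real_derivative s * (12 * \<kappa>\<^sup>2 * q2 + 12 * \<kappa> * q3 * s + 4 * q4 * s\<^sup>2)) (at s)"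
    unfolding T4_def[abs_def] by (auto intro!: derivative_eq_intros simp: power2_eq_square power3_eq_cube algebra_simps)
  have T: "T2 q2 s \<noteq> 0"
    using T2_pos[OF q2, of s] by simp
  have pow: "x ^ 5 = x * x * x * x * x" "x ^ 6 = x * x * x * x * x * x" for x :: real
    by (simp_all add: eval_nat_numeral)
  have 1: "((\<lambda>s. N\<^sup>2 / 6 * (T3 q2 q3 s)\<^sup>2 / (T2 q2 s) ^ 3) has_real_derivative
      s * (N\<^sup>2 / 6 * (2 * T3 q2 q3 s * (6 * \<kappa> * q2 + 3 * q3 * s) * T2 q2 s - 6 * q2 * (T3 q2 q3 s)\<^sup>2) / (T2 q2 s) ^ 4)) (at s)"
    using T by (auto intro!: derivative_eq_intros t t3)
      (simp add: divide_simps, simp add: power2_eq_square power3_eq_cube power4_eq_xxxx pow algebra_simps)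
  have 2: "((\<lambda>s. N * T4 q2 q3 q4 s / (T2 q2 s)\<^sup>2 - 3) has_real_derivative
      N * s * ((12 * \<kappa>\<^sup>2 * q2 + 12 * \<kappa> * q3 * s + 4 * q4 * s\<^sup>2) * T2 q2 s - 4 * q2 * T4 q2 q3 q4 s) / (T2 q2 s) ^ 3) (at s)"
    using T by (auto intro!: derivative_eq_intros t t4)
      (simp add: divide_simps, simp add: power2_eq_square power3_eq_cube power4_eq_xxxx pow algebra_simps)
  have 3: "((\<lambda>s. N / 24 * (N * T4 q2 q3 q4 s / (T2 q2 s)\<^sup>2 - 3)\<^sup>2) has_real_derivative
      s * (N\<^sup>2 / 12 * (N * T4 q2 q3 q4 s / (T2 q2 s)\<^sup>2 - 3)
       * ((12 * \<kappa>\<^sup>2 * q2 + 12 * \<kappa> * q3 * s + 4 * q4 * s\<^sup>2) * T2 q2 s - 4 * q2 * T4 q2 q3 q4 s) / (T2 q2 s) ^ 3)) (at s)"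
    by (rule DERIV_cong[OF DERIV_cmult[OF DERIV_power[OF 2]]]) (simp add: power2_eq_square)
  show ?thesis
    unfolding \<Phi>_def[abs_def] \<Psi>_def
    by (rule DERIV_cong[OF DERIV_add[OF 1 3]]) (simp add: algebra_simps)
qed

lemma \<Psi>_continuous:
  "continuous_on {p. fst p \<ge> 0} (\<lambda>p :: real \<times> real \<times> real \<times> real.
     \<Psi> (fst p) (fst (snd p)) (fst (snd (snd p))) (snd (snd (snd p))))"
proof -
  have "T2 (fst p) s \<noteq> 0" if "fst p \<ge> 0" for p :: "real \<times> real \<times> real \<times> real" and s
    using T2_pos[OF that, of s] by simp
  then show ?thesis
    unfolding \<Psi>_def T3_def T4_def by (intro continuous_intros) (auto simp: T2_def intro!: continuous_intros)
qed

text \<open>Contains the power sums of orders 2, 3, 4 of all vectors with norm between 1 and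
  \<open>exp 1\<close>, the norms of slopes over \<open>annulus\<close>.\<close>

definition q_box :: "(real \<times> real \<times> real) set" where
  "q_box = {1..(exp 1)\<^sup>2} \<times> {- (exp 1 ^ 3)..exp 1 ^ 3} \<times> {0..exp 1 ^ 4}"

text \<open>Only four real parameters enter, so compactness makes the bounds uniform over all rays.
  At s = 0 the value is \<open>lam * q2\<close>, at least \<open>lam\<close> on the box, and uniform
  continuity costs at most \<open>lam / 2\<close> for small s.\<close>

lemma \<Psi>_bounds:
  obtains s0 c2 where "s0 > 0" "lam / 2 \<le> c2"
    "\<And>q2 q3 q4 s. (q2, q3, q4) \<in> q_box \<Longrightarrow> 0 \<le> s \<Longrightarrow> s \<le> s0 \<Longrightarrow> lam / 2 \<le> \<Psi> q2 q3 q4 s \<and> \<Psi> q2 q3 q4 s \<le> c2"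
proof -
  define K where "K = {1..(exp 1)\<^sup>2 :: real} \<times> {- (exp 1 ^ 3)..exp 1 ^ 3 :: real} \<times> {0..exp 1 ^ 4 :: real} \<times> {0..1 :: real}"
  define f where "f p = \<Psi> (fst p) (fst (snd p)) (fst (snd (snd p))) (snd (snd (snd p)))" for p
  have K: "compact K"
    unfolding K_def by (intro compact_Times compact_Icc)
  have cont: "continuous_on K f"
    unfolding f_def[abs_def] by (rule continuous_on_subset[OF \<Psi>_continuous]) (auto simp: K_def)
  have "bounded (f ` K)"
    using K cont by (intro compact_imp_bounded compact_continuous_image)
  then obtain C where C: "\<And>p. p \<in> K \<Longrightarrow> norm (f p) \<le> C"
    unfolding bounded_iff by blast
  have "uniformly_continuous_on K f"
    using cont K by (rule compact_uniformly_continuous)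
  then obtain \<delta> where \<delta>: "\<delta> > 0" "\<And>p p'. p \<in> K \<Longrightarrow> p' \<in> K \<Longrightarrow> dist p' p < \<delta> \<Longrightarrow> dist (f p') (f p) < lam / 2"
    unfolding uniformly_continuous_on_def using lam_pos half_gt_zero by metis
  show ?thesis
  proof (rule that[of "min 1 (\<delta> / 2)" "max C (lam / 2)"])
    fix q2 q3 q4 s
    assume q: "(q2, q3, q4) \<in> q_box" and s: "0 \<le> s" "s \<le> min 1 (\<delta> / 2)"
    have inK: "(q2, q3, q4, s) \<in> K" "(q2, q3, q4, 0) \<in> K"
      using q s by (auto simp: K_def q_box_def)
    have "dist (q2, q3, q4, s) (q2, q3, q4, 0) < \<delta>"
      using s \<delta>(1) by (simp add: dist_Pair_Pair dist_real_def)
    then have "dist (f (q2, q3, q4, s)) (f (q2, q3, q4, 0)) < lam / 2"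
      using inK by (intro \<delta>(2))
    then have "\<bar>\<Psi> q2 q3 q4 s - lam * q2\<bar> < lam / 2"
      by (simp add: f_def \<Psi>_0 dist_real_def)
    moreover have "lam * 1 \<le> lam * q2"
      using q lam_pos by (intro mult_left_mono) (auto simp: q_box_def)
    ultimately have "lam / 2 \<le> \<Psi> q2 q3 q4 s"
      by linarith
    moreover have "\<Psi> q2 q3 q4 s \<le> C"
      using C[OF inK(1)] by (simp add: f_def)
    ultimately show "lam / 2 \<le> \<Psi> q2 q3 q4 s \<and> \<Psi> q2 q3 q4 s \<le> max C (lam / 2)"
      by auto
  qed (use \<delta> in auto)
qed

lemma power_sum_bounds:
  fixes v :: "real ^ 'n"
  assumes "1 \<le> norm v" "norm v \<le> R"
  shows "(power_sum 2 v, power_sum 3 v, power_sum 4 v) \<in> {1..R\<^sup>2} \<times> {- (R ^ 3)..R ^ 3} \<times> {0..R ^ 4}"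
proof -
  have comp: "\<bar>v $ j\<bar> \<le> norm v" for j
    by (rule component_le_norm_cart)
  have n2: "(\<Sum>j\<in>UNIV. (v $ j)\<^sup>2) = (norm v)\<^sup>2"
    using power_sum_2[of v] by (simp add: power_sum_def)
  have "\<bar>power_sum 3 v\<bar> \<le> (\<Sum>j\<in>UNIV. \<bar>(v $ j) ^ 3\<bar>)"
    unfolding power_sum_def by (rule sum_abs)
  also have "\<dots> \<le> (\<Sum>j\<in>UNIV. norm v * (v $ j)\<^sup>2)"
    using comp by (intro sum_mono) (simp add: power3_eq_cube power2_eq_square abs_mult mult.assoc mult_right_mono)
  also have "\<dots> = norm v ^ 3"
    unfolding sum_distrib_left[symmetric] n2 by (simp add: power3_eq_cube power2_eq_square)
  also have "\<dots> \<le> R ^ 3"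
    using assms by (intro power_mono) auto
  finally have 3: "\<bar>power_sum 3 v\<bar> \<le> R ^ 3" .
  have "power_sum 4 v \<le> (\<Sum>j\<in>UNIV. (norm v)\<^sup>2 * (v $ j)\<^sup>2)"
    unfolding power_sum_def
  proof (intro sum_mono)
    fix j
    have "(v $ j)\<^sup>2 \<le> (norm v)\<^sup>2"
      using comp[of j] by (metis abs_le_square_iff abs_norm_cancel)
    then have "(v $ j)\<^sup>2 * (v $ j)\<^sup>2 \<le> (norm v)\<^sup>2 * (v $ j)\<^sup>2"
      by (intro mult_right_mono) auto
    then show "(v $ j) ^ 4 \<le> (norm v)\<^sup>2 * (v $ j)\<^sup>2"
      by (simp add: power4_eq_xxxx power2_eq_square mult.assoc)
  qed
  also have "\<dots> = norm v ^ 4"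
    unfolding sum_distrib_left[symmetric] n2 by (simp add: power4_eq_xxxx power2_eq_square)
  also have "\<dots> \<le> R ^ 4"
    using assms by (intro power_mono) auto
  finally have "power_sum 4 v \<le> R ^ 4" .
  moreover have "0 \<le> power_sum 4 v"
    unfolding power_sum_def by (intro sum_nonneg) simp
  moreover have "1 \<le> power_sum 2 v" "power_sum 2 v \<le> R\<^sup>2"
    using assms by (auto simp: power_sum_2 intro: power_mono one_le_power)
  ultimately show ?thesis
    using 3 by auto
qed

end

text \<open>The part of the Gaussian measure in \<open>C\<close> pushes forward, just below the
  maximum, to a measure with density a power of the distance to the maximum times \<open>F\<close>.
  The power is separated because it is unbounded for n = 3. The limit of \<open>F\<close> is the
  contribution of a single cap. Being free of chart data, the predicate can be combined over all
  outliers.\<close>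

definition cap_density :: "(real ^ 'n) set \<Rightarrow> real \<Rightarrow> (real \<Rightarrow> real) \<Rightarrow> bool" where
  "cap_density C \<eta> F \<longleftrightarrow> \<eta> > 0
      \<and> continuous_on {J_plus CARD('n) - \<eta><..<J_plus CARD('n)} F
      \<and> (\<forall>t\<in>{J_plus CARD('n) - \<eta><..<J_plus CARD('n)}. 0 \<le> F t)
      \<and> (F \<longlongrightarrow> (2 / lambda_n CARD('n)) powr ((real CARD('n) - 2) / 2) / 2 * ((real CARD('n) - 2) * cone_mass CARD('n)))
           (at_left (J_plus CARD('n)))
      \<and> (\<forall>B\<in>sets borel. B \<subseteq> {J_plus CARD('n) - \<eta><..<J_plus CARD('n)} \<longrightarrow>
          (\<integral>\<^sup>+x. ennreal (gauss x) * indicator C x * indicator B (JB (dir x)) \<partial>lborel)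
          = (\<integral>\<^sup>+t. indicator B t * ennreal ((J_plus CARD('n) - t) powr ((real CARD('n) - 4) / 2) * F t) \<partial>lborel))"

context outlier_chart
begin

definition cap :: "real \<Rightarrow> (real ^ 'n) set" where
  "cap r = {x. 0 < x \<bullet> e \<and> norm (pe x) < r * (x \<bullet> e)}"

lemma cap_measurable [measurable]: "cap r \<in> sets borel"
  unfolding cap_def by measurable

text \<open>Gnomonic coordinate on the tangent space at \<open>e\<close>: for
  \<open>x \<bullet> e > 0\<close> the vector \<open>center x\<close> is a positive multiple of
  \<open>e + slope x\<close>.\<close>

definition slope :: "real ^ 'n \<Rightarrow> real ^ 'n" where
  "slope x = (1 / (x \<bullet> e)) *\<^sub>R pe x"

lemma slope_tangent: "slope x \<in> tangent e"
  using perp_tangent[of x] by (simp add: slope_def tangent_iff)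

lemma slope_measurable [measurable]: "slope \<in> borel_measurable borel"
  unfolding slope_def by measurable

lemma power_sum_measurable [measurable]: "(power_sum k :: real ^ 'n \<Rightarrow> real) \<in> borel_measurable borel"
  unfolding power_sum_def by (intro borel_measurable_continuous_onI continuous_intros)

lemma profile_measurable [measurable]:
  assumes [measurable]: "q2 \<in> borel_measurable M" "q3 \<in> borel_measurable M"
    "q4 \<in> borel_measurable M" "u \<in> borel_measurable M"
  shows "(\<lambda>x. \<Phi> (q2 x) (q3 x) (q4 x) (u x)) \<in> borel_measurable M"
    and "(\<lambda>x. \<Psi> (q2 x) (q3 x) (q4 x) (u x)) \<in> borel_measurable M"
proof -
  have [measurable]: "(\<lambda>x. T2 (q2 x) (u x)) \<in> borel_measurable M"
    "(\<lambda>x. T3 (q2 x) (q3 x) (u x)) \<in> borel_measurable M"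
    "(\<lambda>x. T4 (q2 x) (q3 x) (q4 x) (u x)) \<in> borel_measurable M"
    unfolding T2_def T3_def T4_def by measurable
  show "(\<lambda>x. \<Phi> (q2 x) (q3 x) (q4 x) (u x)) \<in> borel_measurable M"
    and "(\<lambda>x. \<Psi> (q2 x) (q3 x) (q4 x) (u x)) \<in> borel_measurable M"
    unfolding \<Phi>_def \<Psi>_def by measurable
qed

lemma slope_in_q_box:
  assumes "x \<in> annulus"
  shows "(power_sum 2 (slope x), power_sum 3 (slope x), power_sum 4 (slope x)) \<in> q_box"
  unfolding q_box_def
  using assms by (intro power_sum_bounds) (auto simp: annulus_def slope_def field_simps)

lemma JB_dir_stretch:
  assumes "x \<bullet> e > 0"
  shows "JB (dir (stretch a e s x)) = \<Phi> (power_sum 2 (slope x)) (power_sum 3 (slope x)) (power_sum 4 (slope x)) s"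
proof -
  have "center (stretch a e s x) = (x \<bullet> e) *\<^sub>R (e + s *\<^sub>R slope x)"
    using assms by (simp add: center_eq stretch_inner perp_stretch slope_def scaleR_add_right)
  then have "dir (stretch a e s x) = sgn (e + s *\<^sub>R slope x)"
    using assms by (simp add: sgn_scaleR)
  then show ?thesis
    by (simp add: JB_ray[OF slope_tangent])
qed

text \<open>On \<open>annulus\<close> the slope is at most \<open>exp 1\<close>, so
  \<open>axial\<close> is bounded by a constant times the integrand of
  \<open>nn_integral_axial_annulus\<close>.\<close>

lemma axial_integrable: "integrable (restrict_space lborel annulus) axial"
proof (rule integrableI_nonneg)
  let ?d = "CARD('n) - 2"
  have "(\<integral>\<^sup>+x. ennreal (axial x) \<partial>restrict_space lborel annulus)
      = (\<integral>\<^sup>+x. ennreal (axial x) * indicator annulus x \<partial>lborel)"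
    by (rule nn_integral_restrict_space) simp
  also have "\<dots> \<le> (\<integral>\<^sup>+x. ennreal (exp 1 ^ ?d) * (indicator annulus x * ennreal (axial x * (x \<bullet> e / norm (pe x)) ^ ?d)) \<partial>lborel)"
  proof (intro nn_integral_mono)
    fix x :: "real ^ 'n"
    show "ennreal (axial x) * indicator annulus x
        \<le> ennreal (exp 1 ^ ?d) * (indicator annulus x * ennreal (axial x * (x \<bullet> e / norm (pe x)) ^ ?d))"
    proof (cases "x \<in> annulus")
      case True
      then have y: "x \<bullet> e > 0" "norm (pe x) > 0" "norm (pe x) \<le> exp 1 * (x \<bullet> e)"
        by (auto simp: annulus_def)
      then have "1 \<le> exp 1 * (x \<bullet> e / norm (pe x))"
        by (simp add: field_simps)
      then have "1 \<le> exp 1 ^ ?d * (x \<bullet> e / norm (pe x)) ^ ?d"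
        unfolding power_mult_distrib[symmetric] by (rule one_le_power)
      then have "axial x * 1 \<le> axial x * (exp 1 ^ ?d * (x \<bullet> e / norm (pe x)) ^ ?d)"
        using axial_pos[of x] by (intro mult_left_mono) auto
      then show ?thesis
        using True y axial_pos[of x]
        by (simp add: ennreal_mult[symmetric] mult_ac ennreal_leI)
    qed simp
  qed
  also have "\<dots> = ennreal (exp 1 ^ ?d) * (\<integral>\<^sup>+x. indicator annulus x * ennreal (axial x * (x \<bullet> e / norm (pe x)) ^ ?d) \<partial>lborel)"
    by (rule nn_integral_cmult) measurable
  also have "(\<integral>\<^sup>+x. indicator annulus x * ennreal (axial x * (x \<bullet> e / norm (pe x)) ^ ?d) \<partial>lborel)
      = ennreal (real ?d * cone_mass CARD('n))"
    using nn_integral_axial_annulus n3 by simp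
  finally show "(\<integral>\<^sup>+x. ennreal (axial x) \<partial>restrict_space lborel annulus) < \<infinity>"
    by (simp add: ennreal_mult_less_top order_le_less_trans)
qed (auto simp: axial_pos less_imp_le intro!: measurable_restrict_space1)

text \<open>An instance of \<open>radial_profile\<close> with rays labelled by
  \<open>annulus\<close>, m = n - 3 and \<open>g\<close> the Gaussian density along the ray. The cap
  radius \<open>r\<close> stays free up to \<open>s0\<close>, so that caps can later be shrunk until
  they are disjoint.\<close>

lemma chart_density:
  "\<exists>s0>0. \<forall>r. 0 < r \<longrightarrow> r \<le> s0 \<longrightarrow> (\<exists>\<eta> F. cap_density (cap r) \<eta> F)"
proof -
  define J where "J = J_plus CARD('n)"
  define m where "m = CARD('n) - 3"
  define M where "M = restrict_space lborel annulus"
  define \<phi> where "\<phi> x = \<Phi> (power_sum 2 (slope x)) (power_sum 3 (slope x)) (power_sum 4 (slope x))" for x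
  define \<psi> where "\<psi> x = \<Psi> (power_sum 2 (slope x)) (power_sum 3 (slope x)) (power_sum 4 (slope x))" for x
  define g where "g x s = axial x * exp (- (s * norm (pe x))\<^sup>2 / 2)" for x s
  have space_M: "space M = annulus"
    by (simp add: M_def space_restrict_space)
  have meas_M: "f \<in> borel_measurable M" if "f \<in> borel_measurable borel" for f :: "real ^ 'n \<Rightarrow> real"
    unfolding M_def using that by (intro measurable_restrict_space1) simp
  obtain s0 c2 where s0: "s0 > 0" "lam / 2 \<le> c2"
    and \<Psi>: "\<And>q2 q3 q4 s. (q2, q3, q4) \<in> q_box \<Longrightarrow> 0 \<le> s \<Longrightarrow> s \<le> s0 \<Longrightarrow> lam / 2 \<le> \<Psi> q2 q3 q4 s \<and> \<Psi> q2 q3 q4 s \<le> c2"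
    by (rule \<Psi>_bounds) blast
  have q2_nonneg: "power_sum 2 (slope x) \<ge> 0" for x
    by (simp add: power_sum_2)
  interpret R: radial_profile M \<phi> \<psi> g axial J s0 "lam / 2" c2 m
  proof (intro radial_profile.intro radial_profile_axioms.intro)
    show "sigma_finite_measure M"
      unfolding M_def by (rule sigma_finite_measure_restrict_space[OF sigma_finite_lborel]) simp
    show "s0 > 0" "0 < lam / 2" "lam / 2 \<le> c2"
      using s0 lam_pos by auto
    show "\<phi> x 0 = J" for x
      by (simp add: \<phi>_def \<Phi>_0 J_def)
    show "(\<phi> x has_real_derivative - (s * \<psi> x s)) (at s)" for x s
      unfolding \<phi>_def \<psi>_def by (rule \<Phi>_deriv[OF q2_nonneg])
    show "isCont (\<psi> x) s" for x s
    proof -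
      have "T2 (power_sum 2 (slope x)) s \<noteq> 0" for s
        using T2_pos[OF q2_nonneg, of x s] by simp
      then show ?thesis
        unfolding \<psi>_def \<Psi>_def[abs_def] T3_def T4_def
        by (intro continuous_intros) (auto simp: T2_def intro!: continuous_intros)
    qed
    show "lam / 2 \<le> \<psi> x s \<and> \<psi> x s \<le> c2" if "x \<in> space M" "0 \<le> s" "s \<le> s0" for x s
      unfolding \<psi>_def using that by (intro \<Psi> slope_in_q_box) (auto simp: space_M)
    show "isCont (g x) s" for x s
      unfolding g_def[abs_def] by (intro continuous_intros) auto
    show "0 \<le> g x s" for x s
      using axial_pos[of x] by (simp add: g_def)
    show "g x s \<le> axial x" for x s
      using axial_pos[of x] by (simp add: g_def)
    show "integrable M axial"
      unfolding M_def by (rule axial_integrable)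
    define q where "q k x = power_sum k (slope x)" for k x
    define z where "z x = norm (pe x)" for x
    have [measurable]: "q k \<in> borel_measurable M" "z \<in> borel_measurable M" "axial \<in> borel_measurable M" for k
      unfolding q_def[abs_def] z_def[abs_def] by (intro meas_M; measurable)+
    show "(\<lambda>(x, s). \<phi> x s) \<in> borel_measurable (M \<Otimes>\<^sub>M borel)"
      unfolding \<phi>_def q_def[symmetric] by measurable
    show "(\<lambda>(x, s). \<psi> x s) \<in> borel_measurable (M \<Otimes>\<^sub>M borel)"
      unfolding \<psi>_def q_def[symmetric] by measurable
    show "(\<lambda>(x, s). g x s) \<in> borel_measurable (M \<Otimes>\<^sub>M borel)"
      unfolding g_def z_def[symmetric] by measurable
  qed
  have m: "real m = N - 3"
    using n3 by (simp add: m_def N_def of_nat_diff)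
  have ex: "R.ex = (N - 4) / 2"
    by (simp add: R.ex_def m)
  \<comment> \<open>With \<open>\<rho>\<close> the reciprocal norm of the slope,
    \<open>\<psi> x 0\<close> is lam / \<rho>^2. The power \<open>ex\<close> contributes \<rho>^(n -
    4) and the division by \<open>\<psi>\<close> another \<rho>^2, which together give the integrand
    of \<open>nn_integral_axial_annulus\<close>.\<close>
  have limit: "(\<integral>x. (2 / \<psi> x 0) powr R.ex * g x 0 / \<psi> x 0 \<partial>M)
      = (2 / lam) powr ((N - 2) / 2) / 2 * ((N - 2) * cone_mass CARD('n))"
  proof -
    let ?d = "CARD('n) - 2"
    define c where "c = (2 / lam) powr ((N - 2) / 2) / 2"
    have c: "c > 0"
      using lam_pos by (simp add: c_def)
    have "(\<integral>x. (2 / \<psi> x 0) powr R.ex * g x 0 / \<psi> x 0 \<partial>M)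
        = (\<integral>x. c * (axial x * (x \<bullet> e / norm (pe x)) ^ ?d) \<partial>M)"
    proof (intro Bochner_Integration.integral_cong refl)
      fix x assume "x \<in> space M"
      then have y: "x \<bullet> e > 0" "norm (pe x) > 0"
        by (auto simp: space_M annulus_def)
      define \<rho> where "\<rho> = x \<bullet> e / norm (pe x)"
      have \<rho>: "\<rho> > 0"
        using y by (simp add: \<rho>_def)
      have "\<psi> x 0 = lam / \<rho>\<^sup>2"
        using y by (simp add: \<psi>_def \<Psi>_0 power_sum_2 slope_def \<rho>_def power_divide)
      moreover have "(2 / (lam / \<rho>\<^sup>2)) powr R.ex * A / (lam / \<rho>\<^sup>2) = c * (A * \<rho> ^ ?d)" for A
      proof -
        have "(2 / (lam / \<rho>\<^sup>2)) powr R.ex = (2 / lam) powr R.ex * (\<rho>\<^sup>2) powr R.ex"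
          using \<rho> lam_pos by (simp flip: powr_mult)
        also have "(\<rho>\<^sup>2) powr R.ex = \<rho> powr (2 * R.ex)"
          using \<rho> by (simp add: powr_powr flip: powr_numeral)
        also have "2 * R.ex = real ?d - 2"
          using n3 by (simp add: ex N_def of_nat_diff)
        also have "\<rho> powr (real ?d - 2) = \<rho> ^ ?d / \<rho>\<^sup>2"
          using \<rho> by (simp add: powr_diff powr_realpow)
        also have "(2 / lam) powr R.ex = (2 / lam) powr ((N - 2) / 2 - 1)"
          by (simp add: ex diff_divide_distrib)
        also have "\<dots> = c * lam"
          using lam_pos by (simp add: powr_diff c_def)
        finally have "(2 / (lam / \<rho>\<^sup>2)) powr R.ex = c * lam * (\<rho> ^ ?d / \<rho>\<^sup>2)" .
        then show ?thesis
          using \<rho> lam_pos by simp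
      qed
      ultimately show "(2 / \<psi> x 0) powr R.ex * g x 0 / \<psi> x 0 = c * (axial x * (x \<bullet> e / norm (pe x)) ^ ?d)"
        by (simp only: g_def \<rho>_def[symmetric]) simp
    qed
    also have "\<dots> = c * (\<integral>x. axial x * (x \<bullet> e / norm (pe x)) ^ ?d \<partial>M)"
      by simp
    also have "(\<integral>x. axial x * (x \<bullet> e / norm (pe x)) ^ ?d \<partial>M)
        = enn2real (\<integral>\<^sup>+x. ennreal (axial x * (x \<bullet> e / norm (pe x)) ^ ?d) \<partial>M)"
    proof (rule integral_eq_nn_integral)
      show "(\<lambda>x. axial x * (x \<bullet> e / norm (pe x)) ^ ?d) \<in> borel_measurable M"
        by (rule meas_M) measurable
      show "AE x in M. 0 \<le> axial x * (x \<bullet> e / norm (pe x)) ^ ?d"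
        using axial_pos by (intro AE_I2) (auto simp: space_M annulus_def less_imp_le)
    qed
    also have "(\<integral>\<^sup>+x. ennreal (axial x * (x \<bullet> e / norm (pe x)) ^ ?d) \<partial>M) = ennreal (real ?d * cone_mass CARD('n))"
    proof -
      have "(\<integral>\<^sup>+x. ennreal (axial x * (x \<bullet> e / norm (pe x)) ^ ?d) \<partial>M)
          = (\<integral>\<^sup>+x. ennreal (axial x * (x \<bullet> e / norm (pe x)) ^ ?d) * indicator annulus x \<partial>lborel)"
        unfolding M_def by (rule nn_integral_restrict_space) simp
      then show ?thesis
        using nn_integral_axial_annulus n3 by (simp add: mult.commute)
    qed
    finally show ?thesis
      using n3 cone_mass_pos[OF n3] by (simp add: c_def N_def of_nat_diff)
  qed
  show ?thesis
  proof (rule exI[of _ s0], intro conjI s0(1) allI impI)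
    fix r :: real assume r: "0 < r" "r \<le> s0"
    \<comment> \<open>The second entry ensures, through the lower quadratic bound, that a value
      above \<open>J - \<eta>\<close> at some s < s0 forces s < r / \<open>exp 1\<close>.\<close>
    define \<eta> where "\<eta> = min R.\<eta> (lam / 2 * (r / exp 1)\<^sup>2 / 2)"
    have \<eta>: "\<eta> > 0"
      using R.eta_pos lam_pos r by (simp add: \<eta>_def)
    have sub: "{J - \<eta><..<J} \<subseteq> {J - R.\<eta><..<J}"
      by (auto simp: \<eta>_def)
    have "(\<integral>\<^sup>+x. ennreal (gauss x) * indicator (cap r) x * indicator B (JB (dir x)) \<partial>lborel)
          = (\<integral>\<^sup>+t. indicator B t * ennreal ((J - t) powr ((N - 4) / 2) * R.F t) \<partial>lborel)"
      if B_meas [measurable]: "B \<in> sets borel" and B: "B \<subseteq> {J - \<eta><..<J}" for B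
    proof -
      define h where "h x = ennreal (gauss x) * indicator (cap r) x * indicator B (JB (dir x))" for x
      have [measurable]: "h \<in> borel_measurable borel"
        unfolding h_def[abs_def] by measurable
      have "(\<integral>\<^sup>+x. h x \<partial>lborel) = (\<integral>\<^sup>+x. h x * indicator {x. 0 < x \<bullet> e \<and> pe x \<noteq> 0} x \<partial>lborel)"
      proof (intro nn_integral_cong)
        fix x
        \<comment> \<open>On the axis of the cone the value is exactly \<open>J\<close>, which
          \<open>B\<close> excludes; this is the part that polar coordinates miss.\<close>
        have "JB (dir x) \<notin> B" if "0 < x \<bullet> e" "pe x = 0"
        proof -
          have "dir x = e"
            using that e_Omega by (simp add: center_eq sgn_scaleR sgn_div_norm)
          then have "JB (dir x) = J"
            using JB_eq_J_plus_iff[OF n3, of e] e_outlier outliers_subset_Omega[OF n3] by (auto simp: J_def)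
          then show ?thesis
            using B by auto
        qed
        then show "h x = h x * indicator {x. 0 < x \<bullet> e \<and> pe x \<noteq> 0} x"
          by (auto simp: h_def cap_def indicator_def)
      qed
      also have "\<dots> = (\<integral>\<^sup>+x. indicator annulus x *
         (\<integral>\<^sup>+s. ennreal (s ^ (CARD('n) - 3)) * indicator {0<..} s * h (stretch a e s x) \<partial>lborel) \<partial>lborel)"
        using n3 by (subst nn_integral_polar) auto
      also have "\<dots> = (\<integral>\<^sup>+x. (\<integral>\<^sup>+s. indicator {0<..<s0} s * ennreal (s ^ m * g x s) * indicator B (\<phi> x s) \<partial>lborel) * indicator annulus x \<partial>lborel)"
      proof (intro nn_integral_cong)
        fix x :: "real ^ 'n"
        show "indicator annulus x * (\<integral>\<^sup>+s. ennreal (s ^ (CARD('n) - 3)) * indicator {0<..} s * h (stretch a e s x) \<partial>lborel)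
          = (\<integral>\<^sup>+s. indicator {0<..<s0} s * ennreal (s ^ m * g x s) * indicator B (\<phi> x s) \<partial>lborel) * indicator annulus x"
        proof (cases "x \<in> annulus")
          case True
          then have y: "x \<bullet> e > 0" "x \<bullet> e \<le> norm (pe x)" "norm (pe x) \<le> exp 1 * (x \<bullet> e)"
            by (auto simp: annulus_def)
          have "ennreal (s ^ (CARD('n) - 3)) * indicator {0<..} s * h (stretch a e s x)
              = indicator {0<..<s0} s * ennreal (s ^ m * g x s) * indicator B (\<phi> x s)" for s
          proof (cases "s > 0 \<and> \<phi> x s \<in> B")
            case True
            have \<phi>: "JB (dir (stretch a e s x)) = \<phi> x s"
              unfolding \<phi>_def by (rule JB_dir_stretch[OF y(1)])
            have cap: "stretch a e s x \<in> cap r \<longleftrightarrow> s * norm (pe x) < r * (x \<bullet> e)"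
              using True y(1) by (simp add: cap_def stretch_inner perp_stretch)
            \<comment> \<open>For values in \<open>B\<close>, lying in the cap means the same as
              \<open>s < s0\<close>. Slopes over \<open>annulus\<close> are at least 1, which yields
              s < r \<le> s0; they are at most \<open>exp 1\<close>, which yields the converse from
              s < r / \<open>exp 1\<close>.\<close>
            have "s * norm (pe x) < r * (x \<bullet> e) \<longleftrightarrow> s < s0"
            proof
              assume less: "s * norm (pe x) < r * (x \<bullet> e)"
              have "s * (x \<bullet> e) \<le> s * norm (pe x)"
                using True y by (intro mult_left_mono) auto
              with less have "s * (x \<bullet> e) < r * (x \<bullet> e)"
                by simp
              then show "s < s0"
                using y(1) r by simp
            next
              assume "s < s0"
              then have "lam / 2 / 2 * (s\<^sup>2 - 0\<^sup>2) \<le> \<phi> x 0 - \<phi> x s"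
                using True \<open>x \<in> annulus\<close> by (intro R.quadratic_bounds) (auto simp: space_M)
              also have "\<phi> x 0 = J"
                by (simp add: \<phi>_def \<Phi>_0 J_def)
              also have "J - \<phi> x s < \<eta>"
                using True B by auto
              also have "\<eta> \<le> lam / 2 / 2 * (r / exp 1)\<^sup>2"
                by (simp add: \<eta>_def)
              finally have "s\<^sup>2 < (r / exp 1)\<^sup>2"
                using lam_pos by simp
              then have "s < r / exp 1"
                using r by (intro power_less_imp_less_base[of s 2]) auto
              have "s * norm (pe x) \<le> s * (exp 1 * (x \<bullet> e))"
                using True y by (intro mult_left_mono) auto
              also have "\<dots> = s * exp 1 * (x \<bullet> e)"
                by simp
              also have "\<dots> < r * (x \<bullet> e)"
                using \<open>s < r / exp 1\<close> y(1) by (simp add: field_simps)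
              finally show "s * norm (pe x) < r * (x \<bullet> e)" .
            qed
            then show ?thesis
              using True cap axial_pos[of x]
              by (auto simp: h_def \<phi> gauss_stretch g_def m_def indicator_def ennreal_mult[symmetric] mult_ac)
          next
            case False
            then show ?thesis
              using JB_dir_stretch[OF y(1), of s] by (auto simp: h_def \<phi>_def indicator_def)
          qed
          then show ?thesis
            using True by simp
        qed simp
      qed
      also have "\<dots> = (\<integral>\<^sup>+x. (\<integral>\<^sup>+s. indicator {0<..<s0} s * ennreal (s ^ m * g x s) * indicator B (\<phi> x s) \<partial>lborel) \<partial>M)"
        unfolding M_def by (rule nn_integral_restrict_space[symmetric]) simp
      also have "\<dots> = (\<integral>\<^sup>+t. indicator B t * ennreal ((J - t) powr ((N - 4) / 2) * R.F t) \<partial>lborel)"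
        unfolding ex[symmetric] using B sub by (intro R.level_integral) auto
      finally show ?thesis
        by (simp add: h_def)
    qed
    moreover have "continuous_on {J - \<eta><..<J} R.F"
      using R.F_continuous sub by (rule continuous_on_subset)
    moreover have "\<forall>t\<in>{J - \<eta><..<J}. 0 \<le> R.F t"
      using R.F_nonneg sub by (auto simp: subset_iff)
    moreover have "(R.F \<longlongrightarrow> (2 / lam) powr ((N - 2) / 2) / 2 * ((N - 2) * cone_mass CARD('n))) (at_left J)"
      using R.F_limit unfolding limit .
    ultimately have "cap_density (cap r) \<eta> R.F"
      using \<eta> unfolding cap_density_def J_def N_def lam_def by blast
    then show "\<exists>\<eta> F. cap_density (cap r) \<eta> F"
      by blast
  qed
qed

end

section \<open>The density near the maximum\<close>

text \<open>The cone \<open>cap\<close> of a chart, rewritten without the chart so that cones around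
  different outliers can be compared.\<close>

definition outlier_cap :: "real ^ 'n \<Rightarrow> real \<Rightarrow> (real ^ 'n) set" where
  "outlier_cap e r = {x. 0 < x \<bullet> e \<and> norm (center x - (x \<bullet> e) *\<^sub>R e) < r * (x \<bullet> e)}"

lemma outlier_cap_density:
  fixes e :: "real ^ 'n"
  assumes n: "CARD('n) \<ge> 3" and e: "e \<in> outliers"
  shows "\<exists>s0>0. \<forall>r. 0 < r \<longrightarrow> r \<le> s0 \<longrightarrow> (\<exists>\<eta> F. cap_density (outlier_cap e r) \<eta> F)"
proof -
  define N where "N = real CARD('n)"
  obtain i \<kappa> where "outlier_chart e i \<kappa> N"
    by (rule outlier_moments[OF n e N_def]) (use n e N_def in \<open>auto simp: outlier_chart_def\<close>)
  then interpret outlier_chart e i \<kappa> N .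
  have cap: "cap r = outlier_cap e r" for r
    by (auto simp: cap_def outlier_cap_def center_eq)
  show ?thesis
    using chart_density unfolding cap .
qed

lemma outlier_cap_open: "open (outlier_cap e r)"
  unfolding outlier_cap_def by (intro open_Collect_conj open_Collect_less continuous_intros)

lemma outlier_cap_measurable [measurable]: "outlier_cap e r \<in> sets borel"
  by (rule borel_open[OF outlier_cap_open])

lemma dir_in_outlier_cap_iff:
  fixes e :: "real ^ 'n"
  assumes e: "e \<bullet> 1 = 0" and x: "center x \<noteq> 0"
  shows "dir x \<in> outlier_cap e r \<longleftrightarrow> x \<in> outlier_cap e r"
proof -
  define c where "c = center x"
  define k where "k = inverse (norm c)"
  have k: "k > 0"
    using x by (simp add: k_def c_def)
  have ce: "c \<bullet> e = x \<bullet> e"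
    using e by (simp add: c_def center_def inner_diff_left inner_diff_right inner_commute)
  have dir: "dir x = k *\<^sub>R c"
    by (simp add: sgn_div_norm k_def c_def)
  have "center (dir x) = k *\<^sub>R c"
    unfolding dir by (simp add: center_def c_def center_inner_one[unfolded center_def])
  then have "center (dir x) - (dir x \<bullet> e) *\<^sub>R e = k *\<^sub>R (c - (x \<bullet> e) *\<^sub>R e)"
    by (simp add: dir ce algebra_simps)
  moreover have "dir x \<bullet> e = k * (x \<bullet> e)"
    by (simp add: dir ce)
  ultimately show ?thesis
    using k by (simp only: outlier_cap_def mem_Collect_eq norm_scaleR c_def[symmetric])
      (simp add: zero_less_mult_iff mult.left_commute[of r k])
qed

lemma finite_common_lower_bound:
  fixes f :: "'b \<Rightarrow> real"
  assumes "finite A" "\<And>x. x \<in> A \<Longrightarrow> f x > 0"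
  obtains \<delta> where "\<delta> > 0" "\<And>x. x \<in> A \<Longrightarrow> \<delta> \<le> f x"
proof (rule that[of "Min (insert 1 (f ` A))"])
  show "Min (insert 1 (f ` A)) > 0"
    using assms by (subst Min_gr_iff) auto
  show "Min (insert 1 (f ` A)) \<le> f x" if "x \<in> A" for x
    using assms that by (intro Min_le) auto
qed

text \<open>If x lies in both cones and y, y' are its components along e, e', then y e and y' e'
  differ by less than r (y + y'), and so do y and y'. Hence both y and y' times |e - e'| are below 2
  r (y + y'); adding gives |e - e'| < 4 r. A quarter of the least distance between outliers
  therefore suffices.\<close>

lemma outlier_caps_disjoint:
  assumes n: "CARD('n) \<ge> 3"
  obtains r0 where "r0 > 0"
    "\<And>r e e' x. r \<le> r0 \<Longrightarrow> e \<in> outliers \<Longrightarrow> e' \<in> outliers \<Longrightarrow> x \<in> outlier_cap e r \<Longrightarrow> x \<in> outlier_cap e' r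
      \<Longrightarrow> e = (e' :: real ^ 'n)"
proof -
  define P where "P = {p \<in> outliers \<times> outliers. fst p \<noteq> (snd p :: real ^ 'n)}"
  have "finite P"
    unfolding P_def using finite_cartesian_product[OF finite_outliers finite_outliers]
    by (rule rev_finite_subset) auto
  then obtain \<delta> where \<delta>: "\<delta> > 0" "\<And>p. p \<in> P \<Longrightarrow> \<delta> \<le> norm (fst p - snd p)"
    by (rule finite_common_lower_bound[of P "\<lambda>p. norm (fst p - snd p)"]) (auto simp: P_def)
  show ?thesis
  proof (rule that[of "\<delta> / 4"])
    fix r and e e' x :: "real ^ 'n"
    assume r: "r \<le> \<delta> / 4" and e: "e \<in> outliers" "e' \<in> outliers"
      and x: "x \<in> outlier_cap e r" "x \<in> outlier_cap e' r"
    define y y' where "y = x \<bullet> e" and "y' = x \<bullet> e'"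
    have y: "0 < y" "norm (center x - y *\<^sub>R e) < r * y" "0 < y'" "norm (center x - y' *\<^sub>R e') < r * y'"
      using x by (auto simp: outlier_cap_def y_def y'_def)
    have unit: "norm e = 1" "norm e' = 1"
      using e outliers_subset_Omega[OF n] by (auto simp: Omega_iff)
    have "norm (y *\<^sub>R e - y' *\<^sub>R e') \<le> norm (center x - y *\<^sub>R e) + norm (center x - y' *\<^sub>R e')"
      using norm_triangle_ineq4[of "center x - y' *\<^sub>R e'" "center x - y *\<^sub>R e"] by (simp add: add.commute)
    then have 1: "norm (y *\<^sub>R e - y' *\<^sub>R e') < r * (y + y')"
      using y by (simp add: algebra_simps)
    have 2: "\<bar>y - y'\<bar> \<le> norm (y *\<^sub>R e - y' *\<^sub>R e')"
      using norm_triangle_ineq3[of "y *\<^sub>R e" "y' *\<^sub>R e'"] y unit by simp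
    have "y * norm (e - e') = norm ((y *\<^sub>R e - y' *\<^sub>R e') + (y' - y) *\<^sub>R e')"
      using y(1) by (simp add: algebra_simps flip: scaleR_diff_right norm_scaleR)
        (metis abs_of_pos norm_scaleR scaleR_diff_right)
    also have "\<dots> \<le> norm (y *\<^sub>R e - y' *\<^sub>R e') + norm ((y' - y) *\<^sub>R e')"
      by (rule norm_triangle_ineq)
    also have "norm ((y' - y) *\<^sub>R e') = \<bar>y - y'\<bar>"
      using unit by simp
    finally have 3: "y * norm (e - e') < 2 * r * (y + y')"
      using 1 2 by simp
    have "y' * norm (e - e') = norm ((y *\<^sub>R e - y' *\<^sub>R e') + (y' - y) *\<^sub>R e)"
      using y(3) by (simp add: algebra_simps flip: scaleR_diff_right norm_scaleR)
        (metis abs_of_pos norm_scaleR scaleR_diff_right)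
    also have "\<dots> \<le> norm (y *\<^sub>R e - y' *\<^sub>R e') + norm ((y' - y) *\<^sub>R e)"
      by (rule norm_triangle_ineq)
    also have "norm ((y' - y) *\<^sub>R e) = \<bar>y - y'\<bar>"
      using unit by simp
    finally have 4: "y' * norm (e - e') < 2 * r * (y + y')"
      using 1 2 by simp
    have "(y + y') * norm (e - e') < (y + y') * (4 * r)"
      using 3 4 by (simp add: algebra_simps)
    then have "norm (e - e') < 4 * r"
      using y by simp
    then have "norm (e - e') < \<delta>"
      using r by simp
    then show "e = e'"
      using \<delta>(2)[of "(e, e')"] e by (auto simp: P_def)
  qed (use \<delta> in auto)
qed

text \<open>\<open>Omega\<close> without the open caps is compact and contains no outlier, so
  \<open>JB\<close> attains a maximum there that is strictly smaller than the global one.\<close>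

lemma near_max_in_outlier_cap:
  assumes n: "CARD('n) \<ge> 3" and r: "r > 0"
  obtains \<eta> where "\<eta> > 0"
    "\<And>u. u \<in> Omega \<Longrightarrow> J_plus CARD('n) - \<eta> < JB u \<Longrightarrow> \<exists>e\<in>outliers. u \<in> outlier_cap (e :: real ^ 'n) r"
proof -
  define S where "S = Omega - (\<Union>e\<in>outliers. outlier_cap (e :: real ^ 'n) r)"
  have "compact S"
    unfolding S_def by (intro compact_diff compact_Omega open_UN ballI outlier_cap_open)
  show ?thesis
  proof (cases "S = {}")
    case True
    then show ?thesis
      using that[of 1] by (auto simp: S_def)
  next
    case False
    have "continuous_on S JB"
      by (intro continuous_on_JB[OF continuous_on_id])
    then obtain v where v: "v \<in> S" "\<And>u. u \<in> S \<Longrightarrow> JB u \<le> JB v"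
      using continuous_attains_sup[OF \<open>compact S\<close> False] by metis
    have "v \<notin> outliers"
    proof
      assume e: "v \<in> outliers"
      then have "norm v = 1" "v \<bullet> 1 = 0"
        using outliers_subset_Omega[OF n] by (auto simp: Omega_iff)
      then have "v \<in> outlier_cap v r"
        using r by (simp add: outlier_cap_def center_def norm_eq_1)
      with e v(1) show False
        by (auto simp: S_def)
    qed
    then have "JB v < J_plus CARD('n)"
      using v(1) JB_eq_J_plus_iff[OF n, of v] JB_le_J_plus[OF n, of v] by (auto simp: S_def)
    then show ?thesis
    proof (intro that[of "J_plus CARD('n) - JB v"])
      fix u :: "real ^ 'n" assume u: "u \<in> Omega" "J_plus CARD('n) - (J_plus CARD('n) - JB v) < JB u"
      then have "u \<notin> S"
        using v(2)[of u] by auto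
      then show "\<exists>e\<in>outliers. u \<in> outlier_cap e r"
        using u by (auto simp: S_def)
    qed auto
  qed
qed

lemma JB_dir_density_near_max:
  assumes n: "CARD('n) \<ge> 3"
  obtains \<eta> F where "\<eta> > 0"
    "continuous_on {J_plus CARD('n) - \<eta><..<J_plus CARD('n)} F"
    "\<And>t. t \<in> {J_plus CARD('n) - \<eta><..<J_plus CARD('n)} \<Longrightarrow> 0 \<le> F t"
    "(F \<longlongrightarrow> (2 / lambda_n CARD('n)) powr ((real CARD('n) - 2) / 2) * (CARD('n) * (real CARD('n) - 2) * cone_mass CARD('n))) (at_left (J_plus CARD('n)))"
    "\<And>B. B \<in> sets borel \<Longrightarrow> B \<subseteq> {J_plus CARD('n) - \<eta><..<J_plus CARD('n)} \<Longrightarrow>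
      emeasure (distr gauss_measure borel (\<lambda>x :: real ^ 'n. JB (dir x))) B
        = (\<integral>\<^sup>+t. indicator B t * ennreal ((J_plus CARD('n) - t) powr ((real CARD('n) - 4) / 2) * F t) \<partial>lborel)"
proof -
  let ?O = "outliers :: (real ^ 'n) set"
  define N where "N = real CARD('n)"
  define J where "J = J_plus CARD('n)"
  define L where "L = (2 / lambda_n CARD('n)) powr ((N - 2) / 2) / 2 * ((N - 2) * cone_mass CARD('n))"
  note good_def = cap_density_def[where C = "C :: (real ^ 'n) set" for C, folded N_def, folded J_def L_def]
  have "\<forall>e\<in>?O. \<exists>s0>0. \<forall>r. 0 < r \<longrightarrow> r \<le> s0 \<longrightarrow> (\<exists>\<eta> F. cap_density (outlier_cap e r) \<eta> F)"
    using outlier_cap_density[OF n] by simp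
  from bchoice[OF this] obtain s0 where
    s0': "\<forall>e\<in>?O. s0 e > 0 \<and> (\<forall>r. 0 < r \<longrightarrow> r \<le> s0 e \<longrightarrow> (\<exists>\<eta> F. cap_density (outlier_cap e r) \<eta> F))" ..
  have s0: "s0 e > 0" "0 < r \<Longrightarrow> r \<le> s0 e \<Longrightarrow> \<exists>\<eta> F. cap_density (outlier_cap e r) \<eta> F" if "e \<in> ?O" for e r
    using bspec[OF s0' that] by simp_all
  obtain s1 where s1: "s1 > 0" "\<And>e. e \<in> ?O \<Longrightarrow> s1 \<le> s0 e"
    by (rule finite_common_lower_bound[where f = s0, OF finite_outliers s0(1)]) (assumption, rule that)
  obtain r0 where r0: "r0 > 0" "\<And>r e e' x. r \<le> r0 \<Longrightarrow> e \<in> ?O \<Longrightarrow> e' \<in> ?O \<Longrightarrow> x \<in> outlier_cap e r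
      \<Longrightarrow> x \<in> outlier_cap e' r \<Longrightarrow> e = e'"
    by (rule outlier_caps_disjoint[OF n]) blast
  \<comment> \<open>One radius for all caps: admissible in every chart and small enough for
    disjointness. The level widths depend on it and are therefore chosen only afterwards.\<close>
  define r where "r = min s1 r0"
  have r: "r > 0" "r \<le> r0" "\<And>e. e \<in> ?O \<Longrightarrow> r \<le> s0 e"
    using s1 r0 by (auto simp: r_def intro: min.coboundedI1)
  have "\<forall>e\<in>?O. \<exists>p. cap_density (outlier_cap e r) (fst p) (snd p)"
    using s0(2) r by simp
  from bchoice[OF this] obtain p where p: "\<forall>e\<in>?O. cap_density (outlier_cap e r) (fst (p e)) (snd (p e))" ..
  define \<eta>' where "\<eta>' e = fst (p e)" for e
  define F where "F e = snd (p e)" for e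
  have F: "cap_density (outlier_cap e r) (\<eta>' e) (F e)" if "e \<in> ?O" for e
    using p that by (simp add: \<eta>'_def F_def)
  have \<eta>'_pos: "\<eta>' e > 0" if "e \<in> ?O" for e
    using F[OF that] by (simp add: good_def)
  obtain \<eta>1 where \<eta>1: "\<eta>1 > 0" "\<And>e. e \<in> ?O \<Longrightarrow> \<eta>1 \<le> \<eta>' e"
    by (rule finite_common_lower_bound[where f = \<eta>', OF finite_outliers \<eta>'_pos]) (assumption, rule that)
  obtain \<eta>2 where \<eta>2: "\<eta>2 > 0" "\<And>u. u \<in> Omega \<Longrightarrow> J - \<eta>2 < JB u \<Longrightarrow> \<exists>e\<in>?O. u \<in> outlier_cap e r"
    unfolding J_def by (rule near_max_in_outlier_cap[OF n r(1)]) blast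
  define \<eta> where "\<eta> = min \<eta>1 \<eta>2"
  have sub: "{J - \<eta><..<J} \<subseteq> {J - \<eta>' e<..<J}" if "e \<in> ?O" for e
    using \<eta>1(2)[OF that] by (auto simp: \<eta>_def)
  define G where "G t = (\<Sum>e\<in>?O. F e t)" for t
  show ?thesis
  proof (rule that[of \<eta> G])
    show "\<eta> > 0"
      using \<eta>1 \<eta>2 by (simp add: \<eta>_def)
    show "continuous_on {J_plus CARD('n) - \<eta><..<J_plus CARD('n)} G"
      unfolding G_def[abs_def] J_def[symmetric]
    proof (rule continuous_on_sum)
      fix e assume e: "e \<in> ?O"
      show "continuous_on {J - \<eta><..<J} (F e)"
        using F[OF e] sub[OF e] unfolding good_def by (meson continuous_on_subset)
    qed
    show "0 \<le> G t" if "t \<in> {J_plus CARD('n) - \<eta><..<J_plus CARD('n)}" for t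
      unfolding G_def
    proof (rule sum_nonneg)
      fix e assume e: "e \<in> ?O"
      then have "t \<in> {J - \<eta>' e<..<J}"
        using that sub[OF e] by (auto simp: J_def)
      then show "0 \<le> F e t"
        using F[OF e] by (simp add: good_def)
    qed
    have "(G \<longlongrightarrow> (\<Sum>e\<in>?O. L)) (at_left J)"
      unfolding G_def[abs_def] using F by (intro tendsto_sum) (simp add: good_def)
    \<comment> \<open>Each of the 2 n caps contributes with a factor 1/2, whence the single factor
      n.\<close>
    also have "(\<Sum>e\<in>?O. L) = (2 / lambda_n CARD('n)) powr ((real CARD('n) - 2) / 2) * (CARD('n) * (real CARD('n) - 2) * cone_mass CARD('n))"
      by (simp add: card_outliers[OF n] L_def N_def)
    finally show "(G \<longlongrightarrow> (2 / lambda_n CARD('n)) powr ((real CARD('n) - 2) / 2) * (CARD('n) * (real CARD('n) - 2) * cone_mass CARD('n))) (at_left (J_plus CARD('n)))"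
      by (simp add: J_def)
  next
    fix B :: "real set"
    assume B_meas [measurable]: "B \<in> sets borel" and "B \<subseteq> {J_plus CARD('n) - \<eta><..<J_plus CARD('n)}"
    then have B: "B \<subseteq> {J - \<eta><..<J}"
      by (simp add: J_def)
    have "emeasure (distr gauss_measure borel (\<lambda>x :: real ^ 'n. JB (dir x))) B
        = (\<integral>\<^sup>+x. indicator B (JB (dir x)) \<partial>(gauss_measure :: (real ^ 'n) measure))"
      by (subst nn_integral_indicator[symmetric], simp, subst nn_integral_distr) auto
    also have "\<dots> = (\<integral>\<^sup>+x. ennreal (gauss x) * indicator B (JB (dir (x :: real ^ 'n))) \<partial>lborel)"
      unfolding gauss_measure_def by (subst nn_integral_density) auto
    also have "\<dots> = (\<integral>\<^sup>+x. (\<Sum>e\<in>?O. ennreal (gauss x) * indicator (outlier_cap e r) x * indicator B (JB (dir x))) \<partial>lborel)"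
      using AE_center_nonzero[OF n]
    proof (intro nn_integral_cong_AE, eventually_elim)
      case (elim x)
      show ?case
      proof (cases "JB (dir x) \<in> B")
        case True
        then have "J - \<eta> < JB (dir x)"
          using B by auto
        then have "J - \<eta>2 < JB (dir x)"
          by (simp add: \<eta>_def)
        then obtain e where e: "e \<in> ?O" "dir x \<in> outlier_cap e r"
          using \<eta>2(2) dir_in_Omega[OF elim(2)] by blast
        moreover have "e \<bullet> 1 = 0"
          using e outliers_subset_Omega[OF n] by (auto simp: Omega_iff)
        ultimately have x: "x \<in> outlier_cap e r"
          using dir_in_outlier_cap_iff[OF _ elim(2)] by blast
        have "(\<Sum>e'\<in>?O. ennreal (gauss x) * indicator (outlier_cap e' r) x * indicator B (JB (dir x)))
            = (\<Sum>e'\<in>{e}. ennreal (gauss x) * indicator (outlier_cap e' r) x * indicator B (JB (dir x)))"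
          using e(1) x r0(2)[OF r(2)] finite_outliers by (intro sum.mono_neutral_right) (auto simp: indicator_def)
        then show ?thesis
          using x by simp
      qed simp
    qed
    also have "\<dots> = (\<Sum>e\<in>?O. (\<integral>\<^sup>+x. ennreal (gauss x) * indicator (outlier_cap e r) x * indicator B (JB (dir x)) \<partial>lborel))"
      by (rule nn_integral_sum) measurable
    also have "\<dots> = (\<Sum>e\<in>?O. (\<integral>\<^sup>+t. indicator B t * ennreal ((J - t) powr ((N - 4) / 2) * F e t) \<partial>lborel))"
    proof (rule sum.cong[OF refl])
      fix e assume e: "e \<in> ?O"
      have "B \<subseteq> {J - \<eta>' e<..<J}"
        using B sub[OF e] by (rule order_trans)
      then show "(\<integral>\<^sup>+x. ennreal (gauss x) * indicator (outlier_cap e r) x * indicator B (JB (dir x)) \<partial>lborel)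
          = (\<integral>\<^sup>+t. indicator B t * ennreal ((J - t) powr ((N - 4) / 2) * F e t) \<partial>lborel)"
        using F[OF e] B_meas unfolding good_def by blast
    qed
    also have "\<dots> = (\<integral>\<^sup>+t. (\<Sum>e\<in>?O. indicator B t * ennreal ((J - t) powr ((N - 4) / 2) * F e t)) \<partial>lborel)"
    proof (rule nn_integral_sum[symmetric])
      fix e assume e: "e \<in> ?O"
      \<comment> \<open>Continuity, and with it measurability, of \<open>F e\<close> is known only
        on this interval. Since \<open>B\<close> lies inside, cutting \<open>F e\<close> off outside
        does not change the integrand.\<close>
      have "continuous_on {J - \<eta>' e<..<J} (F e)"
        using F[OF e] by (simp add: good_def)
      then have "(\<lambda>t. indicator {J - \<eta>' e<..<J} t *\<^sub>R F e t) \<in> borel_measurable borel"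
        by (intro borel_measurable_continuous_on_indicator) auto
      then have [measurable]: "(\<lambda>t. indicator B t * ennreal ((J - t) powr ((N - 4) / 2) * (indicator {J - \<eta>' e<..<J} t *\<^sub>R F e t))) \<in> borel_measurable borel"
        by measurable
      have "(\<lambda>t. indicator B t * ennreal ((J - t) powr ((N - 4) / 2) * (indicator {J - \<eta>' e<..<J} t *\<^sub>R F e t)))
          = (\<lambda>t. indicator B t * ennreal ((J - t) powr ((N - 4) / 2) * F e t))"
        using B sub[OF e] by (auto simp: fun_eq_iff indicator_def)
      then show "(\<lambda>t. indicator B t * ennreal ((J - t) powr ((N - 4) / 2) * F e t)) \<in> borel_measurable lborel"
        using \<open>(\<lambda>t. indicator B t * ennreal (_ * (_ *\<^sub>R F e t))) \<in> _\<close> by simp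
    qed
    also have "\<dots> = (\<integral>\<^sup>+t. indicator B t * ennreal ((J - t) powr ((N - 4) / 2) * G t) \<partial>lborel)"
    proof (intro nn_integral_cong)
      fix t
      show "(\<Sum>e\<in>?O. indicator B t * ennreal ((J - t) powr ((N - 4) / 2) * F e t))
          = indicator B t * ennreal ((J - t) powr ((N - 4) / 2) * G t)"
      proof (cases "t \<in> B")
        case True
        have "0 \<le> F e t" if e: "e \<in> ?O" for e
          using F[OF e] B sub[OF e] True unfolding good_def by blast
        then show ?thesis
          using True by (simp add: G_def sum_distrib_left sum_ennreal)
      qed simp
    qed
    finally show "emeasure (distr gauss_measure borel (\<lambda>x :: real ^ 'n. JB (dir x))) B
        = (\<integral>\<^sup>+t. indicator B t * ennreal ((J_plus CARD('n) - t) powr ((real CARD('n) - 4) / 2) * G t) \<partial>lborel)"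
      by (simp add: J_def N_def)
  qed
qed

section \<open>Tail integrals of densities with a power factor, and the constants\<close>

lemma nn_integral_powr_below:
  fixes p J \<epsilon> :: real
  assumes p: "p > -1" and \<epsilon>: "\<epsilon> > 0"
  shows "(\<integral>\<^sup>+t. indicator {J - \<epsilon><..<J} t * ennreal ((J - t) powr p) \<partial>lborel) = ennreal (\<epsilon> powr (p + 1) / (p + 1))"
proof -
  have "(\<integral>\<^sup>+t. indicator {J - \<epsilon><..<J} t * ennreal ((J - t) powr p) \<partial>lborel)
      = (\<integral>\<^sup>+s. indicator {J - \<epsilon><..<J} (J - s) * ennreal ((J - (J - s)) powr p) \<partial>lborel)"
    by (subst lborel_distr_diff_left[of J, symmetric], subst nn_integral_distr) auto
  also have "\<dots> = (\<integral>\<^sup>+s. ennreal (indicator {0..\<epsilon>} s * s powr p) \<partial>lborel)"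
  proof (intro nn_integral_cong_AE)
    have "AE s in lborel. s \<noteq> (0::real)" "AE s in lborel. s \<noteq> \<epsilon>"
      by (rule AE_lborel_singleton)+
    then show "AE s in lborel. indicator {J - \<epsilon><..<J} (J - s) * ennreal ((J - (J - s)) powr p)
        = ennreal (indicator {0..\<epsilon>} s * s powr p)"
      by eventually_elim (auto simp: indicator_def)
  qed
  also have "\<dots> = ennreal (\<epsilon> powr (p + 1) / (p + 1))"
  proof (rule nn_integral_has_integral_lebesgue)
    show "((\<lambda>s. s powr p) has_integral \<epsilon> powr (p + 1) / (p + 1)) {0..\<epsilon>}"
      using p \<epsilon> by (intro has_integral_powr_from_0) auto
  qed auto
  finally show ?thesis .
qed

lemma nn_integral_powr_below_scaled:
  fixes p J c \<epsilon> :: real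
  assumes p: "p > -1" and c: "c > 0" and \<epsilon>: "\<epsilon> > 0"
  shows "(\<integral>\<^sup>+t. indicator {J - \<epsilon><..<J} t * ennreal ((J - t) powr p * c) \<partial>lborel)
      = ennreal (c * (\<epsilon> powr (p + 1) / (p + 1)))"
proof -
  have "(\<integral>\<^sup>+t. indicator {J - \<epsilon><..<J} t * ennreal ((J - t) powr p * c) \<partial>lborel)
      = (\<integral>\<^sup>+t. ennreal c * (indicator {J - \<epsilon><..<J} t * ennreal ((J - t) powr p)) \<partial>lborel)"
    using c by (intro nn_integral_cong) (simp add: ennreal_mult mult_ac)
  also have "\<dots> = ennreal c * ennreal (\<epsilon> powr (p + 1) / (p + 1))"
    by (subst nn_integral_cmult) (auto simp: nn_integral_powr_below[OF p \<epsilon>])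
  also have "\<dots> = ennreal (c * (\<epsilon> powr (p + 1) / (p + 1)))"
    using c p by (intro ennreal_mult[symmetric]) auto
  finally show ?thesis .
qed

text \<open>Close to \<open>J\<close> the factor \<open>G\<close> lies between constants just below
  and just above \<open>L\<close>, and for a constant factor the integral is explicit.\<close>

lemma tail_integral_asymp:
  fixes p J \<eta> L :: real and G P :: "real \<Rightarrow> real"
  assumes p: "p > -1" and \<eta>: "\<eta> > 0" and L: "L > 0"
    and G: "(G \<longlongrightarrow> L) (at_left J)"
    and P: "\<And>\<epsilon>. 0 < \<epsilon> \<Longrightarrow> \<epsilon> < \<eta> \<Longrightarrow>
      ennreal (P \<epsilon>) = (\<integral>\<^sup>+t. indicator {J - \<epsilon><..<J} t * ennreal ((J - t) powr p * G t) \<partial>lborel)"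
    and P_nonneg: "\<And>\<epsilon>. 0 \<le> P \<epsilon>"
  shows "((\<lambda>\<epsilon>. P \<epsilon> / \<epsilon> powr (p + 1)) \<longlongrightarrow> L / (p + 1)) (at_right 0)"
proof (rule order_tendstoI)
  fix y assume y: "y < L / (p + 1)"
  \<comment> \<open>Midpoint between \<open>y * (p + 1)\<close> and \<open>L\<close>; the maximum
    with 0 keeps \<open>c\<close> positive even when \<open>y\<close> is negative.\<close>
  define c where "c = (max (y * (p + 1)) 0 + L) / 2"
  have "y * (p + 1) < L"
    using y p by (simp add: pos_less_divide_eq)
  then have c: "0 < c" "c < L" "y * (p + 1) < c"
    using L by (auto simp: c_def max_def)
  have "eventually (\<lambda>t. c < G t) (at_left J)"
    using G c by (intro order_tendstoD)
  then obtain b where b: "b < J" "\<And>t. b < t \<Longrightarrow> t < J \<Longrightarrow> c < G t"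
    unfolding eventually_at_left_field by auto
  have "eventually (\<lambda>\<epsilon>. \<epsilon> \<in> {0<..<min \<eta> (J - b)}) (at_right 0)"
    using \<eta> b by (intro eventually_at_right_real) auto
  then show "eventually (\<lambda>\<epsilon>. y < P \<epsilon> / \<epsilon> powr (p + 1)) (at_right 0)"
  proof eventually_elim
    case (elim \<epsilon>)
    then have \<epsilon>: "0 < \<epsilon>" "\<epsilon> < \<eta>" "b < J - \<epsilon>"
      by auto
    have "ennreal (c * (\<epsilon> powr (p + 1) / (p + 1))) \<le> ennreal (P \<epsilon>)"
      unfolding nn_integral_powr_below_scaled[OF p c(1) \<epsilon>(1), of J, symmetric] P[OF \<epsilon>(1,2)]
      using b(2) \<epsilon> by (intro nn_integral_mono) (auto simp: indicator_def less_imp_le intro!: ennreal_leI mult_left_mono)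
    then have "c * (\<epsilon> powr (p + 1) / (p + 1)) \<le> P \<epsilon>"
      using P_nonneg by simp
    then have "c / (p + 1) \<le> P \<epsilon> / \<epsilon> powr (p + 1)"
      using \<epsilon> by (simp add: pos_le_divide_eq)
    moreover have "y < c / (p + 1)"
      using c p by (simp add: pos_less_divide_eq)
    ultimately show ?case
      by simp
  qed
next
  fix y assume y: "L / (p + 1) < y"
  define c where "c = (y * (p + 1) + L) / 2"
  have "L < y * (p + 1)"
    using y p by (simp add: pos_divide_less_eq)
  then have c: "0 < c" "L < c" "c < y * (p + 1)"
    using L by (auto simp: c_def)
  have "eventually (\<lambda>t. G t < c) (at_left J)"
    using G c by (intro order_tendstoD)
  then obtain b where b: "b < J" "\<And>t. b < t \<Longrightarrow> t < J \<Longrightarrow> G t < c"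
    unfolding eventually_at_left_field by auto
  have "eventually (\<lambda>\<epsilon>. \<epsilon> \<in> {0<..<min \<eta> (J - b)}) (at_right 0)"
    using \<eta> b by (intro eventually_at_right_real) auto
  then show "eventually (\<lambda>\<epsilon>. P \<epsilon> / \<epsilon> powr (p + 1) < y) (at_right 0)"
  proof eventually_elim
    case (elim \<epsilon>)
    then have \<epsilon>: "0 < \<epsilon>" "\<epsilon> < \<eta>" "b < J - \<epsilon>"
      by auto
    have "ennreal (P \<epsilon>) \<le> ennreal (c * (\<epsilon> powr (p + 1) / (p + 1)))"
      unfolding nn_integral_powr_below_scaled[OF p c(1) \<epsilon>(1), of J, symmetric] P[OF \<epsilon>(1,2)]
      using b(2) \<epsilon> by (intro nn_integral_mono) (auto simp: indicator_def less_imp_le intro!: ennreal_leI mult_left_mono)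
    moreover have "0 \<le> c * (\<epsilon> powr (p + 1) / (p + 1))"
      using c p by simp
    ultimately have "P \<epsilon> \<le> c * (\<epsilon> powr (p + 1) / (p + 1))"
      by simp
    then have "P \<epsilon> / \<epsilon> powr (p + 1) \<le> c / (p + 1)"
      using \<epsilon> by (simp add: pos_divide_le_eq)
    moreover have "c / (p + 1) < y"
      using c p by (simp add: pos_divide_less_eq)
    ultimately show ?case
      by simp
  qed
qed

lemma cone_mass_c_n: "c_n n = 2 * real n * cone_mass n"
  by (simp add: c_n_def cone_mass_def)

lemma cone_mass_density_constant:
  assumes "n \<ge> 3"
  shows "real n * (real n - 2) * cone_mass n
    = real n * Gamma ((real n - 1) / 2) / (sqrt pi * Gamma ((real n - 2) / 2))"
proof -
  have "Gamma ((real n - 2) / 2 + 1) = (real n - 2) / 2 * Gamma ((real n - 2) / 2)"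
    using assms by (intro Gamma_plus1) (auto dest: nonpos_Ints_nonpos)
  moreover have "(real n - 2) / 2 + 1 = real n / 2"
    by (simp add: field_simps)
  ultimately have Gamma: "Gamma (real n / 2) = (real n - 2) / 2 * Gamma ((real n - 2) / 2)"
    by simp
  have "x * (x - 2) * (g / (2 * r * ((x - 2) / 2 * X))) = x * g / (r * X)" if "x - 2 \<noteq> 0" for x g r X :: real
    using that by (simp add: divide_simps)
  from this[of "real n"] show ?thesis
    using assms unfolding cone_mass_def Gamma by simp
qed

theorem proposition2:
  fixes M :: "'a measure" and U :: "'a \<Rightarrow> real ^ 'n" and n d :: nat
  assumes n: "n = CARD('n)" "n \<ge> 3"
    and d: "d = n - 2"
    and M: "prob_space M"
    and U: "uniform_on_Omega M U"
  shows
    "(\<forall>u\<in>(Omega :: (real ^ 'n) set). JB u \<le> J_plus n) \<and>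
     {u \<in> (Omega :: (real ^ 'n) set). JB u = J_plus n} = outliers \<and>
     card (outliers :: (real ^ 'n) set) = 2 * n \<and>
     (\<forall>u\<in>(outliers :: (real ^ 'n) set).
        has_riemannian_hessian JB u (\<lambda>v. - lambda_n n *\<^sub>R v)) \<and>
     (\<lambda>\<epsilon>. \<P>(x in M. JB (U x) > J_plus n - \<epsilon>))
        \<sim>[at_right 0] (\<lambda>\<epsilon>. c_n n * (2 * \<epsilon> / lambda_n n) powr (real d / 2)) \<and>
     (\<exists>f :: real \<Rightarrow> real.
        (\<forall>x. f x \<ge> 0) \<and>
        distributed M lborel (\<lambda>x. JB (U x)) (\<lambda>x. ennreal (f x)) \<and>
        (\<exists>a<J_plus n. continuous_on {a<..<J_plus n} f) \<and>
        f \<sim>[at_left (J_plus n)]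
          (\<lambda>x. real n * Gamma ((real n - 1) / 2) / (sqrt pi * Gamma ((real n - 2) / 2))
               * (2 / lambda_n n) powr (real d / 2) * (J_plus n - x) powr (real d / 2 - 1)))"
proof -
  have n3: "CARD('n) \<ge> 3"
    using n by simp
  interpret M: prob_space M by (rule M)
  define J where "J = J_plus n"
  define p where "p = (real n - 4) / 2"
  \<comment> \<open>The exponent is -1/2 for n = 3, still integrable, and p + 1 is the exponent of
    the tail probability.\<close>
  have p: "p > -1" "p + 1 = real d / 2" "p = real d / 2 - 1"
    using n d by (auto simp: p_def of_nat_diff field_simps)
  define C where "C = (2 / lambda_n n) powr (real d / 2) * (real n * (real n - 2) * cone_mass n)"
  have lam: "lambda_n n > 0"
    using lambda_n_pos n(2) .
  have C_pos: "C > 0"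
    using lam n cone_mass_pos[OF n(2)] by (simp add: C_def)
  have [measurable]: "U \<in> borel_measurable M"
    using U by (simp add: uniform_on_Omega_def)
  define \<mu> where "\<mu> = distr M borel (\<lambda>x. JB (U x))"
  have \<mu>_eq: "\<mu> = distr gauss_measure borel (\<lambda>x :: real ^ 'n. JB (dir x))"
  proof -
    have "\<mu> = distr (distr M borel U) borel JB"
      by (simp add: \<mu>_def distr_distr comp_def)
    also have "\<dots> = distr (distr gauss_measure borel (dir :: real ^ 'n \<Rightarrow> _)) borel JB"
      by (simp only: uniform_on_Omega_distr[OF n3 M U])
    finally show ?thesis
      by (simp add: distr_distr comp_def)
  qed
  have sets_\<mu> [simp, measurable_cong]: "sets \<mu> = sets borel"
    by (simp add: \<mu>_def)
  have "prob_space \<mu>"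
    unfolding \<mu>_def by (rule M.prob_space_distr) simp
  then interpret \<mu>: prob_space \<mu> .
  have ac: "absolutely_continuous lborel \<mu>"
    unfolding \<mu>_eq by (rule JB_dir_absolutely_continuous[OF n3])
  obtain \<eta> G where \<eta>: "\<eta> > 0"
    and *: "continuous_on {J_plus CARD('n) - \<eta><..<J_plus CARD('n)} G"
      "\<And>t. t \<in> {J_plus CARD('n) - \<eta><..<J_plus CARD('n)} \<Longrightarrow> 0 \<le> G t"
      "(G \<longlongrightarrow> (2 / lambda_n CARD('n)) powr ((real CARD('n) - 2) / 2) * (real CARD('n) * (real CARD('n) - 2) * cone_mass CARD('n))) (at_left (J_plus CARD('n)))"
      "\<And>B. B \<in> sets borel \<Longrightarrow> B \<subseteq> {J_plus CARD('n) - \<eta><..<J_plus CARD('n)} \<Longrightarrow>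
        emeasure (distr gauss_measure borel (\<lambda>x :: real ^ 'n. JB (dir x))) B
        = (\<integral>\<^sup>+t. indicator B t * ennreal ((J_plus CARD('n) - t) powr ((real CARD('n) - 4) / 2) * G t) \<partial>lborel)"
    by (rule JB_dir_density_near_max[OF n3]) (rule that)
  have G_cont: "continuous_on {J - \<eta><..<J} G"
    and G_nonneg: "\<And>t. t \<in> {J - \<eta><..<J} \<Longrightarrow> 0 \<le> G t"
    and G: "\<And>B. B \<in> sets borel \<Longrightarrow> B \<subseteq> {J - \<eta><..<J} \<Longrightarrow>
      emeasure \<mu> B = (\<integral>\<^sup>+t. indicator B t * ennreal ((J - t) powr p * G t) \<partial>lborel)"
    using * unfolding J_def p_def \<mu>_eq n(1) by simp_all
  have "real d = real n - 2"
    using n d by (simp add: of_nat_diff)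
  then have G_lim: "(G \<longlongrightarrow> C) (at_left J)"
    using *(3) unfolding C_def J_def n(1)[symmetric] by simp
  define A where "A = {J - \<eta><..<J}"
  have [measurable]: "A \<in> sets borel"
    by (simp add: A_def)
  obtain D where [measurable]: "D \<in> borel_measurable lborel"
    and D: "AE x in lborel. RN_deriv lborel \<mu> x = ennreal (D x)" "\<And>x. 0 \<le> D x"
    by (rule sigma_finite_measure.real_RN_deriv[OF sigma_finite_lborel \<mu>.finite_measure_axioms ac])
      (auto intro: that)
  have \<mu>_D: "\<mu> = density lborel (\<lambda>x. ennreal (D x))"
  proof -
    have "\<mu> = density lborel (RN_deriv lborel \<mu>)"
      using sigma_finite_measure.density_RN_deriv[OF sigma_finite_lborel ac] by simp
    also have "\<dots> = density lborel (\<lambda>x. ennreal (D x))"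
      using D(1) by (intro density_cong) auto
    finally show ?thesis .
  qed
  \<comment> \<open>Glued version of the density: explicit and continuous on \<open>A\<close>, where
    pointwise statements are made, and a real-valued Radon-Nikodym derivative elsewhere.\<close>
  define f where "f t = (if t \<in> A then (J - t) powr p * G t else D t)" for t
  have f_nonneg: "f t \<ge> 0" for t
    using G_nonneg D(2) by (auto simp: f_def A_def)
  have f_meas [measurable]: "f \<in> borel_measurable borel"
  proof -
    have "(\<lambda>t. indicator A t *\<^sub>R ((J - t) powr p * G t)) \<in> borel_measurable borel"
      using G_cont unfolding A_def
      by (intro borel_measurable_continuous_on_indicator continuous_intros) auto
    then have "(\<lambda>t. indicator A t *\<^sub>R ((J - t) powr p * G t) + indicator (- A) t * D t) \<in> borel_measurable borel"
      by measurable
    also have "(\<lambda>t. indicator A t *\<^sub>R ((J - t) powr p * G t) + indicator (- A) t * D t) = f"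
      by (auto simp: f_def fun_eq_iff indicator_def)
    finally show ?thesis .
  qed
  have \<mu>_f: "\<mu> = density lborel (\<lambda>x. ennreal (f x))"
  proof (rule measure_eqI)
    fix B assume "B \<in> sets \<mu>"
    then have [measurable]: "B \<in> sets borel"
      by simp
    have "emeasure \<mu> B = emeasure \<mu> (B \<inter> A) + emeasure \<mu> (B - A)"
      by (subst plus_emeasure) (auto intro!: arg_cong[where f = "emeasure \<mu>"])
    also have "emeasure \<mu> (B \<inter> A) = (\<integral>\<^sup>+t. indicator (B \<inter> A) t * ennreal ((J - t) powr p * G t) \<partial>lborel)"
      by (rule G) (auto simp: A_def)
    also have "\<dots> = (\<integral>\<^sup>+t. ennreal (f t) * indicator (B \<inter> A) t \<partial>lborel)"
      by (intro nn_integral_cong) (auto simp: f_def indicator_def)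
    also have "emeasure \<mu> (B - A) = (\<integral>\<^sup>+t. ennreal (D t) * indicator (B - A) t \<partial>lborel)"
      by (subst \<mu>_D, subst emeasure_density) auto
    also have "\<dots> = (\<integral>\<^sup>+t. ennreal (f t) * indicator (B - A) t \<partial>lborel)"
      by (intro nn_integral_cong) (auto simp: f_def indicator_def)
    also have "(\<integral>\<^sup>+t. ennreal (f t) * indicator (B \<inter> A) t \<partial>lborel) + (\<integral>\<^sup>+t. ennreal (f t) * indicator (B - A) t \<partial>lborel)
        = (\<integral>\<^sup>+t. ennreal (f t) * indicator (B \<inter> A) t + ennreal (f t) * indicator (B - A) t \<partial>lborel)"
      by (rule nn_integral_add[symmetric]) measurable
    also have "\<dots> = (\<integral>\<^sup>+t. ennreal (f t) * indicator B t \<partial>lborel)"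
      by (intro nn_integral_cong) (auto simp: indicator_def)
    also have "\<dots> = emeasure (density lborel (\<lambda>x. ennreal (f x))) B"
      by (subst emeasure_density) auto
    finally show "emeasure \<mu> B = emeasure (density lborel (\<lambda>x. ennreal (f x))) B" .
  qed simp
  \<comment> \<open>The value \<open>J\<close> is taken on \<open>Omega\<close>, but with
    probability 0 by absolute continuity. So the tail event agrees almost surely with an open
    interval of values below \<open>J\<close>, where \<open>G\<close> gives the density.\<close>
  have le_J: "AE x in M. JB (U x) < J"
  proof -
    have "AE x in M. JB (U x) \<le> J"
      using U JB_le_J_plus[OF n3] n unfolding uniform_on_Omega_def J_def by (auto elim: eventually_mono)
    moreover have "AE t in lborel. t \<noteq> J"
      by (rule AE_lborel_singleton)
    then have "AE t in \<mu>. t \<noteq> J"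
      unfolding \<mu>_D by (subst AE_density) (auto elim: eventually_mono)
    then have "AE x in M. JB (U x) \<noteq> J"
      unfolding \<mu>_def by (subst (asm) AE_distr_iff) auto
    ultimately show ?thesis
      by eventually_elim auto
  qed
  define P where "P \<epsilon> = \<P>(x in M. JB (U x) > J - \<epsilon>)" for \<epsilon>
  have P: "ennreal (P \<epsilon>) = (\<integral>\<^sup>+t. indicator {J - \<epsilon><..<J} t * ennreal ((J - t) powr p * G t) \<partial>lborel)"
    if "0 < \<epsilon>" "\<epsilon> < \<eta>" for \<epsilon>
  proof -
    have "ennreal (P \<epsilon>) = emeasure M {x \<in> space M. JB (U x) > J - \<epsilon>}"
      by (simp add: P_def M.emeasure_eq_measure)
    also have "\<dots> = emeasure M {x \<in> space M. JB (U x) \<in> {J - \<epsilon><..<J}}"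
      using le_J by (intro emeasure_eq_AE) (auto elim!: eventually_mono)
    also have "\<dots> = emeasure \<mu> {J - \<epsilon><..<J}"
      unfolding \<mu>_def by (subst emeasure_distr) (auto intro!: arg_cong[where f = "emeasure M"])
    also have "\<dots> = (\<integral>\<^sup>+t. indicator {J - \<epsilon><..<J} t * ennreal ((J - t) powr p * G t) \<partial>lborel)"
      using that by (intro G) auto
    finally show ?thesis .
  qed
  have "((\<lambda>\<epsilon>. P \<epsilon> / \<epsilon> powr (p + 1)) \<longlongrightarrow> C / (p + 1)) (at_right 0)"
    by (rule tail_integral_asymp[OF p(1) \<eta> C_pos G_lim P]) (auto simp: P_def)
  then have "(\<lambda>\<epsilon>. P \<epsilon> / \<epsilon> powr (p + 1)) \<sim>[at_right 0] (\<lambda>_. C / (p + 1))"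
    using C_pos p(1) by (intro tendsto_imp_asymp_equiv_const) auto
  then have "(\<lambda>\<epsilon>. P \<epsilon> / \<epsilon> powr (p + 1) * \<epsilon> powr (p + 1)) \<sim>[at_right 0] (\<lambda>\<epsilon>. C / (p + 1) * \<epsilon> powr (p + 1))"
    by (rule asymp_equiv_mult[OF _ asymp_equiv_refl])
  moreover have "eventually (\<lambda>\<epsilon>. P \<epsilon> / \<epsilon> powr (p + 1) * \<epsilon> powr (p + 1) = P \<epsilon>) (at_right 0)"
    by (rule eventually_mono[OF eventually_at_right_less[of "0::real"]]) simp
  moreover have "eventually (\<lambda>\<epsilon>. C / (p + 1) * \<epsilon> powr (p + 1) = c_n n * (2 * \<epsilon> / lambda_n n) powr (real d / 2)) (at_right 0)"
  proof (rule eventually_mono[OF eventually_at_right_less[of "0::real"]])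
    fix \<epsilon> :: real assume \<epsilon>: "0 < \<epsilon>"
    \<comment> \<open>Dividing by p + 1 = (n - 2) / 2 cancels the factor n - 2 in \<open>C\<close>
      and leaves 2 n \<open>cone_mass n\<close>, which is \<open>c_n n\<close>.\<close>
    have "C / (p + 1) = (2 / lambda_n n) powr (real d / 2) * c_n n"
      using n p(1) by (simp add: C_def cone_mass_c_n p_def field_simps)
    moreover have "(2 * \<epsilon> / lambda_n n) powr (real d / 2) = (2 / lambda_n n) powr (real d / 2) * \<epsilon> powr (real d / 2)"
      using \<epsilon> lam by (simp flip: powr_mult)
    ultimately show "C / (p + 1) * \<epsilon> powr (p + 1) = c_n n * (2 * \<epsilon> / lambda_n n) powr (real d / 2)"
      unfolding p(2) by simp
  qed
  ultimately have tail: "P \<sim>[at_right 0] (\<lambda>\<epsilon>. c_n n * (2 * \<epsilon> / lambda_n n) powr (real d / 2))"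
    by (subst (asm) asymp_equiv_cong) auto
  have near: "eventually (\<lambda>t. t \<in> A) (at_left J)"
    unfolding A_def using \<eta> by (intro eventually_at_left_real) simp
  have "G \<sim>[at_left J] (\<lambda>_. C)"
    using G_lim C_pos by (intro tendsto_imp_asymp_equiv_const) auto
  then have "(\<lambda>t. G t * (J - t) powr p) \<sim>[at_left J] (\<lambda>t. C * (J - t) powr p)"
    by (rule asymp_equiv_mult[OF _ asymp_equiv_refl])
  moreover have "eventually (\<lambda>t. G t * (J - t) powr p = f t) (at_left J)"
    using near by (rule eventually_mono) (simp add: f_def)
  moreover have "C * (J - t) powr p = real n * Gamma ((real n - 1) / 2) / (sqrt pi * Gamma ((real n - 2) / 2))
               * (2 / lambda_n n) powr (real d / 2) * (J - t) powr (real d / 2 - 1)" for t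
    unfolding C_def cone_mass_density_constant[OF n(2)] p(3) by simp
  ultimately have f_asymp: "f \<sim>[at_left J] (\<lambda>x. real n * Gamma ((real n - 1) / 2) / (sqrt pi * Gamma ((real n - 2) / 2))
               * (2 / lambda_n n) powr (real d / 2) * (J - x) powr (real d / 2 - 1))"
    by (subst (asm) asymp_equiv_cong) auto
  have f_cont: "continuous_on {J - \<eta><..<J} f"
  proof -
    have "continuous_on {J - \<eta><..<J} (\<lambda>t. (J - t) powr p * G t)"
      using G_cont by (intro continuous_intros) auto
    then show ?thesis
      by (rule continuous_on_cong[THEN iffD1, rotated -1]) (auto simp: f_def A_def)
  qed
  have "distributed M lborel (\<lambda>x. JB (U x)) (\<lambda>x. ennreal (f x))"
    unfolding distributed_def
  proof (intro conjI)
    have "distr M lborel (\<lambda>x. JB (U x)) = \<mu>"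
      unfolding \<mu>_def by (rule distr_cong) auto
    then show "distr M lborel (\<lambda>x. JB (U x)) = density lborel (\<lambda>x. ennreal (f x))"
      using \<mu>_f by simp
  qed auto
  moreover have "J - \<eta> < J"
    using \<eta> by simp
  ultimately have density: "\<exists>f :: real \<Rightarrow> real. (\<forall>x. f x \<ge> 0) \<and>
        distributed M lborel (\<lambda>x. JB (U x)) (\<lambda>x. ennreal (f x)) \<and>
        (\<exists>a<J. continuous_on {a<..<J} f) \<and>
        f \<sim>[at_left J] (\<lambda>x. real n * Gamma ((real n - 1) / 2) / (sqrt pi * Gamma ((real n - 2) / 2))
               * (2 / lambda_n n) powr (real d / 2) * (J - x) powr (real d / 2 - 1))"
    using f_nonneg f_cont f_asymp by blast
  have max: "{u \<in> (Omega :: (real ^ 'n) set). JB u = J_plus n} = outliers"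
    using JB_eq_J_plus_iff[OF n3] outliers_subset_Omega[OF n3] n by auto
  show ?thesis
    using JB_le_J_plus[OF n3] max card_outliers[OF n3] JB_has_riemannian_hessian[OF n3]
      tail density n(1)
    unfolding J_def P_def[abs_def] by simp
qed

end
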